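(* For all compositions $\eta,\gamma\in\mathbb{N}^n$, the coefficient $c_{\eta,\gamma}(r)$ in the expansion $x^{\underline\eta}=\sum_\gamma c_{\eta,\gamma}(r)\,x^\gamma$ is a polynomial in $\mathbb{N}[r]$ of degree at most $|\eta|-|\gamma|$.
   Context: Fix $n\ge1$. Let $r$ be an indeterminate, $\alpha=1/r$, $\mathbb{F}=\mathbb{Q}(r)$, and work in $\mathbb{F}[x_1,\dots,x_n]$. A composition is $\eta\in\mathbb{N}^n$ ($\mathbb{N}$ includes $0$), $|\eta|=\sum\eta_i$, $x^\eta=\prod x_i^{\eta_i}$; a partition is a weakly decreasing composition. Let $\delta=(n-1,\dots,1,0)$. Permutations act on vectors by $(wv)_{w(i)}=v_i$. For a composition $\gamma$ let $w_\gamma$ be the permutation of minimal length such that $w_\gamma^{-1}(\gamma)$ is a partition, and set $\overline\gamma=\gamma+w_\gamma(r\delta)$. It is known that for each composition $\eta$ there is a unique polynomial $E_\eta^{r\delta}$ of total degree $|\eta|$ vanishing at $\overline\gamma$ for all compositions $\gamma\ne\eta$ with $|\gamma|\le|\eta|$ and having coefficient $1$ on $x^\eta$; let $E_\eta^{(\alpha)}$ denote its homogeneous component of degree $|\eta|$ (the nonsymmetric Jack polynomial). For a box $(i,j)$ of $\eta$ ($1\le j\le\eta_i$) let $a_\eta(i,j)=\eta_i-j$, $l_\eta(i,j)=\#\{k>i:j\le\eta_k\le\eta_i\}+\#\{k<i:j\le\eta_k+1\le\eta_i\}$, and $d_\eta(\alpha)=\prod_s(\alpha(a_\eta(s)+1)+l_\eta(s)+1)$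 over boxes $s$ of $\eta$. Put $F_\eta^{(\alpha)}=d_\eta(\alpha)E_\eta^{(\alpha)}$ and $F_\eta^{r\delta}(x)=(-1)^{|\eta|}d_\eta(\alpha)E_\eta^{r\delta}(-x)$. Both families are $\mathbb{F}$-bases of $\mathbb{F}[x_1,\dots,x_n]$; the dehomogenization operator $\Xi$ is the unique $\mathbb{F}$-linear operator with $\Xi(F_\eta^{(\alpha)})=F_\eta^{r\delta}$ for all $\eta$. The bar monomial is $x^{\underline\eta}=\Xi(x^\eta)$. *)

theory Defs
  imports
    "HOL-Library.Poly_Mapping"
    "HOL-Library.FuncSet"
    "HOL-Combinatorics.Permutations"
    "HOL-Computational_Algebra.Polynomial_Factorial"
begin

text \<open>
  The field \<open>\<rat>(r)\<close> is the fraction field of \<open>\<rat>[r]\<close>. Exponent vectors are finitely supported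
  functions on the variable indices. For a fixed \<open>n\<close> the variables are \<open>x\<^sub>1, \<dots>, x\<^sub>n\<close>, so the ring
  \<open>\<rat>(r)[x\<^sub>1, \<dots>, x\<^sub>n]\<close> is the subset \<open>polys n\<close> of the type of polynomials in infinitely many variables.
\<close>

type_synonym ratfun = "rat poly fract"
type_synonym expo = "nat \<Rightarrow>\<^sub>0 nat"
type_synonym mpoly = "expo \<Rightarrow>\<^sub>0 ratfun"

definition r :: ratfun where
  "r = to_fract [:0, 1:]"

definition compositions :: "nat \<Rightarrow> expo set" where
  "compositions n = {\<eta>. Poly_Mapping.keys \<eta> \<subseteq> {1..n}}"

definition weight :: "expo \<Rightarrow> nat" where
  "weight \<eta> = (\<Sum>i\<in>Poly_Mapping.keys \<eta>. Poly_Mapping.lookup \<eta> i)"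

definition polys :: "nat \<Rightarrow> mpoly set" where
  "polys n = {p. Poly_Mapping.keys p \<subseteq> compositions n}"

definition coeff_of :: "mpoly \<Rightarrow> expo \<Rightarrow> ratfun" where
  "coeff_of p \<eta> = Poly_Mapping.lookup p \<eta>"

definition monomial :: "expo \<Rightarrow> mpoly" where
  "monomial \<eta> = Poly_Mapping.single \<eta> 1"

definition Const :: "ratfun \<Rightarrow> mpoly" where
  "Const c = Poly_Mapping.single 0 c"

definition Var :: "nat \<Rightarrow> mpoly" where
  "Var i = monomial (Poly_Mapping.single i 1)"

definition total_degree :: "mpoly \<Rightarrow> nat" where
  "total_degree p = Max (insert 0 (weight ` Poly_Mapping.keys p))"

definition homogeneous_component :: "nat \<Rightarrow> mpoly \<Rightarrow> mpoly" where
  "homogeneous_component d p =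
     (\<Sum>m | m \<in> Poly_Mapping.keys p \<and> weight m = d. Const (coeff_of p m) * monomial m)"

text \<open>Substitution of \<open>v i\<close> for \<open>x\<^sub>i\<close>, with coefficients mapped by \<open>f\<close>.\<close>

definition substitute :: "(ratfun \<Rightarrow> 'a::comm_ring_1) \<Rightarrow> (nat \<Rightarrow> 'a) \<Rightarrow> mpoly \<Rightarrow> 'a" where
  "substitute f v p = (\<Sum>m\<in>Poly_Mapping.keys p.
     f (coeff_of p m) * (\<Prod>i\<in>Poly_Mapping.keys m. v i ^ Poly_Mapping.lookup m i))"

definition eval_at :: "(nat \<Rightarrow> ratfun) \<Rightarrow> mpoly \<Rightarrow> ratfun" where
  "eval_at v p = substitute (\<lambda>c. c) v p"

definition negate_vars :: "mpoly \<Rightarrow> mpoly" where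
  "negate_vars p = substitute Const (\<lambda>i. - Var i) p"

text \<open>The action \<open>(w v)\<^bsub>w(i)\<^esub> = v\<^sub>i\<close>.\<close>

definition perm_act :: "(nat \<Rightarrow> nat) \<Rightarrow> (nat \<Rightarrow> 'a) \<Rightarrow> nat \<Rightarrow> 'a" where
  "perm_act w v = (\<lambda>k. v (inv w k))"

definition perm_length :: "nat \<Rightarrow> (nat \<Rightarrow> nat) \<Rightarrow> nat" where
  "perm_length n w = card {(i, j). i \<in> {1..n} \<and> j \<in> {1..n} \<and> i < j \<and> w j < w i}"

definition sorting_perm :: "nat \<Rightarrow> expo \<Rightarrow> nat \<Rightarrow> nat" where
  "sorting_perm n \<gamma> = (ARG_MIN (perm_length n) w.
     w permutes {1..n} \<and> antimono_on {1..n} (perm_act (inv w) (Poly_Mapping.lookup \<gamma>)))"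

text \<open>Only the entries with index in \<open>{1..n}\<close> matter below.\<close>

definition delta :: "nat \<Rightarrow> nat \<Rightarrow> ratfun" where
  "delta n i = of_nat (n - i)"

definition spectral_vector :: "nat \<Rightarrow> expo \<Rightarrow> nat \<Rightarrow> ratfun" where
  "spectral_vector n \<gamma> i = of_nat (Poly_Mapping.lookup \<gamma> i)
     + perm_act (sorting_perm n \<gamma>) (\<lambda>k. r * delta n k) i"

definition interp_poly :: "nat \<Rightarrow> expo \<Rightarrow> mpoly" where
  "interp_poly n \<eta> = (THE p. p \<in> polys n \<and> total_degree p = weight \<eta> \<and>
     (\<forall>\<gamma>\<in>compositions n. \<gamma> \<noteq> \<eta> \<and> weight \<gamma> \<le> weight \<eta> \<longrightarrow> eval_at (spectral_vector n \<gamma>) p = 0) \<and>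
     coeff_of p \<eta> = 1)"

definition jack_poly :: "nat \<Rightarrow> expo \<Rightarrow> mpoly" where
  "jack_poly n \<eta> = homogeneous_component (weight \<eta>) (interp_poly n \<eta>)"

definition boxes :: "nat \<Rightarrow> expo \<Rightarrow> (nat \<times> nat) set" where
  "boxes n \<eta> = (SIGMA i:{1..n}. {1..Poly_Mapping.lookup \<eta> i})"

definition arm :: "expo \<Rightarrow> nat \<times> nat \<Rightarrow> nat" where
  "arm \<eta> = (\<lambda>(i, j). Poly_Mapping.lookup \<eta> i - j)"

definition leg :: "nat \<Rightarrow> expo \<Rightarrow> nat \<times> nat \<Rightarrow> nat" where
  "leg n \<eta> = (\<lambda>(i, j).
     card {k \<in> {1..n}. k > i \<and> j \<le> Poly_Mapping.lookup \<eta> k \<and>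
                       Poly_Mapping.lookup \<eta> k \<le> Poly_Mapping.lookup \<eta> i}
   + card {k \<in> {1..n}. k < i \<and> j \<le> Poly_Mapping.lookup \<eta> k + 1 \<and>
                       Poly_Mapping.lookup \<eta> k + 1 \<le> Poly_Mapping.lookup \<eta> i})"

definition d_factor :: "nat \<Rightarrow> expo \<Rightarrow> ratfun \<Rightarrow> ratfun" where
  "d_factor n \<eta> \<alpha> =
     (\<Prod>s\<in>boxes n \<eta>. \<alpha> * (of_nat (arm \<eta> s) + 1) + of_nat (leg n \<eta> s) + 1)"

definition F_jack :: "nat \<Rightarrow> expo \<Rightarrow> mpoly" where
  "F_jack n \<eta> = Const (d_factor n \<eta> (1 / r)) * jack_poly n \<eta>"

definition F_interp :: "nat \<Rightarrow> expo \<Rightarrow> mpoly" where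
  "F_interp n \<eta> =
     Const ((- 1) ^ weight \<eta> * d_factor n \<eta> (1 / r)) * negate_vars (interp_poly n \<eta>)"

text \<open>
  As a function on all of the type \<open>mpoly\<close>, the operator is made unique by letting it be
  \<open>undefined\<close> outside \<open>polys n\<close>.
\<close>

definition dehomogenization :: "nat \<Rightarrow> mpoly \<Rightarrow> mpoly" where
  "dehomogenization n = (THE \<Xi>. \<Xi> \<in> polys n \<rightarrow>\<^sub>E polys n \<and>
     (\<forall>p\<in>polys n. \<forall>q\<in>polys n. \<Xi> (p + q) = \<Xi> p + \<Xi> q) \<and>
     (\<forall>c. \<forall>p\<in>polys n. \<Xi> (Const c * p) = Const c * \<Xi> p) \<and>
     (\<forall>\<eta>\<in>compositions n. \<Xi> (F_jack n \<eta>) = F_interp n \<eta>))"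

definition bar_monomial :: "nat \<Rightarrow> expo \<Rightarrow> mpoly" where
  "bar_monomial n \<eta> = dehomogenization n (monomial \<eta>)"

definition nat_poly_ratfun :: "nat poly \<Rightarrow> ratfun" where
  "nat_poly_ratfun c = to_fract (map_poly of_nat c)"

end

theory Submission
  imports Defs
begin

text \<open>
  Let \<open>p\<close> be homogeneous of degree \<open>d\<close>. Since evaluation at the points \<open>- \<gamma>\<close>-bar with \<open>|\<gamma>| < d\<close> is a
  bijection on polynomials of degree less than \<open>d\<close>, there is a unique \<open>q\<close> with top component \<open>p\<close>
  that vanishes at all these points, and \<open>\<Xi> p = q\<close>. This vanishing description shows at once that
  \<open>\<Xi>\<close> turns transpositions of neighbouring variables into Demazure-Lusztig operators and the cyclic
  shift \<open>x\<^sub>n f(x\<^sub>n, x\<^sub>1, \<dots>)\<close> into \<open>x\<^sub>n f(x\<^sub>n + 1, x\<^sub>1, \<dots>)\<close>. These two relations force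
  \<open>\<Xi> (x\<^sub>i p) = x\<^sub>i \<Xi> p + \<Xi> (Y\<^sub>i p)\<close> for the homogeneous Cherednik operators \<open>Y\<^sub>i\<close>, because every monomial
  is obtained from \<open>1\<close> by transpositions and the cyclic shift.

  If \<open>i\<close> is the leftmost index of a maximal entry of \<open>\<zeta> = \<nu> + e\<^sub>i\<close>, then all coefficients of
  \<open>Y\<^sub>i x\<^sup>\<nu>\<close> are polynomials of degree at most \<open>1\<close> with natural coefficients, so the relation with
  \<open>p = x\<^sup>\<nu>\<close> gives the positivity and the degree bound by induction on \<open>|\<zeta>|\<close>. The existence of the
  interpolation polynomials follows from triangularity of \<open>Y\<^sub>i\<close>: the relation makes the top component
  of a Lagrange polynomial a joint eigenfunction of the \<open>Y\<^sub>i\<close>, and its leading monomial must then have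
  the matching eigenvalues.
\<close>

section \<open>Polynomials as linear combinations of monomials\<close>

text \<open>The points carry a minus sign because \<open>F_interp\<close> evaluates the
  interpolation polynomial at -x; the factor (-1)^|\<eta>| then makes its top component equal to
  \<open>F_jack\<close>. The obstacle is that \<open>interp_poly\<close> and
  \<open>dehomogenization\<close> are definite descriptions, about which nothing is known before
  existence and uniqueness are proved. So \<open>lift\<close> is built from interpolation alone, the
  relations are proved for it, and \<Xi> is identified with it afterwards. Positivity is delicate
  because the divided difference of x^\<nu> in x_i and x_j has negative coefficients when \<nu>_j >
  \<nu>_i. Taking one box off a maximal entry of \<zeta> limits the excess of any other entry to 1,
  and taking the leftmost maximal entry confines this excess to j > i, where the constant built into
  the Cherednik operator cancels it. That r is an indeterminate enters through one fact: a + r b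
  determines the natural numbers a and b, so distinct compositions have distinct points.\<close>

abbreviation lookup where "lookup \<equiv> Poly_Mapping.lookup"
abbreviation keys where "keys \<equiv> Poly_Mapping.keys"
abbreviation single where "single \<equiv> Poly_Mapping.single"
abbreviation map_key where "map_key \<equiv> Poly_Mapping.map_key"

lemma lookup_Const_mult [simp]: "lookup (Const c * p) m = c * lookup p m"
proof -
  have "Const c * p = Poly_Mapping.map ((*) c) p"
    by (simp add: Const_def mult_map_scale_conv_mult)
  then show ?thesis by (simp add: Poly_Mapping.map.rep_eq when_def)
qed

lemma lookup_monomial: "lookup (monomial m) k = (if m = k then 1 else 0)"
  by (simp add: monomial_def lookup_single when_def)

lemma Const_0 [simp]: "Const 0 = 0" by (simp add: Const_def)
lemma Const_eq_0_iff [simp]: "Const c = 0 \<longleftrightarrow> c = 0"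
  by (metis Const_0 Const_def lookup_single_eq lookup_zero)
lemma Const_1 [simp]: "Const 1 = 1" by (simp add: Const_def)
lemma Const_add: "Const (a + b) = Const a + Const b" by (simp add: Const_def single_add)
lemma Const_mult: "Const (a * b) = Const a * Const b" by (simp add: Const_def mult_single)
lemma Const_uminus: "Const (- a) = - Const a" by (simp add: Const_def single_uminus)
lemma Const_of_nat: "Const (of_nat k) = of_nat k"
  by (induction k) (simp_all add: Const_add)

lemma monomial_0 [simp]: "monomial 0 = 1" by (simp add: monomial_def)
lemma monomial_add: "monomial (a + b) = monomial a * monomial b"
  by (simp add: monomial_def mult_single)
lemma monomial_single: "monomial (single i k) = Var i ^ k"
proof (induction k)
  case (Suc k)
  have "single i (Suc k) = single i 1 + single i k" by (simp flip: single_add)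
  then show ?case using Suc by (simp add: Var_def monomial_add)
qed simp

lemma keys_monomial [simp]: "keys (monomial m) = {m}" by (simp add: monomial_def)

lemma mpoly_expand_superset:
  assumes "finite S" "keys p \<subseteq> S"
  shows "p = (\<Sum>m\<in>S. Const (lookup p m) * monomial m)"
proof (rule poly_mapping_eqI)
  fix k
  have "lookup (\<Sum>m\<in>S. Const (lookup p m) * monomial m) k = (\<Sum>m\<in>S. if k = m then lookup p m else 0)"
    by (auto simp: lookup_sum lookup_monomial intro!: sum.cong)
  also have "\<dots> = lookup p k" using assms by (auto simp: in_keys_iff)
  finally show "lookup p k = lookup (\<Sum>m\<in>S. Const (lookup p m) * monomial m) k" by simp
qed

lemmas mpoly_expand = mpoly_expand_superset[OF finite_keys subset_refl]

definition support_in :: "expo set \<Rightarrow> mpoly set" where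
  "support_in S = {p. keys p \<subseteq> S}"

lemma support_inD: "p \<in> support_in S \<Longrightarrow> lookup p m \<noteq> 0 \<Longrightarrow> m \<in> S"
  by (auto simp: support_in_def in_keys_iff)

lemma support_inI: "(\<And>m. lookup p m \<noteq> 0 \<Longrightarrow> m \<in> S) \<Longrightarrow> p \<in> support_in S"
  by (auto simp: support_in_def in_keys_iff)

lemma polys_eq: "polys n = support_in (compositions n)"
  by (simp add: polys_def support_in_def)

lemma support_in_mono: "S \<subseteq> T \<Longrightarrow> p \<in> support_in S \<Longrightarrow> p \<in> support_in T"
  by (auto simp: support_in_def)

lemma support_in_0 [simp]: "0 \<in> support_in S" by (simp add: support_in_def)

lemma support_in_add: "p \<in> support_in S \<Longrightarrow> q \<in> support_in S \<Longrightarrow> p + q \<in> support_in S"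
  unfolding support_in_def using keys_add[of p q] by auto

lemma support_in_Const_mult: "p \<in> support_in S \<Longrightarrow> Const c * p \<in> support_in S"
  by (auto intro!: support_inI dest: support_inD)

lemma support_in_uminus: "p \<in> support_in S \<Longrightarrow> - p \<in> support_in S"
  by (auto intro!: support_inI dest: support_inD)

lemma support_in_diff: "p \<in> support_in S \<Longrightarrow> q \<in> support_in S \<Longrightarrow> p - q \<in> support_in S"
  using support_in_add[of p S "- q"] support_in_uminus by auto

lemma support_in_sum: "(\<And>i. i \<in> I \<Longrightarrow> f i \<in> support_in S) \<Longrightarrow> sum f I \<in> support_in S"
  by (induction I rule: infinite_finite_induct) (auto intro: support_in_add)

lemma support_in_monomial: "m \<in> S \<Longrightarrow> monomial m \<in> support_in S"
  by (simp add: support_in_def)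

section \<open>Linear operators and their extension from monomials\<close>

definition linear_op :: "(mpoly \<Rightarrow> mpoly) \<Rightarrow> bool" where
  "linear_op T \<longleftrightarrow> (\<forall>p q. T (p + q) = T p + T q) \<and> (\<forall>c p. T (Const c * p) = Const c * T p)"

lemma linear_op_add: "linear_op T \<Longrightarrow> T (p + q) = T p + T q"
  and linear_op_Const: "linear_op T \<Longrightarrow> T (Const c * p) = Const c * T p"
  by (auto simp: linear_op_def)

lemma linear_op_0: "linear_op T \<Longrightarrow> T 0 = 0"
  using linear_op_Const[of T 0 0] by simp

lemma linear_op_uminus: "linear_op T \<Longrightarrow> T (- p) = - T p"
  using linear_op_Const[of T "-1" p] by (simp add: Const_uminus)

lemma linear_op_diff: "linear_op T \<Longrightarrow> T (p - q) = T p - T q"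
  using linear_op_add[of T p "- q"] by (simp add: linear_op_uminus)

lemma linear_op_sum: "linear_op T \<Longrightarrow> T (sum f I) = (\<Sum>i\<in>I. T (f i))"
  by (induction I rule: infinite_finite_induct) (auto simp: linear_op_0 linear_op_add)

lemmas linear_op_simps = linear_op_0 linear_op_add linear_op_Const linear_op_uminus linear_op_diff

lemma linear_op_id: "linear_op (\<lambda>p. p)"
  by (simp add: linear_op_def)

lemma linear_op_comp: "linear_op T \<Longrightarrow> linear_op U \<Longrightarrow> linear_op (\<lambda>p. T (U p))"
  by (simp add: linear_op_def)

lemma linear_op_plus: "linear_op T \<Longrightarrow> linear_op U \<Longrightarrow> linear_op (\<lambda>p. T p + U p)"
  by (simp add: linear_op_def algebra_simps)

lemma linear_op_minus: "linear_op T \<Longrightarrow> linear_op U \<Longrightarrow> linear_op (\<lambda>p. T p - U p)"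
  by (simp add: linear_op_def algebra_simps)

lemma linear_op_mult: "linear_op T \<Longrightarrow> linear_op (\<lambda>p. q * T p)"
  by (simp add: linear_op_def algebra_simps)

lemma linear_op_lsum: "(\<And>i. i \<in> I \<Longrightarrow> linear_op (T i)) \<Longrightarrow> linear_op (\<lambda>p. \<Sum>i\<in>I. T i p)"
  by (simp add: linear_op_def sum.distrib sum_distrib_left)

lemma linear_op_expand:
  "linear_op T \<Longrightarrow> T p = (\<Sum>m\<in>keys p. Const (lookup p m) * T (monomial m))"
  by (subst mpoly_expand[of p]) (simp add: linear_op_sum linear_op_Const)

lemma linear_op_eq:
  assumes "linear_op T" "linear_op U" "\<And>m. m \<in> S \<Longrightarrow> T (monomial m) = U (monomial m)" "p \<in> support_in S"
  shows "T p = U p"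
  unfolding linear_op_expand[OF assms(1), of p] linear_op_expand[OF assms(2), of p]
  using assms(3,4) by (auto simp: support_in_def intro!: sum.cong)

lemma linear_op_support_in:
  assumes "linear_op T" "\<And>m. m \<in> S \<Longrightarrow> T (monomial m) \<in> support_in S'" "p \<in> support_in S"
  shows "T p \<in> support_in S'"
  unfolding linear_op_expand[OF assms(1), of p]
  using assms(2,3) by (auto simp: support_in_def intro!: support_in_sum[unfolded support_in_def, simplified]
      support_in_Const_mult[unfolded support_in_def, simplified])

text \<open>The result is linear on the whole type, not only on \<open>polys n\<close>. Values on
  monomials that come from \<open>SOME\<close> or \<open>THE\<close> (quotients by x_i - x_j, lifts)
  thus yield linear operators without further proof.\<close>

definition linear_extension :: "(expo \<Rightarrow> mpoly) \<Rightarrow> mpoly \<Rightarrow> mpoly" where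
  "linear_extension g p = (\<Sum>m\<in>keys p. Const (lookup p m) * g m)"

lemma linear_extension_superset:
  "finite S \<Longrightarrow> keys p \<subseteq> S \<Longrightarrow> linear_extension g p = (\<Sum>m\<in>S. Const (lookup p m) * g m)"
  unfolding linear_extension_def by (rule sum.mono_neutral_left) (auto simp: in_keys_iff)

lemma linear_op_extension: "linear_op (linear_extension g)"
  unfolding linear_op_def
proof safe
  fix p q :: mpoly
  let ?S = "keys p \<union> keys q"
  show "linear_extension g (p + q) = linear_extension g p + linear_extension g q"
    using keys_add[of p q]
    by (simp add: linear_extension_superset[of ?S] lookup_add Const_add algebra_simps sum.distrib)
next
  fix c and p :: mpoly
  have "keys (Const c * p) \<subseteq> keys p" by (auto simp: in_keys_iff)
  then show "linear_extension g (Const c * p) = Const c * linear_extension g p"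
    by (simp add: linear_extension_superset[of "keys p"] Const_mult sum_distrib_left mult.assoc)
qed

lemma linear_extension_monomial [simp]: "linear_extension g (monomial m) = g m"
  by (simp add: linear_extension_def lookup_monomial)

section \<open>Substitution and evaluation homomorphisms\<close>

definition eval_monomial :: "(nat \<Rightarrow> 'a::comm_ring_1) \<Rightarrow> expo \<Rightarrow> 'a" where
  "eval_monomial v m = (\<Prod>i\<in>keys m. v i ^ lookup m i)"

lemma eval_monomial_superset:
  "finite A \<Longrightarrow> keys m \<subseteq> A \<Longrightarrow> eval_monomial v m = (\<Prod>i\<in>A. v i ^ lookup m i)"
  unfolding eval_monomial_def by (rule prod.mono_neutral_left) (auto simp: in_keys_iff)

lemma eval_monomial_0 [simp]: "eval_monomial v 0 = 1"
  by (simp add: eval_monomial_def)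

lemma eval_monomial_add: "eval_monomial v (a + b) = eval_monomial v a * eval_monomial v b"
  using keys_add[of a b]
  by (simp add: eval_monomial_superset[of "keys a \<union> keys b"] lookup_add power_add prod.distrib)

lemma eval_monomial_single [simp]: "eval_monomial v (single i k) = v i ^ k"
  by (simp add: eval_monomial_superset[of "{i}"])

lemma substitute_superset:
  assumes "f 0 = 0" "finite S" "keys p \<subseteq> S"
  shows "substitute f v p = (\<Sum>m\<in>S. f (lookup p m) * eval_monomial v m)"
  unfolding substitute_def coeff_of_def eval_monomial_def[symmetric]
  using assms by (intro sum.mono_neutral_left) (auto simp: in_keys_iff)

text \<open>Covers two cases at once: the identity for evaluation in \<open>ratfun\<close>, and
  \<open>Const\<close> for substituting polynomials into polynomials.\<close>

locale coefficient_hom =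
  fixes f :: "ratfun \<Rightarrow> 'a::comm_ring_1"
  assumes f_1 [simp]: "f 1 = 1"
    and f_add: "f (a + b) = f a + f b"
    and f_mult: "f (a * b) = f a * f b"
begin

lemma f_0 [simp]: "f 0 = 0"
  using f_add[of 0 0] by simp

lemma substitute_add: "substitute f v (p + q) = substitute f v p + substitute f v q"
  using keys_add[of p q]
  by (simp add: substitute_superset[of f "keys p \<union> keys q"] lookup_add f_add algebra_simps sum.distrib)

lemma substitute_0 [simp]: "substitute f v 0 = 0"
  by (simp add: substitute_def)

lemma substitute_sum: "substitute f v (sum g I) = (\<Sum>i\<in>I. substitute f v (g i))"
  by (induction I rule: infinite_finite_induct) (simp_all add: substitute_add)

lemma substitute_Const_mult: "substitute f v (Const c * p) = f c * substitute f v p"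
proof -
  have "keys (Const c * p) \<subseteq> keys p" by (auto simp: in_keys_iff)
  then show ?thesis
    by (simp add: substitute_superset[of f "keys p"] f_mult sum_distrib_left mult.assoc)
qed

lemma substitute_monomial: "substitute f v (monomial m) = eval_monomial v m"
  by (simp add: substitute_superset[of f "{m}"] lookup_monomial)

lemma substitute_mult: "substitute f v (p * q) = substitute f v p * substitute f v q"
proof -
  have "p * q = (\<Sum>m\<in>keys p. Const (lookup p m) * monomial m) * (\<Sum>k\<in>keys q. Const (lookup q k) * monomial k)"
    by (simp flip: mpoly_expand)
  also have "\<dots> = (\<Sum>m\<in>keys p. \<Sum>k\<in>keys q. Const (lookup p m) * (Const (lookup q k) * monomial (m + k)))"
    unfolding sum_product monomial_add by (simp only: mult_ac)
  also have "substitute f v \<dots> = (\<Sum>m\<in>keys p. \<Sum>k\<in>keys q.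
      f (lookup p m) * (f (lookup q k) * (eval_monomial v m * eval_monomial v k)))"
    by (simp add: substitute_sum substitute_Const_mult substitute_monomial eval_monomial_add)
  also have "\<dots> = substitute f v p * substitute f v q"
    by (simp add: substitute_superset[of f "keys p"] substitute_superset[of f "keys q"]
        sum_product algebra_simps)
  finally show ?thesis .
qed

lemma substitute_1 [simp]: "substitute f v 1 = 1"
  using substitute_monomial[of v 0] by simp

lemma substitute_Const [simp]: "substitute f v (Const c) = f c"
  using substitute_Const_mult[of v c 1] by simp

lemma substitute_Var [simp]: "substitute f v (Var i) = v i"
  by (simp add: Var_def substitute_monomial)

lemma substitute_uminus: "substitute f v (- p) = - substitute f v p"
  using substitute_add[of v p "- p"] by (simp add: eq_neg_iff_add_eq_0 add.commute)

lemma substitute_diff: "substitute f v (p - q) = substitute f v p - substitute f v q"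
  using substitute_add[of v p "- q"] by (simp add: substitute_uminus)

lemma hom_substitute:
  fixes h :: "'a \<Rightarrow> 'b::comm_ring_1"
  assumes "h 0 = 0" "h 1 = 1" "\<And>x y. h (x + y) = h x + h y" "\<And>x y. h (x * y) = h x * h y"
  shows "h (substitute f v p) = substitute (\<lambda>c. h (f c)) (\<lambda>i. h (v i)) p"
proof -
  have hs: "h (sum g I) = (\<Sum>i\<in>I. h (g i))" for g and I :: "expo set"
    by (induction I rule: infinite_finite_induct) (simp_all add: assms)
  have hp: "h (prod g I) = (\<Prod>i\<in>I. h (g i))" for g and I :: "nat set"
    by (induction I rule: infinite_finite_induct) (simp_all add: assms)
  have hpow: "h (x ^ k) = h x ^ k" for x k
    by (induction k) (simp_all add: assms)
  show ?thesis
    unfolding substitute_def hs assms(4) hp hpow ..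
qed

end

text \<open>Needed because the coordinates of points are computed and compared only at indices in
  \<open>{1..n}\<close>.\<close>

lemma substitute_cong:
  assumes "p \<in> polys n" "\<And>i. i \<in> {1..n} \<Longrightarrow> v i = w i"
  shows "substitute f v p = substitute f w p"
proof -
  have "v i ^ lookup m i = w i ^ lookup m i" if "m \<in> keys p" "i \<in> keys m" for m i
  proof -
    have "i \<in> {1..n}" using assms(1) that unfolding polys_def compositions_def by blast
    then show ?thesis using assms(2) by simp
  qed
  then have "(\<Prod>i\<in>keys m. v i ^ lookup m i) = (\<Prod>i\<in>keys m. w i ^ lookup m i)" if "m \<in> keys p" for m
    using that by (intro prod.cong) auto
  then show ?thesis unfolding substitute_def by (intro sum.cong) simp_all
qed

lemma coefficient_hom_ident: "coefficient_hom (\<lambda>c. c)"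
  by (rule coefficient_hom.intro) simp_all

lemma coefficient_hom_Const: "coefficient_hom Const"
  by (rule coefficient_hom.intro) (simp_all add: Const_add Const_mult)

lemmas sub_simps [simp] =
  coefficient_hom.substitute_add[OF coefficient_hom_Const]
  coefficient_hom.substitute_mult[OF coefficient_hom_Const]
  coefficient_hom.substitute_uminus[OF coefficient_hom_Const]
  coefficient_hom.substitute_diff[OF coefficient_hom_Const]
  coefficient_hom.substitute_0[OF coefficient_hom_Const]
  coefficient_hom.substitute_1[OF coefficient_hom_Const]
  coefficient_hom.substitute_Const[OF coefficient_hom_Const]
  coefficient_hom.substitute_Var[OF coefficient_hom_Const]

abbreviation sub :: "(nat \<Rightarrow> mpoly) \<Rightarrow> mpoly \<Rightarrow> mpoly" where
  "sub \<equiv> substitute Const"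

lemma eval_at_simps [simp]:
  "eval_at v 0 = 0" "eval_at v 1 = 1" "eval_at v (Const c) = c" "eval_at v (Var i) = v i"
  "eval_at v (p + q) = eval_at v p + eval_at v q"
  "eval_at v (p * q) = eval_at v p * eval_at v q"
  "eval_at v (p - q) = eval_at v p - eval_at v q"
  "eval_at v (- p) = - eval_at v p"
  unfolding eval_at_def
  by (fact coefficient_hom.substitute_0[OF coefficient_hom_ident]
    coefficient_hom.substitute_1[OF coefficient_hom_ident]
    coefficient_hom.substitute_Const[OF coefficient_hom_ident]
    coefficient_hom.substitute_Var[OF coefficient_hom_ident]
    coefficient_hom.substitute_add[OF coefficient_hom_ident]
    coefficient_hom.substitute_mult[OF coefficient_hom_ident]
    coefficient_hom.substitute_diff[OF coefficient_hom_ident]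
    coefficient_hom.substitute_uminus[OF coefficient_hom_ident])+

lemma eval_at_sum: "eval_at v (sum g I) = (\<Sum>i\<in>I. eval_at v (g i))"
  by (simp add: eval_at_def coefficient_hom.substitute_sum[OF coefficient_hom_ident])

lemma eval_at_cong:
  "p \<in> polys n \<Longrightarrow> (\<And>i. i \<in> {1..n} \<Longrightarrow> v i = w i) \<Longrightarrow> eval_at v p = eval_at w p"
  unfolding eval_at_def by (rule substitute_cong)

lemma eval_at_sub: "eval_at w (sub u p) = eval_at (\<lambda>i. eval_at w (u i)) p"
proof -
  have "eval_at w (sub u p) = substitute (\<lambda>c. eval_at w (Const c)) (\<lambda>i. eval_at w (u i)) p"
    by (rule coefficient_hom.hom_substitute[OF coefficient_hom_Const]) simp_all
  then show ?thesis
    unfolding eval_at_def[of "\<lambda>i. eval_at w (u i)"] by simp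
qed

lemma sub_sub: "sub w (sub u p) = sub (\<lambda>i. sub w (u i)) p"
proof -
  have "sub w (sub u p) = substitute (\<lambda>c. sub w (Const c)) (\<lambda>i. sub w (u i)) p"
    by (rule coefficient_hom.hom_substitute[OF coefficient_hom_Const]) simp_all
  then show ?thesis by simp
qed

lemma linear_op_sub: "linear_op (sub u)"
  by (simp add: linear_op_def)

lemma eval_monomial_Var:
  "eval_monomial (\<lambda>i. Var (w i)) m = monomial (\<Sum>i\<in>keys m. single (w i) (lookup m i))"
proof -
  have "monomial (sum g I) = (\<Prod>i\<in>I. monomial (g i))" for g and I :: "nat set"
    by (induction I rule: infinite_finite_induct) (simp_all add: monomial_add)
  then show ?thesis by (simp add: eval_monomial_def monomial_single)
qed

section \<open>Renaming of variables\<close>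

definition permute_vars :: "(nat \<Rightarrow> nat) \<Rightarrow> mpoly \<Rightarrow> mpoly" where
  "permute_vars w = sub (\<lambda>i. Var (w i))"

lemma permute_vars_simps:
  "permute_vars w 0 = 0" "permute_vars w 1 = 1"
  "permute_vars w (Const c) = Const c" "permute_vars w (Var i) = Var (w i)"
  "permute_vars w (p + q) = permute_vars w p + permute_vars w q"
  "permute_vars w (p * q) = permute_vars w p * permute_vars w q"
  "permute_vars w (p - q) = permute_vars w p - permute_vars w q"
  "permute_vars w (- p) = - permute_vars w p"
  by (simp_all add: permute_vars_def)

lemma linear_op_permute_vars: "linear_op (permute_vars w)"
  unfolding permute_vars_def by (rule linear_op_sub)

lemma permute_vars_sum: "permute_vars w (sum g I) = (\<Sum>i\<in>I. permute_vars w (g i))"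
  by (rule linear_op_sum[OF linear_op_permute_vars])

lemma permute_vars_comp: "permute_vars w (permute_vars u p) = permute_vars (\<lambda>i. w (u i)) p"
  by (simp add: permute_vars_def sub_sub)

lemma lookup_map_key: "inj f \<Longrightarrow> lookup (map_key f m) i = lookup m (f i)"
  by (simp add: map_key.rep_eq)

text \<open>The exponent of x_i becomes that of x_(w i), so the new exponent at \<open>k\<close> is
  the old one at \<open>inv w k\<close>.\<close>

lemma permute_vars_monomial:
  assumes "bij w"
  shows "permute_vars w (monomial m) = monomial (map_key (inv w) m)"
proof -
  have "(\<Sum>i\<in>keys m. single (w i) (lookup m i)) = map_key (inv w) m"
  proof (rule poly_mapping_eqI)
    fix k
    have "lookup (\<Sum>i\<in>keys m. single (w i) (lookup m i)) k = (\<Sum>i\<in>keys m. if i = inv w k then lookup m i else 0)"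
      using assms by (auto simp: lookup_sum lookup_single when_def bij_inv_eq_iff intro!: sum.cong)
    also have "\<dots> = lookup (map_key (inv w) m) k"
      using bij_imp_bij_inv[OF assms] by (simp add: lookup_map_key bij_is_inj in_keys_iff)
    finally show "lookup (\<Sum>i\<in>keys m. single (w i) (lookup m i)) k = lookup (map_key (inv w) m) k" .
  qed
  then show ?thesis by (simp add: permute_vars_def coefficient_hom.substitute_monomial[OF coefficient_hom_Const] eval_monomial_Var)
qed

lemma permute_vars_id: "permute_vars (\<lambda>i. i) p = p"
proof (rule linear_op_eq[OF linear_op_permute_vars linear_op_id, of UNIV])
  show "permute_vars (\<lambda>i. i) (monomial m) = monomial m" for m
    using permute_vars_monomial[of "\<lambda>i. i" m] Poly_Mapping.map_key_id[of m] bij_id by (simp add: inv_id id_def)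
qed (simp add: support_in_def)

section \<open>Compositions, degrees and spectral vectors\<close>

lemma compositions_lookup: "\<eta> \<in> compositions n \<Longrightarrow> i \<notin> {1..n} \<Longrightarrow> lookup \<eta> i = 0"
  unfolding compositions_def mem_Collect_eq using not_in_keys_iff_lookup_eq_zero[of i \<eta>] by blast

lemma compositionsI: "(\<And>i. i \<notin> {1..n} \<Longrightarrow> lookup \<eta> i = 0) \<Longrightarrow> \<eta> \<in> compositions n"
  unfolding compositions_def mem_Collect_eq using not_in_keys_iff_lookup_eq_zero[of _ \<eta>] by blast

lemma compositions_0 [simp]: "0 \<in> compositions n"
  by (simp add: compositions_def)

lemma compositions_add: "a \<in> compositions n \<Longrightarrow> b \<in> compositions n \<Longrightarrow> a + b \<in> compositions n"
  by (auto intro!: compositionsI simp: lookup_add compositions_lookup)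

lemma compositions_single: "i \<in> {1..n} \<Longrightarrow> single i k \<in> compositions n"
  by (auto intro!: compositionsI simp: lookup_single when_def)

lemma compositions_mono: "m \<le> n \<Longrightarrow> \<eta> \<in> compositions m \<Longrightarrow> \<eta> \<in> compositions n"
  by (auto intro!: compositionsI simp: compositions_lookup)

lemma weight_superset: "finite A \<Longrightarrow> keys \<eta> \<subseteq> A \<Longrightarrow> weight \<eta> = (\<Sum>i\<in>A. lookup \<eta> i)"
  unfolding weight_def by (rule sum.mono_neutral_left) (auto simp: in_keys_iff)

lemma weight_eq: "\<eta> \<in> compositions n \<Longrightarrow> weight \<eta> = (\<Sum>i\<in>{1..n}. lookup \<eta> i)"
  by (rule weight_superset) (auto simp: compositions_def)

lemma weight_0 [simp]: "weight 0 = 0"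
  by (simp add: weight_def)

lemma weight_single [simp]: "weight (single i k) = k"
  by (simp add: weight_superset[of "{i}"])

lemma weight_add [simp]: "weight (a + b) = weight a + weight b"
  using keys_add[of a b]
  by (simp add: weight_superset[of "keys a \<union> keys b"] lookup_add sum.distrib)

lemma weight_eq_0_iff [simp]: "weight \<eta> = 0 \<longleftrightarrow> \<eta> = 0"
proof
  assume "weight \<eta> = 0"
  then have "\<forall>i\<in>keys \<eta>. lookup \<eta> i = 0" by (simp add: weight_def)
  then show "\<eta> = 0" by (intro poly_mapping_eqI) (auto simp: in_keys_iff)
qed simp

lemma lookup_le_weight: "lookup \<eta> i \<le> weight \<eta>"
proof (cases "i \<in> keys \<eta>")
  case True
  then show ?thesis unfolding weight_def by (intro member_le_sum) auto
qed (simp add: in_keys_iff)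

text \<open>The strict bound makes \<open>polys_below n 0\<close> the zero space, so lower-order
  remainders of a polynomial of degree \<open>d\<close> need no special case at
  \<open>d = 0\<close>.\<close>

definition comps_below :: "nat \<Rightarrow> nat \<Rightarrow> expo set" where
  "comps_below n d = {\<eta> \<in> compositions n. weight \<eta> < d}"

definition comps_of_weight :: "nat \<Rightarrow> nat \<Rightarrow> expo set" where
  "comps_of_weight n d = {\<eta> \<in> compositions n. weight \<eta> = d}"

lemma comps_below_0 [simp]: "comps_below n 0 = {}"
  by (simp add: comps_below_def)

lemma comps_below_Suc: "comps_below n (Suc d) = comps_below n d \<union> comps_of_weight n d"
  by (auto simp: comps_below_def comps_of_weight_def)

lemma finite_comps_below [simp]: "finite (comps_below n d)"
proof (rule finite_imageD)
  have "lookup ` comps_below n d \<subseteq> {f. \<forall>i. (i \<in> {1..n} \<longrightarrow> f i \<in> {..<d}) \<and> (i \<notin> {1..n} \<longrightarrow> f i = 0)}"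
    using lookup_le_weight
    by (auto simp: comps_below_def compositions_lookup intro: le_less_trans)
  then show "finite (lookup ` comps_below n d)"
    by (rule finite_subset) (rule finite_set_of_finite_funs, auto)
  show "inj_on lookup (comps_below n d)"
    by (auto intro!: inj_onI poly_mapping_eqI)
qed

lemma finite_comps_of_weight [simp]: "finite (comps_of_weight n d)"
  using finite_comps_below[of n "Suc d"] by (simp add: comps_below_Suc)

abbreviation polys_below :: "nat \<Rightarrow> nat \<Rightarrow> mpoly set" where
  "polys_below n d \<equiv> support_in (comps_below n d)"

abbreviation homogeneous :: "nat \<Rightarrow> nat \<Rightarrow> mpoly set" where
  "homogeneous n d \<equiv> support_in (comps_of_weight n d)"

lemma polys_below_mono: "d \<le> e \<Longrightarrow> p \<in> polys_below n d \<Longrightarrow> p \<in> polys_below n e"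
  by (erule support_in_mono[rotated]) (auto simp: comps_below_def)

lemma polys_below_polys: "p \<in> polys_below n d \<Longrightarrow> p \<in> polys n"
  unfolding polys_eq by (erule support_in_mono[rotated]) (auto simp: comps_below_def)

lemma homogeneous_polys_below: "p \<in> homogeneous n d \<Longrightarrow> p \<in> polys_below n (Suc d)"
  by (erule support_in_mono[rotated]) (auto simp: comps_below_def comps_of_weight_def)

lemma homogeneous_polys: "p \<in> homogeneous n d \<Longrightarrow> p \<in> polys n"
  by (blast intro: homogeneous_polys_below polys_below_polys)

lemma polys_below_index_mono: "m \<le> n \<Longrightarrow> p \<in> polys_below m d \<Longrightarrow> p \<in> polys_below n d"
  by (erule support_in_mono[rotated]) (auto simp: comps_below_def intro: compositions_mono)

lemma polys_below_mult:
  assumes "p \<in> polys_below n (Suc a)" "q \<in> polys_below n (Suc b)"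
  shows "p * q \<in> polys_below n (Suc (a + b))"
  unfolding support_in_def
proof safe
  fix k assume "k \<in> keys (p * q)"
  then obtain x y where "k = x + y" "x \<in> keys p" "y \<in> keys q" using keys_mult[of p q] by blast
  moreover from this have "x \<in> comps_below n (Suc a)" "y \<in> comps_below n (Suc b)"
    using assms by (auto simp: support_in_def)
  ultimately show "k \<in> comps_below n (Suc (a + b))"
    by (auto simp: comps_below_def compositions_add)
qed

lemma polys_below_Const: "Const c \<in> polys_below n (Suc 0)"
  using support_in_Const_mult[OF support_in_monomial[of 0 "comps_below n (Suc 0)"], of c]
  by (simp add: comps_below_def)

lemma polys_below_1: "1 \<in> polys_below n (Suc 0)"
  using polys_below_Const[of 1] by simp

lemma homogeneous_Var: "i \<in> {1..n} \<Longrightarrow> Var i \<in> homogeneous n 1"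
  by (auto simp: Var_def comps_of_weight_def intro!: support_in_monomial compositions_single)

lemma polys_below_Var: "i \<in> {1..n} \<Longrightarrow> Var i \<in> polys_below n (Suc (Suc 0))"
  using homogeneous_polys_below[OF homogeneous_Var] by simp

lemma polys_below_Var_mult:
  assumes "i \<in> {1..n}" "p \<in> polys_below n d"
  shows "Var i * p \<in> polys_below n (Suc d)"
proof (cases d)
  case 0
  then have "p = 0" using assms(2) by (simp add: support_in_def)
  then show ?thesis by simp
next
  case (Suc d')
  then show ?thesis using polys_below_mult[OF polys_below_Var[OF assms(1)], of p d'] assms(2) by simp
qed

lemma homogeneous_mult:
  assumes "p \<in> homogeneous n a" "q \<in> homogeneous n b"
  shows "p * q \<in> homogeneous n (a + b)"
  unfolding support_in_def
proof safe
  fix k assume "k \<in> keys (p * q)"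
  then obtain x y where "k = x + y" "x \<in> keys p" "y \<in> keys q" using keys_mult[of p q] by blast
  moreover from this have "x \<in> comps_of_weight n a" "y \<in> comps_of_weight n b"
    using assms by (auto simp: support_in_def)
  ultimately show "k \<in> comps_of_weight n (a + b)"
    by (auto simp: comps_of_weight_def compositions_add)
qed

lemma homogeneous_Var_mult:
  "i \<in> {1..n} \<Longrightarrow> p \<in> homogeneous n d \<Longrightarrow> Var i * p \<in> homogeneous n (Suc d)"
  using homogeneous_mult[OF homogeneous_Var, of i n p d] by simp

lemma polys_below_power: "p \<in> polys_below n (Suc (Suc 0)) \<Longrightarrow> p ^ k \<in> polys_below n (Suc k)"
proof (induction k)
  case (Suc k)
  then show ?case using polys_below_mult[of p n 1 "p ^ k" k] by simp
qed (simp add: polys_below_1)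

lemma polys_below_sub:
  assumes u: "\<And>i. i \<in> {1..n} \<Longrightarrow> u i \<in> polys_below n (Suc (Suc 0))" and "p \<in> polys_below n d"
  shows "sub u p \<in> polys_below n d"
proof (rule linear_op_support_in[OF linear_op_sub _ assms(2)])
  fix m assume m: "m \<in> comps_below n d"
  have "(\<Prod>i\<in>A. u i ^ lookup m i) \<in> polys_below n (Suc (\<Sum>i\<in>A. lookup m i))" if "A \<subseteq> {1..n}" for A
    using finite_subset[OF that finite_atLeastAtMost] that
    by (induction A rule: finite_induct) (auto intro!: polys_below_1 polys_below_mult polys_below_power u)
  from this[of "{1..n}"] have "sub u (monomial m) \<in> polys_below n (Suc (weight m))"
    using m weight_eq[of m n]
    by (auto simp: coefficient_hom.substitute_monomial[OF coefficient_hom_Const] comps_below_def compositions_def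
        eval_monomial_superset[of "{1..n}"])
  moreover have "Suc (weight m) \<le> d" using m by (simp add: comps_below_def)
  ultimately show "sub u (monomial m) \<in> polys_below n d" by (rule polys_below_mono[rotated])
qed

lemma compositions_map_key: "w permutes {1..n} \<Longrightarrow> m \<in> compositions n \<Longrightarrow> map_key w m \<in> compositions n"
  by (auto intro!: compositionsI simp: lookup_map_key permutes_inj compositions_lookup permutes_not_in)

lemma weight_map_key: "w permutes {1..n} \<Longrightarrow> m \<in> compositions n \<Longrightarrow> weight (map_key w m) = weight m"
  using sum.permute[of w "{1..n}" "lookup m"]
  by (simp add: weight_eq[of _ n] compositions_map_key lookup_map_key permutes_inj comp_def)

lemma permute_vars_support:
  assumes w: "w permutes {1..n}"
  shows "p \<in> homogeneous n d \<Longrightarrow> permute_vars w p \<in> homogeneous n d"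
    and "p \<in> polys_below n d \<Longrightarrow> permute_vars w p \<in> polys_below n d"
    and "p \<in> polys n \<Longrightarrow> permute_vars w p \<in> polys n"
proof -
  note [simp] = permute_vars_monomial[OF permutes_bij[OF w]] compositions_map_key[OF permutes_inv[OF w]]
    weight_map_key[OF permutes_inv[OF w]]
  show "permute_vars w p \<in> homogeneous n d" if "p \<in> homogeneous n d"
    by (rule linear_op_support_in[OF linear_op_permute_vars _ that])
      (simp add: comps_of_weight_def support_in_monomial)
  show "permute_vars w p \<in> polys_below n d" if "p \<in> polys_below n d"
    by (rule linear_op_support_in[OF linear_op_permute_vars _ that])
      (simp add: comps_below_def support_in_monomial)
  show "permute_vars w p \<in> polys n" if "p \<in> polys n"
    unfolding polys_eq
    by (rule linear_op_support_in[OF linear_op_permute_vars _ that[unfolded polys_eq]])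
      (simp add: support_in_monomial)
qed

lemma linear_op_homogeneous:
  assumes "linear_op T" "\<And>m. m \<in> compositions n \<Longrightarrow> T (monomial m) \<in> homogeneous n (weight m)"
    and "p \<in> homogeneous n d"
  shows "T p \<in> homogeneous n d"
  using assms(1) _ assms(3)
proof (rule linear_op_support_in)
  fix m assume "m \<in> comps_of_weight n d"
  then show "T (monomial m) \<in> homogeneous n d" using assms(2)[of m] by (auto simp: comps_of_weight_def)
qed

section \<open>Genericity of r\<close>

lemma of_nat_fract: "(of_nat a :: ratfun) = to_fract [:of_nat a:]"
  by (induction a) (simp_all add: one_pCons flip: to_fract_1 to_fract_add)

text \<open>Both sides are linear polynomials in the indeterminate, whose coefficients can be
  compared. The separation of spectral points and the nonvanishing of \<open>d_factor\<close> rest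
  on this.\<close>

lemma spectral_value_eq_iff:
  "(of_nat a + r * of_nat b :: ratfun) = of_nat a' + r * of_nat b' \<longleftrightarrow> a = a' \<and> b = b'"
proof -
  have "of_nat a + r * of_nat b = to_fract [:of_nat a, of_nat b:]" for a b
    by (simp add: r_def of_nat_fract flip: to_fract_mult to_fract_add)
  then show ?thesis by simp
qed

lemma r_nonzero: "r \<noteq> 0"
  by (simp add: r_def)

lemma d_factor_nonzero: "d_factor n \<eta> (1 / r) \<noteq> 0"
proof -
  have "1 / r * (of_nat a + 1) + of_nat l + 1 \<noteq> 0" for a l
  proof
    assume "1 / r * (of_nat a + 1) + of_nat l + 1 = 0"
    \<comment> \<open>Multiplication by \<open>r\<close> turns the factor into a spectral value with
      positive coefficients.\<close>
    then have "of_nat (Suc a) + r * of_nat (Suc l) = of_nat 0 + r * of_nat 0"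
      using r_nonzero by (simp add: field_simps)
    then show False unfolding spectral_value_eq_iff by simp
  qed
  then show ?thesis by (simp add: d_factor_def boxes_def)
qed

text \<open>
  \<open>beats \<eta> i\<close> says which entries come after the \<open>i\<close>-th one in the stable decreasing rearrangement
  of \<open>\<eta>\<close>; their number is the coefficient of \<open>r\<close> in the \<open>i\<close>-th spectral coordinate.
\<close>

definition beats :: "expo \<Rightarrow> nat \<Rightarrow> nat \<Rightarrow> bool" where
  "beats \<eta> i j \<longleftrightarrow> j < i \<and> lookup \<eta> j < lookup \<eta> i \<or> i < j \<and> lookup \<eta> j \<le> lookup \<eta> i"

lemma beats_irrefl: "\<not> beats \<eta> i i" by (simp add: beats_def)

lemma beats_trans: "beats \<eta> i j \<Longrightarrow> beats \<eta> j k \<Longrightarrow> beats \<eta> i k"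
  unfolding beats_def by (cases i k rule: linorder_cases) auto

lemma beats_total: "i \<noteq> j \<Longrightarrow> beats \<eta> i j \<longleftrightarrow> \<not> beats \<eta> j i"
  unfolding beats_def by linarith

definition value_inversions :: "nat \<Rightarrow> (nat \<Rightarrow> nat) \<Rightarrow> (nat \<times> nat) set" where
  "value_inversions n w = {(x, y). x \<in> {1..n} \<and> y \<in> {1..n} \<and> x < y \<and> inv w y < inv w x}"

text \<open>\<open>inv w x\<close> is the place that the entry at position \<open>x\<close> takes
  after sorting; in this form the inversions are the pairs of positions whose order sorting
  reverses.\<close>

lemma perm_length_eq:
  assumes w: "w permutes {1..n}"
  shows "perm_length n w = card (value_inversions n w)"
  unfolding perm_length_def
proof (rule bij_betw_same_card[of "\<lambda>(i, j). (w j, w i)"], rule bij_betwI[where g = "\<lambda>(x, y). (inv w y, inv w x)"])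
  note [simp] = permutes_in_image[OF w] permutes_in_image[OF permutes_inv[OF w]] permutes_inverses[OF w]
  show "(\<lambda>(i, j). (w j, w i)) \<in> {(i, j). i \<in> {1..n} \<and> j \<in> {1..n} \<and> i < j \<and> w j < w i} \<rightarrow> value_inversions n w"
    using permutes_in_image[OF w] by (auto simp: value_inversions_def simp del: atLeastAtMost_iff)
  show "(\<lambda>(x, y). (inv w y, inv w x)) \<in> value_inversions n w \<rightarrow> {(i, j). i \<in> {1..n} \<and> j \<in> {1..n} \<and> i < j \<and> w j < w i}"
    by (auto simp: value_inversions_def simp del: atLeastAtMost_iff One_nat_def)
qed (auto simp: permutes_inverses[OF w])

text \<open>The stable sort reverses only those pairs that every sorting permutation has to reverse,
  so it is the benchmark for minimal length.\<close>

lemma exists_stable_sort: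
  fixes \<gamma> :: expo
  shows
  "\<exists>u. u permutes {1..n} \<and> antimono_on {1..n} (perm_act (inv u) (lookup \<gamma>)) \<and>
     value_inversions n u = {(x, y). x \<in> {1..n} \<and> y \<in> {1..n} \<and> x < y \<and> lookup \<gamma> x < lookup \<gamma> y}"
proof -
  \<comment> \<open>The place of \<open>i\<close> in the stable order: one more than the number of
    entries that precede it. Outside \<open>{1..n}\<close> it is the identity, as
    \<open>permutes\<close> demands.\<close>
  define \<rho> where "\<rho> i = (if i \<in> {1..n} then Suc (card {j \<in> {1..n}. beats \<gamma> j i}) else i)" for i
  have less: "\<rho> i < \<rho> j" if "beats \<gamma> i j" "i \<in> {1..n}" "j \<in> {1..n}" for i j
  proof -
    have "{k \<in> {1..n}. beats \<gamma> k i} \<subset> {k \<in> {1..n}. beats \<gamma> k j}"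
      using that beats_trans beats_irrefl by blast
    then have "card {k \<in> {1..n}. beats \<gamma> k i} < card {k \<in> {1..n}. beats \<gamma> k j}"
      by (rule psubset_card_mono[rotated]) simp
    then show ?thesis using that by (simp add: \<rho>_def)
  qed
  have less_iff: "\<rho> i < \<rho> j \<longleftrightarrow> beats \<gamma> i j" if "i \<in> {1..n}" "j \<in> {1..n}" for i j
    using less[of i j] less[of j i] that beats_total[of i j \<gamma>] by (cases "i = j") (auto simp: beats_irrefl)
  have inj: "inj_on \<rho> {1..n}"
    by (rule inj_onI) (metis less_iff beats_total less_irrefl)
  have maps: "\<rho> i \<in> {1..n}" if "i \<in> {1..n}" for i
  proof -
    have "{j \<in> {1..n}. beats \<gamma> j i} \<subset> {1..n}" using that beats_irrefl by blast
    then have "card {j \<in> {1..n}. beats \<gamma> j i} < card {1..n}" by (rule psubset_card_mono[rotated]) simp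
    then show ?thesis using that by (simp add: \<rho>_def)
  qed
  have "\<rho> ` {1..n} = {1..n}"
    using inj maps by (intro endo_inj_surj) auto
  then have perm: "\<rho> permutes {1..n}"
    using inj by (intro bij_imp_permutes) (auto simp: bij_betw_def \<rho>_def)
  define u where "u = inv \<rho>"
  have u: "u permutes {1..n}" "inv u = \<rho>"
    using perm by (simp_all add: u_def permutes_inv inv_inv_eq permutes_bij)
  have "antimono_on {1..n} (perm_act \<rho> (lookup \<gamma>))"
  proof (rule monotone_onI)
    fix i j :: nat assume ij: "i \<in> {1..n}" "j \<in> {1..n}" "i \<le> j"
    have in_n: "inv \<rho> i \<in> {1..n}" "inv \<rho> j \<in> {1..n}"
      using ij permutes_in_image[OF u(1)] by (simp_all add: u_def del: atLeastAtMost_iff)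
    have "\<not> beats \<gamma> (inv \<rho> j) (inv \<rho> i)"
      using less[OF _ in_n(2,1)] ij(3) permutes_inverses[OF perm] by auto
    then have "\<not> lookup \<gamma> (inv \<rho> i) < lookup \<gamma> (inv \<rho> j)"
      by (auto simp: beats_def intro: linorder_neqE_nat)
    then show "perm_act \<rho> (lookup \<gamma>) j \<le> perm_act \<rho> (lookup \<gamma>) i" by (simp add: perm_act_def)
  qed
  moreover have "value_inversions n u = {(x, y). x \<in> {1..n} \<and> y \<in> {1..n} \<and> x < y \<and> lookup \<gamma> x < lookup \<gamma> y}"
    using less_iff by (auto simp: value_inversions_def u beats_def)
  ultimately show ?thesis using u by auto
qed

text \<open>Every sorting permutation inverts the pairs in \<open>?S\<close>. A minimal one has at
  most as many inversions as the stable sort, whose inversions are exactly \<open>?S\<close>, so its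
  inversion set is \<open>?S\<close>. Equal entries therefore keep their order, which is the
  tie-break in \<open>beats\<close>.\<close>

lemma sorting_perm:
  shows sorting_perm_permutes: "sorting_perm n \<gamma> permutes {1..n}"
    and inv_sorting_perm_less_iff: "i \<in> {1..n} \<Longrightarrow> j \<in> {1..n} \<Longrightarrow>
      inv (sorting_perm n \<gamma>) i < inv (sorting_perm n \<gamma>) j \<longleftrightarrow> beats \<gamma> i j"
proof -
  let ?S = "{(x, y). x \<in> {1..n} \<and> y \<in> {1..n} \<and> x < y \<and> lookup \<gamma> x < lookup \<gamma> y}"
  let ?P = "\<lambda>w. w permutes {1..n} \<and> antimono_on {1..n} (perm_act (inv w) (lookup \<gamma>))"
  let ?w = "sorting_perm n \<gamma>"
  obtain u where u: "?P u" "value_inversions n u = ?S" using exists_stable_sort[of n \<gamma>] by blast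
  have w: "?P ?w" and min: "perm_length n ?w \<le> perm_length n u"
    using arg_min_nat_lemma[of ?P u "perm_length n"] u(1) unfolding sorting_perm_def by auto
  show perm: "?w permutes {1..n}" using w by simp
  have sorted: "inv ?w j < inv ?w i" if "i \<in> {1..n}" "j \<in> {1..n}" "lookup \<gamma> i < lookup \<gamma> j" for i j
  proof (rule ccontr)
    assume "\<not> inv ?w j < inv ?w i"
    moreover have "inv ?w i \<in> {1..n}" "inv ?w j \<in> {1..n}"
      using that permutes_in_image[OF permutes_inv[OF perm]] by blast+
    ultimately have "perm_act (inv ?w) (lookup \<gamma>) (inv ?w j) \<le> perm_act (inv ?w) (lookup \<gamma>) (inv ?w i)"
      using monotone_onD[OF conjunct2[OF w], of "inv ?w i" "inv ?w j"] by simp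
    then show False
      using that permutes_inverses[OF perm] by (simp add: perm_act_def inv_inv_eq permutes_bij[OF perm])
  qed
  then have sub: "?S \<subseteq> value_inversions n ?w" by (auto simp: value_inversions_def)
  have fin: "finite (value_inversions n ?w)"
    by (rule finite_subset[of _ "{1..n} \<times> {1..n}"]) (auto simp: value_inversions_def)
  have "card (value_inversions n ?w) \<le> card ?S"
    using min by (simp only: perm_length_eq[OF perm] perm_length_eq[OF conjunct1[OF u(1)]] u(2))
  then have V: "value_inversions n ?w = ?S" using card_seteq[OF fin sub] by simp
  have beats: "inv ?w i < inv ?w j" if "i \<in> {1..n}" "j \<in> {1..n}" "beats \<gamma> i j" for i j
  proof (cases "lookup \<gamma> j < lookup \<gamma> i")
    case False
    then have "i < j" "\<not> lookup \<gamma> i < lookup \<gamma> j" using that(3) by (auto simp: beats_def)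
    then have "(i, j) \<notin> value_inversions n ?w" unfolding V by simp
    then have "\<not> inv ?w j < inv ?w i" using that \<open>i < j\<close> by (simp add: value_inversions_def)
    moreover have "inv ?w i \<noteq> inv ?w j"
      using \<open>i < j\<close> permutes_inverses(1)[OF perm] by (metis less_irrefl)
    ultimately show ?thesis by simp
  qed (use sorted that in simp)
  show "inv ?w i < inv ?w j \<longleftrightarrow> beats \<gamma> i j" if "i \<in> {1..n}" "j \<in> {1..n}"
    using beats[of i j] beats[of j i] that beats_total[of i j \<gamma>] by (cases "i = j") (auto simp: beats_irrefl)
qed

definition nbeats :: "nat \<Rightarrow> expo \<Rightarrow> nat \<Rightarrow> nat" where
  "nbeats n \<eta> i = card {j \<in> {1..n}. beats \<eta> i j}"

text \<open>With \<open>w\<close> the sorting permutation, the entry \<open>i\<close> has place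
  \<open>inv w i\<close>, and the entries it beats fill the places after it. Their number
  \<open>n - inv w i\<close> is the coordinate of \<open>delta\<close> at that place.\<close>

lemma spectral_vector_eq:
  assumes i: "i \<in> {1..n}"
  shows "spectral_vector n \<gamma> i = of_nat (lookup \<gamma> i) + r * of_nat (nbeats n \<gamma> i)"
proof -
  let ?v = "inv (sorting_perm n \<gamma>)"
  have v: "?v permutes {1..n}" using permutes_inv[OF sorting_perm_permutes] .
  have "nbeats n \<gamma> i = card {j \<in> {1..n}. ?v i < ?v j}"
    unfolding nbeats_def by (rule arg_cong[of _ _ card]) (use inv_sorting_perm_less_iff[OF i] in auto)
  also have "\<dots> = card (?v ` {j \<in> {1..n}. ?v i < ?v j})"
    by (rule card_image[symmetric]) (rule inj_on_subset[OF permutes_inj[OF v]], simp)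
  also have "?v ` {j \<in> {1..n}. ?v i < ?v j} = {?v i<..n}"
  proof (rule set_eqI)
    fix k
    have "k \<in> ?v ` {j \<in> {1..n}. ?v i < ?v j} \<longleftrightarrow> k \<in> ?v ` {1..n} \<and> ?v i < k" by blast
    then show "k \<in> ?v ` {j \<in> {1..n}. ?v i < ?v j} \<longleftrightarrow> k \<in> {?v i<..n}"
      unfolding permutes_image[OF v] by auto
  qed
  finally have "nbeats n \<gamma> i = n - ?v i" by simp
  then show ?thesis by (simp add: spectral_vector_def perm_act_def delta_def)
qed

definition point :: "nat \<Rightarrow> expo \<Rightarrow> nat \<Rightarrow> ratfun" where
  "point n \<gamma> i = - spectral_vector n \<gamma> i"

lemma point_eq: "i \<in> {1..n} \<Longrightarrow> point n \<gamma> i = - (of_nat (lookup \<gamma> i) + r * of_nat (nbeats n \<gamma> i))"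
  by (simp add: point_def spectral_vector_eq)

lemma point_inject:
  assumes "\<gamma> \<in> compositions n" "\<eta> \<in> compositions n" "\<And>i. i \<in> {1..n} \<Longrightarrow> point n \<gamma> i = point n \<eta> i"
  shows "\<gamma> = \<eta>"
proof (rule poly_mapping_eqI)
  fix i show "lookup \<gamma> i = lookup \<eta> i"
    using assms(3)[of i] assms(1,2)
    by (cases "i \<in> {1..n}")
      (simp_all only: point_eq neg_equal_iff_equal spectral_value_eq_iff compositions_lookup not_False_eq_True)
qed

text \<open>Only the indices up to \<open>m\<close> are rotated, so the map also permutes
  \<open>{1..n}\<close> for \<open>n \<ge> m\<close>; the induction on the number of variables
  inside a fixed \<open>n\<close> needs this.\<close>

definition cycle :: "nat \<Rightarrow> nat \<Rightarrow> nat" where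
  "cycle m k = (if k = m then 1 else if 1 \<le> k \<and> k < m then Suc k else k)"

definition cycle_inv :: "nat \<Rightarrow> nat \<Rightarrow> nat" where
  "cycle_inv m k = (if k = 1 then m else if 1 < k \<and> k \<le> m then k - 1 else k)"

lemma cycle_inverses: "1 \<le> m \<Longrightarrow> cycle_inv m (cycle m k) = k" "1 \<le> m \<Longrightarrow> cycle m (cycle_inv m k) = k"
  by (auto simp: cycle_def cycle_inv_def)

lemma cycle_permutes:
  assumes "1 \<le> m"
  shows "cycle m permutes {1..m}"
  unfolding permutes_def
proof (intro conjI allI impI)
  fix y show "\<exists>!x. cycle m x = y" using cycle_inverses[OF assms] by metis
qed (use assms in \<open>auto simp: cycle_def\<close>)

section \<open>Interpolation at spectral vectors\<close>

lemma inv_cycle: "1 \<le> m \<Longrightarrow> inv (cycle m) = cycle_inv m"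
  by (rule inv_equality) (auto simp: cycle_inverses)

lemma nbeats_reindex:
  assumes w: "w permutes {1..n}" and "\<And>j. j \<in> {1..n} \<Longrightarrow> beats \<eta> i j \<longleftrightarrow> beats \<gamma> (w i) (w j)"
  shows "nbeats n \<eta> i = nbeats n \<gamma> (w i)"
proof -
  have "w ` {j \<in> {1..n}. beats \<gamma> (w i) (w j)} = {k \<in> {1..n}. beats \<gamma> (w i) k}"
  proof (rule set_eqI)
    fix k
    have "k \<in> w ` {j \<in> {1..n}. beats \<gamma> (w i) (w j)} \<longleftrightarrow> k \<in> w ` {1..n} \<and> beats \<gamma> (w i) k" by blast
    then show "k \<in> w ` {j \<in> {1..n}. beats \<gamma> (w i) (w j)} \<longleftrightarrow> k \<in> {k \<in> {1..n}. beats \<gamma> (w i) k}"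
      unfolding permutes_image[OF w] by simp
  qed
  then have "nbeats n \<gamma> (w i) = card (w ` {j \<in> {1..n}. beats \<gamma> (w i) (w j)})"
    by (simp add: nbeats_def)
  also have "\<dots> = card {j \<in> {1..n}. beats \<gamma> (w i) (w j)}"
    by (rule card_image) (rule inj_on_subset[OF permutes_inj[OF w]], simp)
  also have "{j \<in> {1..n}. beats \<gamma> (w i) (w j)} = {j \<in> {1..n}. beats \<eta> i j}"
    using assms(2) by blast
  finally show ?thesis by (simp add: nbeats_def)
qed

text \<open>As \<open>cycle m m = 1\<close>, this is (\<gamma>_1, ..., \<gamma>_m) to (\<gamma>_2,
  ..., \<gamma>_m, \<gamma>_1 + 1): the effect on exponents of rotating the variables and
  multiplying by x_m.\<close>

definition affine_shift :: "nat \<Rightarrow> expo \<Rightarrow> expo" where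
  "affine_shift m \<gamma> = map_key (cycle m) \<gamma> + single m 1"

lemma lookup_affine_shift:
  "1 \<le> m \<Longrightarrow> lookup (affine_shift m \<gamma>) k = lookup \<gamma> (cycle m k) + (if k = m then 1 else 0)"
  using permutes_inj[OF cycle_permutes[of m]]
  by (simp add: affine_shift_def lookup_add lookup_map_key lookup_single when_def)

lemma weight_affine_shift: "1 \<le> m \<Longrightarrow> \<gamma> \<in> compositions m \<Longrightarrow> weight (affine_shift m \<gamma>) = Suc (weight \<gamma>)"
  by (simp add: affine_shift_def weight_map_key[OF cycle_permutes])

lemma affine_shift_surj:
  assumes "1 \<le> m" "\<gamma> \<in> compositions m" "0 < lookup \<gamma> m"
  obtains \<eta> where "\<eta> \<in> compositions m" "\<gamma> = affine_shift m \<eta>" "weight \<gamma> = Suc (weight \<eta>)"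
proof -
  define \<eta> where "\<eta> = map_key (cycle_inv m) (\<gamma> - single m 1)"
  have perm: "cycle_inv m permutes {1..m}"
    using permutes_inv[OF cycle_permutes[OF assms(1)]] unfolding inv_cycle[OF assms(1)] .
  have \<eta>: "\<eta> \<in> compositions m"
    unfolding \<eta>_def by (intro compositions_map_key perm compositionsI)
      (simp add: lookup_minus lookup_single when_def compositions_lookup[OF assms(2)])
  have "\<gamma> = affine_shift m \<eta>"
    using assms(3)
    by (intro poly_mapping_eqI)
      (simp add: lookup_affine_shift[OF assms(1)] \<eta>_def lookup_map_key[OF permutes_inj[OF perm]]
        cycle_inverses[OF assms(1)] lookup_minus lookup_single when_def)
  then show thesis using that \<eta> weight_affine_shift[OF assms(1) \<eta>] by simp
qed

text \<open>The increment compensates for the change of tie-break: in first place \<gamma>_1 beats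
  the entries \<le> \<gamma>_1, in last place \<gamma>_1 + 1 beats the entries < \<gamma>_1 + 1.
  Positions beyond \<open>m\<close> carry 0 and stay beaten.\<close>

lemma beats_affine_shift:
  assumes "\<gamma> \<in> compositions m" "k \<in> {1..m}" "j \<ge> 1"
  shows "beats (affine_shift m \<gamma>) k j \<longleftrightarrow> beats \<gamma> (cycle m k) (cycle m j)"
proof -
  have [simp]: "lookup \<gamma> j = 0" if "m < j" using compositions_lookup[OF assms(1)] that by simp
  consider "j = k" | "j < m" "k < m" | "j < m" "k = m" | "j = m" "k < m" | "m < j" using assms(2) by fastforce
  then show ?thesis
    using assms(2,3) by cases (auto simp: beats_def lookup_affine_shift, auto simp: cycle_def)
qed

lemma point_affine_shift:
  assumes "m \<le> n" "\<gamma> \<in> compositions m" "k \<in> {1..m}"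
  shows "point n (affine_shift m \<gamma>) k = point n \<gamma> (cycle m k) - (if k = m then 1 else 0)"
proof -
  have perm: "cycle m permutes {1..n}"
    using permutes_subset[OF cycle_permutes] assms by auto
  have k: "k \<in> {1..n}" "cycle m k \<in> {1..n}"
    using assms permutes_in_image[OF perm, of k] by auto
  have "nbeats n (affine_shift m \<gamma>) k = nbeats n \<gamma> (cycle m k)"
    by (rule nbeats_reindex[OF perm], rule beats_affine_shift[OF assms(2,3)]) simp
  moreover have "1 \<le> m" using assms(3) by simp
  ultimately show ?thesis
    using k by (simp add: point_eq lookup_affine_shift[OF \<open>1 \<le> m\<close>] del: atLeastAtMost_iff)
qed

definition ground_value :: "nat \<Rightarrow> nat \<Rightarrow> ratfun" where
  "ground_value n m = - (r * of_nat (n - m))"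

text \<open>A zero at \<open>m\<close> in a composition supported in \<open>{1..m}\<close> beats
  exactly the \<open>n - m\<close> zeros after it. Hence x_m - \<open>ground_value n m\<close> tells
  the compositions in fewer variables from the affine shifts.\<close>

lemma point_eq_ground_value_iff:
  assumes "m \<in> {1..n}" "\<gamma> \<in> compositions m"
  shows "point n \<gamma> m = ground_value n m \<longleftrightarrow> lookup \<gamma> m = 0"
proof
  assume "point n \<gamma> m = ground_value n m"
  then have "of_nat (lookup \<gamma> m) + r * of_nat (nbeats n \<gamma> m) = of_nat 0 + r * of_nat (n - m)"
    using assms(1) by (simp add: point_eq ground_value_def del: atLeastAtMost_iff)
  then show "lookup \<gamma> m = 0" unfolding spectral_value_eq_iff by simp
next
  assume 0: "lookup \<gamma> m = 0"
  have "{j \<in> {1..n}. beats \<gamma> m j} = {m<..n}"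
    using 0 compositions_lookup[OF assms(2)] assms(1) by (auto simp: beats_def)
  then show "point n \<gamma> m = ground_value n m"
    using 0 assms(1) by (simp add: point_eq ground_value_def nbeats_def del: atLeastAtMost_iff)
qed

abbreviation swap :: "nat \<Rightarrow> nat \<Rightarrow> nat" where
  "swap k \<equiv> Transposition.transpose k (Suc k)"

lemma swap_permutes: "k \<in> {1..<n} \<Longrightarrow> swap k permutes {1..n}"
  by (rule permutes_swap_id) auto

text \<open>Distinct entries are compared by value alone, and no index lies between \<open>k\<close>
  and \<open>Suc k\<close>, so the swap merely exchanges two coordinates. With equal entries
  position decides, which is the case of \<open>point_diff\<close>.\<close>

lemma point_swap:
  assumes "k \<in> {1..<n}" "lookup \<gamma> k \<noteq> lookup \<gamma> (Suc k)" "i \<in> {1..n}"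
  shows "point n (map_key (swap k) \<gamma>) i = point n \<gamma> (swap k i)"
proof -
  note perm = swap_permutes[OF assms(1)]
  have [simp]: "lookup (map_key (swap k) \<gamma>) j = lookup \<gamma> (swap k j)" for j
    by (rule lookup_map_key) simp
  have "nbeats n (map_key (swap k) \<gamma>) i = nbeats n \<gamma> (swap k i)"
  proof (rule nbeats_reindex[OF perm])
    fix j
    consider "i = k" "j = Suc k" | "i = Suc k" "j = k" | "i = j" | "i = k" "j \<notin> {k, Suc k}" | "i = Suc k" "j \<notin> {k, Suc k}"
      | "i \<notin> {k, Suc k}" "j = k" | "i \<notin> {k, Suc k}" "j = Suc k" | "i \<notin> {k, Suc k}" "j \<notin> {k, Suc k}" by auto
    then show "beats (map_key (swap k) \<gamma>) i j = beats \<gamma> (swap k i) (swap k j)"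
      by cases (use assms(2) in \<open>auto simp: beats_def\<close>)
  qed
  then show ?thesis
    using assms(3) permutes_in_image[OF perm, of i] by (simp add: point_eq del: atLeastAtMost_iff)
qed

text \<open>Equal neighbours beat the same entries, except that the left one also beats the right
  one.\<close>

lemma point_diff:
  assumes "k \<in> {1..<n}" "lookup \<gamma> k = lookup \<gamma> (Suc k)"
  shows "point n \<gamma> k - point n \<gamma> (Suc k) = - r"
proof -
  have "beats \<gamma> k j \<longleftrightarrow> j = Suc k \<or> beats \<gamma> (Suc k) j" for j
    using assms(2) unfolding beats_def by (cases j "Suc k" rule: linorder_cases) (auto simp: less_Suc_eq)
  then have "{j \<in> {1..n}. beats \<gamma> k j} = insert (Suc k) {j \<in> {1..n}. beats \<gamma> (Suc k) j}"
    using assms(1) by auto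
  then have "nbeats n \<gamma> k = Suc (nbeats n \<gamma> (Suc k))"
    by (simp add: nbeats_def beats_irrefl)
  then show ?thesis using assms by (simp add: point_eq algebra_simps)
qed

text \<open>Dual to \<open>affine_shift\<close>: the last coordinate of the shifted point is the old
  first one minus 1, so putting x_m + 1 for x_1 restores the old value.\<close>

definition shift_vars :: "nat \<Rightarrow> mpoly \<Rightarrow> mpoly" where
  "shift_vars m = sub (\<lambda>i. if i = 1 then Var m + 1 else Var (cycle_inv m i))"

lemma linear_op_shift_vars: "linear_op (shift_vars m)"
  unfolding shift_vars_def by (rule linear_op_sub)

lemma shift_vars_polys_below: "1 \<le> m \<Longrightarrow> p \<in> polys_below m d \<Longrightarrow> shift_vars m p \<in> polys_below m d"
  unfolding shift_vars_def
  by (erule polys_below_sub[rotated])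
    (auto simp: cycle_inv_def intro!: support_in_add polys_below_Var polys_below_mono[OF _ polys_below_1])

lemma eval_at_shift_vars:
  assumes "1 \<le> m" "m \<le> n" "\<gamma> \<in> compositions m" "p \<in> polys m"
  shows "eval_at (point n (affine_shift m \<gamma>)) (shift_vars m p) = eval_at (point n \<gamma>) p"
  unfolding shift_vars_def eval_at_sub
proof (rule eval_at_cong[OF assms(4)])
  fix i assume i: "i \<in> {1..m}"
  have "cycle_inv m i \<in> {1..m}" "cycle_inv m i = m \<longleftrightarrow> i = 1" "cycle m m = 1"
    using i by (auto simp: cycle_inv_def cycle_def)
  then show "eval_at (point n (affine_shift m \<gamma>)) (if i = 1 then Var m + 1 else Var (cycle_inv m i)) = point n \<gamma> i"
    using point_affine_shift[OF assms(2,3), of "cycle_inv m i"] point_affine_shift[OF assms(2,3), of m] assms(1)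
    by (simp add: cycle_inverses)
qed

text \<open>
  The induction on the number \<open>m\<close> of variables keeps the points of the ambient \<open>n\<close>, which avoids the
  shift of all spectral coordinates by \<open>r\<close> between \<open>n - 1\<close> and \<open>n\<close> variables. The interpolant is
  \<open>q + (x\<^sub>m - c) h\<close>, where \<open>q\<close> handles \<open>\<gamma>\<^sub>m = 0\<close>, for which the last coordinate is \<open>c\<close>, and \<open>h\<close> the
  affine shifts.
\<close>

lemma interpolation_aux:
  assumes "m \<le> n"
  shows "\<exists>p\<in>polys_below m d. \<forall>\<gamma>\<in>comps_below m d. eval_at (point n \<gamma>) p = v \<gamma>"
  using assms
proof (induction "m + d" arbitrary: m d v rule: less_induct)
  case less
  show ?case
  proof (cases d)
    case 0
    then show ?thesis by (intro bexI[of _ 0]) simp_all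
  next
    case (Suc d')
    show ?thesis
    proof (cases m)
      case 0
      have "compositions 0 = {0}" by (auto simp: compositions_def)
      moreover have "Const (v 0) \<in> polys_below m d"
        using Suc by (auto intro: polys_below_mono[OF _ polys_below_Const])
      ultimately show ?thesis using 0 by (intro bexI[of _ "Const (v 0)"]) (auto simp: comps_below_def)
    next
      case (Suc m')
      then have m: "1 \<le> m" "m \<in> {1..n}" using less.prems by auto
      obtain q where q: "q \<in> polys_below m' d" "\<And>\<gamma>. \<gamma> \<in> comps_below m' d \<Longrightarrow> eval_at (point n \<gamma>) q = v \<gamma>"
        using less.hyps[of m' d v] Suc less.prems by auto
      \<comment> \<open>The value still missing at the affine shift, divided by that of x_m - c,
        which is nonzero there because the last entry of an affine shift is positive. The shift
        raises the weight by one, so interpolation of degree below \<open>d'\<close>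
        suffices.\<close>
      define v' where "v' \<gamma> = (v (affine_shift m \<gamma>) - eval_at (point n (affine_shift m \<gamma>)) q)
        / (point n (affine_shift m \<gamma>) m - ground_value n m)" for \<gamma>
      obtain g where g: "g \<in> polys_below m d'" "\<And>\<gamma>. \<gamma> \<in> comps_below m d' \<Longrightarrow> eval_at (point n \<gamma>) g = v' \<gamma>"
        using less.hyps[of m d' v'] \<open>d = Suc d'\<close> less.prems by auto
      define h where "h = shift_vars m g"
      have h: "h \<in> polys_below m d'" unfolding h_def using g m by (simp add: shift_vars_polys_below)
      define p where "p = q + (Var m * h - Const (ground_value n m) * h)"
      have "p \<in> polys_below m d"
        unfolding p_def using q h m \<open>d = Suc d'\<close> Suc
        by (intro support_in_add support_in_diff support_in_Const_mult)
          (auto intro: polys_below_index_mono[of m'] polys_below_Var_mult polys_below_mono[of d'])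
      moreover have "eval_at (point n \<gamma>) p = v \<gamma>" if \<gamma>: "\<gamma> \<in> comps_below m d" for \<gamma>
      proof (cases "lookup \<gamma> m = 0")
        case True
        have "\<gamma> \<in> compositions m'"
        proof (rule compositionsI)
          fix i assume "i \<notin> {1..m'}"
          then have "i = m \<or> i \<notin> {1..m}" using Suc by auto
          then show "lookup \<gamma> i = 0"
            using True compositions_lookup[of \<gamma> m i] \<gamma> by (auto simp: comps_below_def)
        qed
        then have "\<gamma> \<in> comps_below m' d" using \<gamma> by (simp add: comps_below_def)
        moreover have "point n \<gamma> m = ground_value n m"
          using True point_eq_ground_value_iff[OF m(2)] \<gamma> by (simp add: comps_below_def)
        ultimately show ?thesis using q by (simp add: p_def)
      next
        case False
        then obtain \<eta> where \<eta>: "\<eta> \<in> compositions m" "\<gamma> = affine_shift m \<eta>" "weight \<gamma> = Suc (weight \<eta>)"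
          using affine_shift_surj[OF m(1)] \<gamma> by (auto simp: comps_below_def)
        then have \<eta>': "\<eta> \<in> comps_below m d'" using \<gamma> \<open>d = Suc d'\<close> by (simp add: comps_below_def)
        have "point n \<gamma> m \<noteq> ground_value n m"
          using False point_eq_ground_value_iff[OF m(2)] \<gamma> by (simp add: comps_below_def)
        moreover have "eval_at (point n \<gamma>) h = v' \<eta>"
          unfolding \<eta> h_def using eval_at_shift_vars[OF m(1) _ \<eta>(1)] less.prems g(2)[OF \<eta>'] polys_below_polys[OF g(1)] by simp
        ultimately show ?thesis unfolding p_def v'_def \<eta>(2)[symmetric]
          by (simp add: \<eta>(2)[symmetric] field_simps)
      qed
      ultimately show ?thesis by blast
    qed
  qed
qed

lemma interpolation_exists:
  obtains p where "p \<in> polys_below n d" "\<And>\<gamma>. \<gamma> \<in> comps_below n d \<Longrightarrow> eval_at (point n \<gamma>) p = v \<gamma>"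
  using interpolation_aux[of n n d v] by blast

interpretation mpoly_vs: vector_space "\<lambda>c p. Const c * p"
  by unfold_locales (simp_all add: algebra_simps Const_add Const_mult)

text \<open>Dimension count: there is one Lagrange polynomial \<open>L \<eta>\<close> for each
  monomial of degree below \<open>d\<close>. A nonzero \<open>p\<close> vanishing at all points
  would be independent of them, one vector too many in the span of these monomials.\<close>

lemma interpolation_unique:
  assumes p: "p \<in> polys_below n d" and zero: "\<And>\<gamma>. \<gamma> \<in> comps_below n d \<Longrightarrow> eval_at (point n \<gamma>) p = 0"
  shows "p = 0"
proof (rule ccontr)
  assume "p \<noteq> 0"
  let ?C = "comps_below n d"
  define L where "L \<eta> = (SOME q. q \<in> polys_below n d \<and> (\<forall>\<gamma>\<in>?C. eval_at (point n \<gamma>) q = (if \<gamma> = \<eta> then 1 else 0)))" for \<eta>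
  have L: "L \<eta> \<in> polys_below n d" "\<And>\<gamma>. \<gamma> \<in> ?C \<Longrightarrow> eval_at (point n \<gamma>) (L \<eta>) = (if \<gamma> = \<eta> then 1 else 0)" for \<eta>
  proof -
    have "\<exists>q. q \<in> polys_below n d \<and> (\<forall>\<gamma>\<in>?C. eval_at (point n \<gamma>) q = (if \<gamma> = \<eta> then 1 else 0))"
      using interpolation_aux[of n n d "\<lambda>\<gamma>. if \<gamma> = \<eta> then 1 else 0"] by blast
    from someI_ex[OF this] show "L \<eta> \<in> polys_below n d"
      "\<And>\<gamma>. \<gamma> \<in> ?C \<Longrightarrow> eval_at (point n \<gamma>) (L \<eta>) = (if \<gamma> = \<eta> then 1 else 0)" unfolding L_def by blast+
  qed
  have inj: "inj_on L ?C"
    by (rule inj_onI) (metis L(2) zero_neq_one)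
  have p_notin: "p \<notin> L ` ?C" using zero L(2) by force
  have indep: "mpoly_vs.independent (insert p (L ` ?C))"
    unfolding mpoly_vs.independent_explicit_finite_subsets
  proof safe
    fix S u q
    assume S: "S \<subseteq> insert p (L ` ?C)" "finite S" and sum0: "(\<Sum>v\<in>S. Const (u v) * v) = 0" and q: "q \<in> S"
    \<comment> \<open>Evaluation at the point of \<eta> kills \<open>p\<close> and all other
      Lagrange polynomials and isolates one coefficient.\<close>
    have coeff_L: "u (L \<eta>) = 0" if "\<eta> \<in> ?C" "L \<eta> \<in> S" for \<eta>
    proof -
      have ev: "eval_at (point n \<eta>) v = (if v = L \<eta> then 1 else 0)" if "v \<in> S" for v
        using that S(1) zero \<open>\<eta> \<in> ?C\<close> L(2)[OF \<open>\<eta> \<in> ?C\<close>] inj p_notin by (auto simp: inj_on_def)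
      have "0 = eval_at (point n \<eta>) (\<Sum>v\<in>S. Const (u v) * v)" by (simp add: sum0)
      also have "\<dots> = (\<Sum>v\<in>S. if v = L \<eta> then u v else 0)"
        using ev by (auto simp: eval_at_sum intro!: sum.cong)
      also have "\<dots> = u (L \<eta>)" using S that by simp
      finally show ?thesis by simp
    qed
    show "u q = 0"
    proof (cases "q = p")
      case True
      have "Const (u v) * v = 0" if "v \<in> S - {p}" for v
        using that S coeff_L by auto
      then have "0 = Const (u p) * p"
        using sum0 S q True by (subst (asm) sum.remove[of _ p]) (auto simp: sum.neutral)
      then show ?thesis using \<open>p \<noteq> 0\<close> True by simp
    qed (use coeff_L S q in blast)
  qed
  have "insert p (L ` ?C) \<subseteq> mpoly_vs.span (monomial ` ?C)"
  proof
    fix q assume "q \<in> insert p (L ` ?C)"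
    then have "keys q \<subseteq> ?C" using p L by (auto simp: support_in_def)
    then show "q \<in> mpoly_vs.span (monomial ` ?C)"
      by (subst mpoly_expand) (rule mpoly_vs.span_sum, rule mpoly_vs.span_scale, rule mpoly_vs.span_base, auto)
  qed
  then have "card (insert p (L ` ?C)) \<le> card (monomial ` ?C)"
    using mpoly_vs.independent_span_bound[OF _ indep] by simp
  also have "\<dots> \<le> card ?C" by (simp add: card_image_le)
  finally show False using inj p_notin by (simp add: card_image)
qed

section \<open>Divided differences and Cherednik operators\<close>

lemma Var_eq_iff [simp]: "Var i = Var j \<longleftrightarrow> i = j"
proof
  assume "Var i = Var j"
  then have "eval_at (\<lambda>k. if k = i then 1 else 0) (Var i) = eval_at (\<lambda>k. if k = i then 1 else 0) (Var j)" by simp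
  then show "i = j" by (simp split: if_splits)
qed simp

lemma exponent_pair:
  fixes \<mu> :: expo
  assumes "i \<noteq> j"
  obtains m where "\<mu> = m + single i (lookup \<mu> i) + single j (lookup \<mu> j)" "lookup m i = 0" "lookup m j = 0"
proof
  let ?m = "\<mu> - (single i (lookup \<mu> i) + single j (lookup \<mu> j))"
  show "\<mu> = ?m + single i (lookup \<mu> i) + single j (lookup \<mu> j)" "lookup ?m i = 0" "lookup ?m j = 0"
    using assms by (auto intro!: poly_mapping_eqI simp: lookup_add lookup_minus lookup_single when_def)
qed

lemma monomial_pair: "monomial (m + single i a + single j b) = monomial m * (Var i ^ a * Var j ^ b)"
  by (simp add: monomial_add monomial_single mult.assoc)

lemma permute_vars_power: "permute_vars w (p ^ k) = permute_vars w p ^ k"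
  by (induction k) (simp_all add: permute_vars_simps)

lemma permute_vars_transpose_pair:
  assumes "lookup m i = 0" "lookup m j = 0"
  shows "permute_vars (Transposition.transpose i j) (monomial (m + single i a + single j b))
    = monomial m * (Var i ^ b * Var j ^ a)"
proof -
  have "map_key (Transposition.transpose i j) m = m"
    using assms by (intro poly_mapping_eqI) (auto simp: lookup_map_key Transposition.transpose_def)
  then show ?thesis
    by (simp add: monomial_pair permute_vars_simps permute_vars_monomial permute_vars_power mult.commute)
qed

text \<open>For \<open>i = j\<close> the equation reads 0 = 0 and determines nothing; the value 0
  keeps the operator linear for all indices.\<close>

definition divided_difference :: "nat \<Rightarrow> nat \<Rightarrow> mpoly \<Rightarrow> mpoly" where
  "divided_difference i j p = (if i = j then 0
     else THE q. (Var i - Var j) * q = p - permute_vars (Transposition.transpose i j) p)"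

lemma divided_difference_unique:
  assumes "i \<noteq> j" "(Var i - Var j) * q = p - permute_vars (Transposition.transpose i j) p"
  shows "divided_difference i j p = q"
  unfolding divided_difference_def if_not_P[OF assms(1)]
proof (rule the_equality)
  fix q' assume "(Var i - Var j) * q' = p - permute_vars (Transposition.transpose i j) p"
  then have "(Var i - Var j) * q' = (Var i - Var j) * q" using assms(2) by simp
  then show "q' = q" using assms(1) by simp
qed (rule assms(2))

text \<open>The symmetric factor x_i^c x_j^c comes out and leaves the geometric sum for x_i^k -
  x_j^k. The minus sign of the second case is the only source of negative coefficients in the
  Cherednik operators.\<close>

lemma divided_difference_pair:
  assumes "i \<noteq> j" "lookup m i = 0" "lookup m j = 0"
  shows "divided_difference i j (monomial (m + single i (c + k) + single j c))
           = (\<Sum>t<k. monomial (m + single i (c + t) + single j (c + (k - Suc t))))"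
    and "divided_difference i j (monomial (m + single i c + single j (c + k)))
           = - (\<Sum>t<k. monomial (m + single i (c + t) + single j (c + (k - Suc t))))"
proof -
  let ?S = "\<Sum>t<k. monomial (m + single i (c + t) + single j (c + (k - Suc t)))"
  have "?S = monomial m * (Var i ^ c * Var j ^ c) * (\<Sum>t<k. Var j ^ (k - Suc t) * Var i ^ t)"
    by (simp only: monomial_pair power_add sum_distrib_left mult_ac)
  then have "(Var i - Var j) * ?S = monomial m * (Var i ^ c * Var j ^ c) * (Var i ^ k - Var j ^ k)"
    by (simp add: power_diff_sumr2 mult_ac)
  then have S: "(Var i - Var j) * ?S = monomial m * (Var i ^ (c + k) * Var j ^ c) - monomial m * (Var i ^ c * Var j ^ (c + k))"
    by (simp add: algebra_simps power_add)
  show "divided_difference i j (monomial (m + single i (c + k) + single j c)) = ?S"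
    by (rule divided_difference_unique[OF assms(1)])
      (unfold S permute_vars_transpose_pair[OF assms(2,3)], simp only: monomial_pair)
  show "divided_difference i j (monomial (m + single i c + single j (c + k))) = - ?S"
    by (rule divided_difference_unique[OF assms(1)])
      (unfold mult_minus_right S permute_vars_transpose_pair[OF assms(2,3)], simp only: monomial_pair minus_diff_eq)
qed

text \<open>Divisibility is checked on monomials, where x_i - x_j divides x_i^k - x_j^k. The chosen
  quotients are extended linearly, and uniqueness of the quotient identifies the result with the
  definite description.\<close>

lemma divided_difference_mult:
  assumes "i \<noteq> j"
  shows "(Var i - Var j) * divided_difference i j p = p - permute_vars (Transposition.transpose i j) p"
proof -
  have mono: "\<exists>q. (Var i - Var j) * q = monomial \<mu> - permute_vars (Transposition.transpose i j) (monomial \<mu>)" for \<mu>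
  proof -
    obtain m where m: "\<mu> = m + single i (lookup \<mu> i) + single j (lookup \<mu> j)" "lookup m i = 0" "lookup m j = 0"
      using exponent_pair[OF assms] by blast
    have dvd: "Var i - Var j dvd Var i ^ a * Var j ^ b - Var i ^ b * Var j ^ a" for a b
    proof (induction a b rule: linorder_wlog)
      case (le a b)
      have "Var i ^ a * Var j ^ b - Var i ^ b * Var j ^ a = - (Var i ^ a * Var j ^ a * (Var i ^ (b - a) - Var j ^ (b - a)))"
        using le by (simp add: algebra_simps flip: power_add)
      then show ?case using power_diff_sumr2[of "Var i" "b - a" "Var j"] by simp
    next
      case (sym a b)
      then show ?case
        using dvd_minus_iff[of "Var i - Var j" "Var i ^ b * Var j ^ a - Var i ^ a * Var j ^ b"]
        by (simp only: minus_diff_eq)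
    qed
    have "monomial \<mu> - permute_vars (Transposition.transpose i j) (monomial \<mu>) =
        monomial m * (Var i ^ lookup \<mu> i * Var j ^ lookup \<mu> j - Var i ^ lookup \<mu> j * Var j ^ lookup \<mu> i)"
      by (subst (1 2) m(1), unfold permute_vars_transpose_pair[OF m(2,3)]) (simp only: monomial_pair right_diff_distrib)
    then show ?thesis using dvd_mult[OF dvd] by (metis dvdE)
  qed
  define f where "f \<mu> = (SOME q. (Var i - Var j) * q = monomial \<mu> - permute_vars (Transposition.transpose i j) (monomial \<mu>))" for \<mu>
  have f: "(Var i - Var j) * f \<mu> = monomial \<mu> - permute_vars (Transposition.transpose i j) (monomial \<mu>)" for \<mu>
    unfolding f_def by (rule someI_ex[OF mono])
  have "(Var i - Var j) * linear_extension f p = p - permute_vars (Transposition.transpose i j) p"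
    by (rule linear_op_eq[OF linear_op_mult[OF linear_op_extension]
          linear_op_minus[OF linear_op_id linear_op_permute_vars], of UNIV]) (simp_all add: f support_in_def)
  then show ?thesis using divided_difference_unique[OF assms] by metis
qed

lemma linear_op_divided_difference: "linear_op (divided_difference i j)"
proof (cases "i = j")
  case True
  then show ?thesis by (simp add: linear_op_def divided_difference_def)
next
  case False
  show ?thesis unfolding linear_op_def
  proof safe
    fix p q
    show "divided_difference i j (p + q) = divided_difference i j p + divided_difference i j q"
      by (rule divided_difference_unique[OF False])
        (simp add: distrib_left divided_difference_mult[OF False] permute_vars_simps)
  next
    fix c p
    show "divided_difference i j (Const c * p) = Const c * divided_difference i j p"
      by (rule divided_difference_unique[OF False])
        (simp add: mult.left_commute divided_difference_mult[OF False] permute_vars_simps right_diff_distrib)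
  qed
qed

lemma permute_vars_transpose:
  "bij w \<Longrightarrow> permute_vars w (permute_vars (Transposition.transpose i j) p)
     = permute_vars (Transposition.transpose (w i) (w j)) (permute_vars w p)"
  unfolding permute_vars_comp
  by (rule arg_cong2[of _ _ _ _ permute_vars])
    (auto simp: fun_eq_iff Transposition.transpose_def dest: bij_is_inj[THEN injD])

lemma permute_vars_divided_difference:
  assumes "bij w"
  shows "permute_vars w (divided_difference i j p) = divided_difference (w i) (w j) (permute_vars w p)"
proof (cases "i = j")
  case False
  then have ne: "w i \<noteq> w j" using bij_is_inj[OF assms] by (auto dest: injD)
  have "(Var (w i) - Var (w j)) * permute_vars w (divided_difference i j p)
      = permute_vars w ((Var i - Var j) * divided_difference i j p)"
    by (simp add: permute_vars_simps)
  then show ?thesis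
    by (intro divided_difference_unique[OF ne, symmetric])
      (simp add: divided_difference_mult[OF False] permute_vars_simps(7) permute_vars_transpose[OF assms])
qed (simp add: divided_difference_def permute_vars_simps)

text \<open>The twisted Leibniz rule for a single variable; the terms \<open>- p\<close> and
  \<open>+ p\<close> produce the corrections in all commutation relations with variables.\<close>

lemma divided_difference_Var:
  assumes "i \<noteq> j"
  shows "l \<notin> {i, j} \<Longrightarrow> divided_difference i j (Var l * p) = Var l * divided_difference i j p"
    and "divided_difference i j (Var j * p) = Var i * divided_difference i j p - p"
    and "divided_difference i j (Var i * p) = Var j * divided_difference i j p + p"
proof -
  note dd = divided_difference_mult[OF assms, of p]
  show "divided_difference i j (Var l * p) = Var l * divided_difference i j p" if "l \<notin> {i, j}"
    using that dd
    by (intro divided_difference_unique[OF assms]) (simp add: permute_vars_simps mult.left_commute right_diff_distrib)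
  have "(Var i - Var j) * (Var i * divided_difference i j p - p) = Var i * (p - permute_vars (Transposition.transpose i j) p) - (Var i - Var j) * p"
    unfolding dd[symmetric] by (simp add: algebra_simps)
  then show "divided_difference i j (Var j * p) = Var i * divided_difference i j p - p"
    by (intro divided_difference_unique[OF assms]) (simp add: permute_vars_simps algebra_simps)
  have "(Var i - Var j) * (Var j * divided_difference i j p + p) = Var j * (p - permute_vars (Transposition.transpose i j) p) + (Var i - Var j) * p"
    unfolding dd[symmetric] by (simp add: algebra_simps)
  then show "divided_difference i j (Var i * p) = Var j * divided_difference i j p + p"
    by (intro divided_difference_unique[OF assms]) (simp add: permute_vars_simps algebra_simps)
qed

text \<open>The operator x_i d/dx_i, which is diagonal on monomials.\<close>

definition euler :: "nat \<Rightarrow> mpoly \<Rightarrow> mpoly" where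
  "euler i = linear_extension (\<lambda>m. Const (of_nat (lookup m i)) * monomial m)"

lemma linear_op_euler: "linear_op (euler i)"
  unfolding euler_def by (rule linear_op_extension)

lemma euler_monomial: "euler i (monomial m) = Const (of_nat (lookup m i)) * monomial m"
  by (simp add: euler_def)

lemma permute_vars_euler:
  assumes "bij w"
  shows "permute_vars w (euler i p) = euler (w i) (permute_vars w p)"
  by (rule linear_op_eq[OF linear_op_comp[OF linear_op_permute_vars linear_op_euler]
        linear_op_comp[OF linear_op_euler linear_op_permute_vars], of UNIV])
    (simp_all add: support_in_def euler_monomial permute_vars_simps permute_vars_monomial[OF assms]
      lookup_map_key[OF bij_is_inj[OF bij_imp_bij_inv[OF assms]]] inv_f_f[OF bij_is_inj[OF assms]])

lemma euler_Var:
  "euler i (Var j * p) = Var j * euler i p + (if i = j then Var j * p else 0)"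
proof (rule linear_op_eq[of "\<lambda>p. euler i (Var j * p)" "\<lambda>p. Var j * euler i p + (if i = j then Var j * p else 0)" UNIV])
  fix m
  have "Var j * monomial m = monomial (single j 1 + m)" by (simp add: Var_def monomial_add)
  then show "euler i (Var j * monomial m) = Var j * euler i (monomial m) + (if i = j then Var j * monomial m else 0)"
    by (simp add: euler_monomial lookup_add lookup_single Const_add algebra_simps)
next
  show "linear_op (\<lambda>p. euler i (Var j * p))"
    by (intro linear_op_comp[OF linear_op_euler] linear_op_mult linear_op_id)
  show "linear_op (\<lambda>p. Var j * euler i p + (if i = j then Var j * p else 0))"
    using linear_op_mult[OF linear_op_id, of "Var j"]
    by (cases "i = j") (auto intro!: linear_op_plus linear_op_mult linear_op_euler)
qed (simp add: support_in_def)

text \<open>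
  The additive constant \<open>r (n - i)\<close> of the Cherednik operator is distributed over the pairs \<open>i < j\<close>:
  the summand \<open>p\<close> below cancels the negative term that arises on \<open>x\<^sup>\<eta>\<close> when \<open>\<eta>\<^sub>j = \<eta>\<^sub>i + 1\<close>.
\<close>

definition exchange :: "bool \<Rightarrow> nat \<Rightarrow> nat \<Rightarrow> mpoly \<Rightarrow> mpoly" where
  "exchange b i j p =
     (if b then Var i * divided_difference i j p else Var j * divided_difference i j p + p)"

lemma linear_op_exchange: "linear_op (exchange b i j)"
  unfolding exchange_def
  by (cases b) (simp_all add: linear_op_plus linear_op_mult linear_op_divided_difference linear_op_id)

lemma permute_vars_exchange:
  "bij w \<Longrightarrow> permute_vars w (exchange b i j p) = exchange b (w i) (w j) (permute_vars w p)"
  by (simp add: exchange_def permute_vars_simps permute_vars_divided_difference)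

text \<open>The two variants differ by the transposition alone, since x_i - x_j times the divided
  difference is known. This is the correction that arises when a swap reverses the order of
  \<open>i\<close> and \<open>j\<close>.\<close>

lemma exchange_False:
  "i \<noteq> j \<Longrightarrow> exchange False i j p = exchange True i j p + permute_vars (Transposition.transpose i j) p"
  using divided_difference_mult[of i j p] by (simp add: exchange_def algebra_simps)

definition cherednik :: "nat \<Rightarrow> nat \<Rightarrow> mpoly \<Rightarrow> mpoly" where
  "cherednik n i p = euler i p + Const r * (\<Sum>j\<in>{1..n} - {i}. exchange (j < i) i j p)"

lemma linear_op_cherednik: "linear_op (cherednik n i)"
  unfolding cherednik_def
  by (intro linear_op_plus linear_op_euler linear_op_mult linear_op_lsum linear_op_exchange)

text \<open>All ingredients are equivariant except the flag \<open>j < i\<close>, which is pulled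
  back along \<open>w\<close>. The commutation relations amount to tracking which flags
  change.\<close>

lemma permute_vars_cherednik:
  assumes w: "w permutes {1..n}"
  shows "permute_vars w (cherednik n i p) = euler (w i) (permute_vars w p)
    + Const r * (\<Sum>j\<in>{1..n} - {w i}. exchange (inv w j < i) (w i) j (permute_vars w p))"
proof -
  have "bij_betw w ({1..n} - {i}) ({1..n} - {w i})"
  proof (rule bij_betw_imageI)
    show "inj_on w ({1..n} - {i})" by (rule inj_on_subset[OF permutes_inj[OF w]]) simp
    show "w ` ({1..n} - {i}) = {1..n} - {w i}"
      using image_set_diff[OF permutes_inj[OF w], of "{1..n}" "{i}"] permutes_image[OF w] by simp
  qed
  then have "(\<Sum>j\<in>{1..n} - {w i}. exchange (inv w j < i) (w i) j (permute_vars w p))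
      = (\<Sum>j\<in>{1..n} - {i}. exchange (j < i) (w i) (w j) (permute_vars w p))"
    by (subst sum.reindex_bij_betw[symmetric, of w "{1..n} - {i}"]) (simp_all add: permutes_inverses[OF w])
  then show ?thesis
    by (simp add: cherednik_def permute_vars_simps permute_vars_sum permute_vars_exchange[OF permutes_bij[OF w]]
        permute_vars_euler[OF permutes_bij[OF w]])
qed

section \<open>Commutation relations of the Cherednik operators\<close>

lemma permute_vars_swap_swap [simp]: "permute_vars (swap k) (permute_vars (swap k) p) = p"
  by (simp add: permute_vars_comp permute_vars_id)

lemma cherednik_swap_other:
  assumes k: "k \<in> {1..<n}" and i: "i \<notin> {k, Suc k}"
  shows "cherednik n i (permute_vars (swap k) p) = permute_vars (swap k) (cherednik n i p)"
proof -
  have "(swap k j < i) = (j < i)" for j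
    using i by (auto simp: Transposition.transpose_def)
  then show ?thesis
    using i by (simp add: permute_vars_cherednik[OF swap_permutes[OF k]]) (simp add: cherednik_def)
qed

text \<open>A relation of the graded Hecke algebra: the swap changes only the flag of the pair
  \<open>k\<close>, \<open>Suc k\<close>, and \<open>exchange_False\<close> turns this change into
  \<open>Const r * p\<close>.\<close>

lemma cherednik_swap_left:
  assumes k: "k \<in> {1..<n}"
  shows "cherednik n k (permute_vars (swap k) p) = permute_vars (swap k) (cherednik n (Suc k) p) + Const r * p"
proof -
  let ?q = "permute_vars (swap k) p"
  have "swap k j < Suc k \<longleftrightarrow> j < k" if "j \<notin> {k, Suc k}" for j
    using that by (auto simp: Transposition.transpose_def)
  then have rest: "(\<Sum>j\<in>{1..n} - {k} - {Suc k}. exchange (swap k j < Suc k) k j ?q)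
      = (\<Sum>j\<in>{1..n} - {k} - {Suc k}. exchange (j < k) k j ?q)"
    by (intro sum.cong) auto
  have Sk: "Suc k \<in> {1..n} - {k}" using k by auto
  have flip: "exchange False k (Suc k) ?q = exchange True k (Suc k) ?q + p"
    using exchange_False[of k "Suc k" ?q] by simp
  have "permute_vars (swap k) (cherednik n (Suc k) p)
      = euler k ?q + Const r * (\<Sum>j\<in>{1..n} - {k}. exchange (swap k j < Suc k) k j ?q)"
    using permute_vars_cherednik[OF swap_permutes[OF k], of "Suc k" p] by simp
  also have "\<dots> = euler k ?q + Const r * (exchange True k (Suc k) ?q + (\<Sum>j\<in>{1..n} - {k} - {Suc k}. exchange (j < k) k j ?q))"
    unfolding rest[symmetric] using sum.remove[OF _ Sk, of "\<lambda>j. exchange (swap k j < Suc k) k j ?q"] by simp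
  finally have sw: "permute_vars (swap k) (cherednik n (Suc k) p)
    = euler k ?q + Const r * (exchange True k (Suc k) ?q + (\<Sum>j\<in>{1..n} - {k} - {Suc k}. exchange (j < k) k j ?q))" .
  have "cherednik n k ?q
      = euler k ?q + Const r * (exchange False k (Suc k) ?q + (\<Sum>j\<in>{1..n} - {k} - {Suc k}. exchange (j < k) k j ?q))"
    unfolding cherednik_def using sum.remove[OF _ Sk, of "\<lambda>j. exchange (j < k) k j ?q"] by simp
  then show ?thesis unfolding sw flip by (simp only: distrib_left add_ac)
qed

lemma cherednik_swap_right:
  assumes k: "k \<in> {1..<n}"
  shows "cherednik n (Suc k) (permute_vars (swap k) p) = permute_vars (swap k) (cherednik n k p) - Const r * p"
proof -
  have "permute_vars (swap k) (cherednik n k p)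
      = permute_vars (swap k) (permute_vars (swap k) (cherednik n (Suc k) (permute_vars (swap k) p))
          + Const r * permute_vars (swap k) p)"
    using cherednik_swap_left[OF k, of "permute_vars (swap k) p"] by simp
  then show ?thesis by (simp add: permute_vars_simps(5,6,3))
qed

lemma cycle_inv_permutes: "1 \<le> n \<Longrightarrow> cycle_inv n permutes {1..n}"
  using permutes_inv[OF cycle_permutes[of n]] inv_cycle[of n] by simp

lemma inv_cycle_inv: "1 \<le> n \<Longrightarrow> inv (cycle_inv n) = cycle n"
  by (rule inv_equality) (auto simp: cycle_inverses)

text \<open>Rotation changes the flag of the pair \<open>i\<close>, \<open>n\<close> only, and the
  factor x_n absorbs this: the divided difference of x_n q is x_i times that of q, minus q, and the
  \<open>- q\<close> cancels the separate summand of \<open>exchange False\<close>.\<close>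

lemma cherednik_cycle:
  assumes "i \<in> {1..<n}"
  shows "cherednik n i (Var n * permute_vars (cycle_inv n) p)
    = Var n * permute_vars (cycle_inv n) (cherednik n (Suc i) p)"
proof -
  let ?q = "permute_vars (cycle_inv n) p"
  have n: "1 \<le> n" "cycle_inv n (Suc i) = i" using assms by (auto simp: cycle_inv_def)
  have "exchange (j < i) i j (Var n * ?q) = Var n * exchange (cycle n j < Suc i) i j ?q"
    if "j \<in> {1..n} - {i}" for j
  proof (cases "j = n")
    case True
    then show ?thesis using that assms
      by (simp add: exchange_def cycle_def divided_difference_Var(2) algebra_simps)
  next
    case False
    then show ?thesis using that assms
      by (simp add: exchange_def cycle_def divided_difference_Var(1) algebra_simps)
  qed
  then have "cherednik n i (Var n * ?q) = Var n * (euler i ?q + Const r * (\<Sum>j\<in>{1..n} - {i}. exchange (cycle n j < Suc i) i j ?q))"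
    using assms by (simp add: cherednik_def euler_Var sum_distrib_left[symmetric] distrib_left mult.left_commute)
  then show ?thesis
    using permute_vars_cherednik[OF cycle_inv_permutes[OF n(1)], of "Suc i" p]
    by (simp add: n(2) inv_cycle_inv[OF n(1)])
qed

text \<open>Here every flag changes, and each change is absorbed by x_n through the Leibniz rule.
  The extra \<open>p\<close> comes from \<open>euler n\<close> acting on the factor x_n.\<close>

lemma cherednik_cycle_last:
  assumes "1 \<le> n"
  shows "cherednik n n (Var n * permute_vars (cycle_inv n) p)
    = Var n * permute_vars (cycle_inv n) (cherednik n 1 p + p)"
proof -
  let ?q = "permute_vars (cycle_inv n) p"
  have n: "cycle_inv n (Suc 0) = n" by (simp add: cycle_inv_def)
  have "exchange (j < n) n j (Var n * ?q) = Var n * exchange (cycle n j < Suc 0) n j ?q"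
    if "j \<in> {1..n} - {n}" for j
    using that by (simp add: exchange_def cycle_def divided_difference_Var(3) algebra_simps)
  then have "cherednik n n (Var n * ?q)
      = Var n * (euler n ?q + ?q + Const r * (\<Sum>j\<in>{1..n} - {n}. exchange (cycle n j < Suc 0) n j ?q))"
    by (simp add: cherednik_def euler_Var sum_distrib_left[symmetric] distrib_left mult.left_commute)
  then show ?thesis
    using permute_vars_cherednik[OF cycle_inv_permutes[OF assms], of "Suc 0" p]
    by (simp add: n inv_cycle_inv[OF assms] permute_vars_simps algebra_simps)
qed

section \<open>The dehomogenization map and its intertwining relations\<close>

lemma compositions_split:
  assumes "\<mu> \<in> compositions n" "0 < lookup \<mu> i"
  obtains \<nu> where "\<nu> \<in> compositions n" "\<mu> = \<nu> + single i 1" "weight \<mu> = Suc (weight \<nu>)"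
proof -
  have eq: "\<mu> = (\<mu> - single i 1) + single i 1"
    using assms(2) by (intro poly_mapping_eqI) (auto simp: lookup_add lookup_minus lookup_single when_def)
  moreover have "\<mu> - single i 1 \<in> compositions n"
    by (rule compositionsI) (simp add: lookup_minus compositions_lookup[OF assms(1)])
  moreover have "weight \<mu> = Suc (weight (\<mu> - single i 1))" by (subst eq) simp
  ultimately show thesis using that by blast
qed

lemma compositions_nonzero_entry:
  assumes "\<mu> \<in> compositions n" "weight \<mu> \<noteq> 0"
  obtains i where "i \<in> {1..n}" "0 < lookup \<mu> i"
proof -
  have "(\<Sum>i\<in>{1..n}. lookup \<mu> i) \<noteq> 0" using assms weight_eq by metis
  then obtain i where "i \<in> {1..n}" "lookup \<mu> i \<noteq> 0" by (meson sum.neutral)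
  then show thesis using that by blast
qed

lemma composition_unit_induct [consumes 1, case_names zero unit]:
  assumes "\<mu> \<in> compositions n" "P 0"
    and "\<And>\<mu> i. \<mu> \<in> compositions n \<Longrightarrow> i \<in> {1..n} \<Longrightarrow> P \<mu> \<Longrightarrow> P (\<mu> + single i 1)"
  shows "P \<mu>"
  using assms(1)
proof (induction "weight \<mu>" arbitrary: \<mu>)
  case 0
  then show ?case using assms(2) by simp
next
  case (Suc d)
  then obtain i where i: "i \<in> {1..n}" "0 < lookup \<mu> i" using compositions_nonzero_entry by (metis nat.distinct(1))
  then obtain \<nu> where "\<nu> \<in> compositions n" "\<mu> = \<nu> + single i 1" "weight \<mu> = Suc (weight \<nu>)"
    using compositions_split Suc.prems by blast
  then show ?case using Suc i assms(3) by auto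
qed

text \<open>A nonzero entry is carried to the last place by neighbour swaps, and a composition with
  nonzero last entry is an affine shift of one of smaller weight. The inner induction runs over the
  distance \<open>n - k\<close> to the last place.\<close>

lemma composition_affine_induct [consumes 2, case_names zero affine swap]:
  assumes "1 \<le> n" "\<mu> \<in> compositions n" "P 0"
    and affine: "\<And>\<mu>. \<mu> \<in> compositions n \<Longrightarrow> P \<mu> \<Longrightarrow> P (affine_shift n \<mu>)"
    and swap: "\<And>\<mu> k. \<mu> \<in> compositions n \<Longrightarrow> k \<in> {1..<n} \<Longrightarrow> P \<mu> \<Longrightarrow> P (map_key (swap k) \<mu>)"
  shows "P \<mu>"
  using assms(2)
proof (induction "weight \<mu>" arbitrary: \<mu>)
  case 0
  then show ?case using assms(3) by simp
next
  case (Suc d)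
  have "P \<nu>" if "k \<in> {1..n}" "\<nu> \<in> compositions n" "weight \<nu> = Suc d" "0 < lookup \<nu> k" for k \<nu>
    using that
  proof (induction "n - k" arbitrary: k \<nu>)
    case 0
    then have "k = n" by simp
    then obtain \<eta> where "\<eta> \<in> compositions n" "\<nu> = affine_shift n \<eta>" "weight \<nu> = Suc (weight \<eta>)"
      using affine_shift_surj[OF assms(1)] 0 by blast
    then show ?case using Suc.hyps(1)[of \<eta>] 0 affine by simp
  next
    case (Suc l)
    then have k: "k \<in> {1..<n}" by auto
    let ?\<nu> = "map_key (swap k) \<nu>"
    have "map_key (swap k) ?\<nu> = \<nu>"
      by (rule poly_mapping_eqI) (simp add: lookup_map_key)
    moreover have "P ?\<nu>"
      using Suc k by (intro Suc.hyps(1)[of "Suc k"])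
        (auto simp: compositions_map_key[OF swap_permutes] weight_map_key[OF swap_permutes] lookup_map_key)
    ultimately show ?case
      using swap[of ?\<nu> k] k Suc.prems by (auto simp: compositions_map_key[OF swap_permutes])
  qed
  then show ?case using compositions_nonzero_entry[OF Suc.prems] Suc.hyps(2) Suc.prems by (metis nat.distinct(1))
qed

lemma polys_below_mult':
  "p \<in> polys_below n a \<Longrightarrow> q \<in> polys_below n (Suc b) \<Longrightarrow> p * q \<in> polys_below n (a + b)"
proof (cases a)
  case 0
  assume "p \<in> polys_below n a"
  then have "p = 0" using 0 by (simp add: support_in_def)
  then show ?thesis by simp
qed (simp add: polys_below_mult)

lemma polys_below_monomial: "\<mu> \<in> compositions n \<Longrightarrow> monomial \<mu> \<in> polys_below n (Suc (weight \<mu>))"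
  by (rule support_in_monomial) (simp add: comps_below_def)

lemma homogeneous_monomial: "\<mu> \<in> compositions n \<Longrightarrow> monomial \<mu> \<in> homogeneous n (weight \<mu>)"
  by (rule support_in_monomial) (simp add: comps_of_weight_def)

text \<open>The two substitutions differ only by x_n + 1 against x_n, in lower order. For a product
  the difference is split as (A - B) A' + (A' - B') B, and in each summand one factor loses a
  degree.\<close>

lemma shift_vars_top:
  assumes n: "1 \<le> n" and p: "p \<in> homogeneous n d"
  shows "shift_vars n p - permute_vars (cycle_inv n) p \<in> polys_below n d"
proof -
  let ?A = "shift_vars n" and ?B = "permute_vars (cycle_inv n)"
  have mono: "?A (monomial \<mu>) - ?B (monomial \<mu>) \<in> polys_below n (weight \<mu>)" if "\<mu> \<in> compositions n" for \<mu>
    using that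
  proof (induction \<mu> rule: composition_unit_induct)
    case zero
    then show ?case by (simp add: shift_vars_def permute_vars_simps)
  next
    case (unit \<mu> i)
    have V: "monomial (\<mu> + single i 1) = Var i * monomial \<mu>" by (simp add: monomial_add Var_def)
    have eq: "?A (Var i * monomial \<mu>) - ?B (Var i * monomial \<mu>)
        = (?A (monomial \<mu>) - ?B (monomial \<mu>)) * ?A (Var i) + (?A (Var i) - ?B (Var i)) * ?B (monomial \<mu>)"
      by (simp add: shift_vars_def permute_vars_simps algebra_simps)
    have "?A (Var i) \<in> polys_below n (Suc 1)"
      using shift_vars_polys_below[OF n polys_below_Var[OF unit(2)]] by simp
    then have 1: "(?A (monomial \<mu>) - ?B (monomial \<mu>)) * ?A (Var i) \<in> polys_below n (weight \<mu> + 1)"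
      by (rule polys_below_mult'[OF unit(3)])
    have "?A (Var i) - ?B (Var i) \<in> polys_below n 1"
      using polys_below_1[of n] by (auto simp: shift_vars_def permute_vars_simps cycle_inv_def)
    moreover have "?B (monomial \<mu>) \<in> polys_below n (Suc (weight \<mu>))"
      by (rule permute_vars_support(2)[OF cycle_inv_permutes[OF n] polys_below_monomial[OF unit(1)]])
    ultimately have 2: "(?A (Var i) - ?B (Var i)) * ?B (monomial \<mu>) \<in> polys_below n (1 + weight \<mu>)"
      by (rule polys_below_mult')
    show ?case unfolding V eq using support_in_add[OF 1 2[unfolded add.commute[of 1]]] by simp
  qed
  have lin: "linear_op (\<lambda>p. ?A p - ?B p)"
    by (rule linear_op_minus[OF linear_op_shift_vars linear_op_permute_vars])
  show ?thesis
    by (rule linear_op_support_in[OF lin _ p]) (use mono in \<open>auto simp: comps_of_weight_def\<close>)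
qed

text \<open>Stated with \<open>Suc\<close> rather than subtraction, so that for weight 0 the support
  is empty and the result is 0.\<close>

lemma divided_difference_support:
  assumes ij: "i \<in> {1..n}" "j \<in> {1..n}" and \<mu>: "\<mu> \<in> compositions n"
  shows "divided_difference i j (monomial \<mu>) \<in> support_in {\<nu> \<in> compositions n. Suc (weight \<nu>) = weight \<mu>}"
proof (cases "i = j")
  case False
  obtain m where m: "\<mu> = m + single i (lookup \<mu> i) + single j (lookup \<mu> j)" "lookup m i = 0" "lookup m j = 0"
    using exponent_pair[OF False] by blast
  have mc: "m \<in> compositions n"
  proof (rule compositionsI)
    fix l assume l: "l \<notin> {1..n}"
    have "lookup \<mu> l = lookup m l + lookup (single i (lookup \<mu> i)) l + lookup (single j (lookup \<mu> j)) l"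
      by (subst m(1)) (simp add: lookup_add)
    then show "lookup m l = 0" using compositions_lookup[OF \<mu> l] by simp
  qed
  have S: "(\<Sum>t<k. monomial (m + single i (c + t) + single j (c + (k - Suc t))))
      \<in> support_in {\<nu> \<in> compositions n. Suc (weight \<nu>) = weight m + c + c + k}" for c k
  proof (rule support_in_sum, rule support_in_monomial)
    fix t assume "t \<in> {..<k}"
    moreover have "m + single i (c + t) + single j (c + (k - Suc t)) \<in> compositions n"
      by (intro compositions_add compositions_single mc ij)
    ultimately show "m + single i (c + t) + single j (c + (k - Suc t))
        \<in> {\<nu> \<in> compositions n. Suc (weight \<nu>) = weight m + c + c + k}" by simp
  qed
  show ?thesis
  proof (cases "lookup \<mu> j \<le> lookup \<mu> i")
    case True
    then obtain k where k: "lookup \<mu> i = lookup \<mu> j + k" using le_Suc_ex by blast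
    have "weight \<mu> = weight m + lookup \<mu> j + lookup \<mu> j + k" by (subst m(1)) (simp add: k)
    then show ?thesis using S[of "lookup \<mu> j" k]
      by (subst m(1), unfold k divided_difference_pair(1)[OF False m(2,3)]) simp
  next
    case False
    then obtain k where k: "lookup \<mu> j = lookup \<mu> i + k" using le_Suc_ex nat_le_linear by blast
    have "weight \<mu> = weight m + lookup \<mu> i + lookup \<mu> i + k" by (subst m(1)) (simp add: k)
    then show ?thesis using support_in_uminus[OF S[of "lookup \<mu> i" k]]
      by (subst m(1), unfold k divided_difference_pair(2)[OF \<open>i \<noteq> j\<close> m(2,3)]) simp
  qed
qed (simp add: divided_difference_def)

lemma divided_difference_polys_below:
  assumes ij: "i \<in> {1..n}" "j \<in> {1..n}" and p: "p \<in> polys_below n (Suc d)"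
  shows "divided_difference i j p \<in> polys_below n d"
proof (rule linear_op_support_in[OF linear_op_divided_difference _ p])
  fix m assume "m \<in> comps_below n (Suc d)"
  then show "divided_difference i j (monomial m) \<in> polys_below n d"
    using divided_difference_support[OF ij, of m] by (auto simp: comps_below_def elim!: support_in_mono[rotated])
qed

lemma exchange_homogeneous:
  assumes ij: "i \<in> {1..n}" "j \<in> {1..n}" and p: "p \<in> homogeneous n d"
  shows "exchange b i j p \<in> homogeneous n d"
proof (rule linear_op_homogeneous[OF linear_op_exchange _ p])
  fix m assume m: "m \<in> compositions n"
  have dd: "Var l * divided_difference i j (monomial m) \<in> homogeneous n (weight m)" if "l \<in> {1..n}" for l
  proof (cases "weight m")
    case 0
    then have "divided_difference i j (monomial m) = 0"
      using divided_difference_support[OF ij m] by (simp add: support_in_def)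
    then show ?thesis by simp
  next
    case (Suc w)
    then have "divided_difference i j (monomial m) \<in> homogeneous n w"
      using divided_difference_support[OF ij m] by (auto simp: comps_of_weight_def elim!: support_in_mono[rotated])
    then show ?thesis using homogeneous_Var_mult[OF that] Suc by simp
  qed
  show "exchange b i j (monomial m) \<in> homogeneous n (weight m)"
    using dd ij support_in_add[OF dd[OF ij(2)] homogeneous_monomial[OF m]] by (simp add: exchange_def)
qed

lemma cherednik_homogeneous:
  assumes "i \<in> {1..n}" "p \<in> homogeneous n d"
  shows "cherednik n i p \<in> homogeneous n d"
  unfolding cherednik_def
proof (intro support_in_add support_in_Const_mult support_in_sum)
  show "euler i p \<in> homogeneous n d"
    by (rule linear_op_homogeneous[OF linear_op_euler _ assms(2)])
      (simp add: euler_monomial support_in_Const_mult homogeneous_monomial)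
qed (use assms in \<open>auto intro: exchange_homogeneous\<close>)

section \<open>The lift: prescribed top component, vanishing at the lower points\<close>

definition is_lift :: "nat \<Rightarrow> nat \<Rightarrow> mpoly \<Rightarrow> mpoly \<Rightarrow> bool" where
  "is_lift n d p q \<longleftrightarrow> q - p \<in> polys_below n d \<and> (\<forall>\<gamma>\<in>comps_below n d. eval_at (point n \<gamma>) q = 0)"

lemma is_lift_unique:
  assumes "is_lift n d p q" "is_lift n d p q'"
  shows "q = q'"
proof -
  have "(q - p) - (q' - p) \<in> polys_below n d"
    using assms unfolding is_lift_def by (blast intro: support_in_diff)
  then have "q - q' \<in> polys_below n d" by simp
  then have "q - q' = 0"
    by (rule interpolation_unique) (use assms in \<open>auto simp: is_lift_def\<close>)
  then show ?thesis by simp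
qed

lemma is_lift_exists: "\<exists>q. is_lift n d p q"
proof -
  obtain s where "s \<in> polys_below n d" "\<And>\<gamma>. \<gamma> \<in> comps_below n d \<Longrightarrow> eval_at (point n \<gamma>) s = eval_at (point n \<gamma>) p"
    using interpolation_exists[of n d "\<lambda>\<gamma>. eval_at (point n \<gamma>) p"] by blast
  then have "is_lift n d p (p - s)" by (simp add: is_lift_def support_in_uminus)
  then show ?thesis by blast
qed

text \<open>Fixing it on monomials makes it linear across degrees; since both conditions of
  \<open>is_lift\<close> are linear for fixed degree, \<open>is_lift_lift\<close> recovers the
  vanishing description for every homogeneous polynomial.\<close>

definition lift :: "nat \<Rightarrow> mpoly \<Rightarrow> mpoly" where
  "lift n = linear_extension (\<lambda>m. THE q. is_lift n (weight m) (monomial m) q)"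

lemma linear_op_lift: "linear_op (lift n)"
  unfolding lift_def by (rule linear_op_extension)

lemmas lift_simps = linear_op_simps[OF linear_op_lift]

lemma is_lift_monomial: "is_lift n (weight m) (monomial m) (lift n (monomial m))"
proof -
  have "\<exists>!q. is_lift n (weight m) (monomial m) q"
    using is_lift_exists is_lift_unique by blast
  from theI'[OF this] show ?thesis by (simp add: lift_def)
qed

lemma is_lift_lift:
  assumes p: "p \<in> homogeneous n d"
  shows "is_lift n d p (lift n p)"
proof -
  have lin: "linear_op (\<lambda>p. lift n p - p)"
    by (intro linear_op_minus linear_op_lift linear_op_id)
  have "lift n p - p \<in> polys_below n d"
    by (rule linear_op_support_in[OF lin _ p])
      (use is_lift_monomial in \<open>auto simp: comps_of_weight_def is_lift_def\<close>)
  moreover have "eval_at (point n \<gamma>) (lift n p) = 0" if \<gamma>: "\<gamma> \<in> comps_below n d" for \<gamma>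
  proof -
    have "eval_at (point n \<gamma>) (lift n (monomial m)) = 0" if "m \<in> keys p" for m
      using that p is_lift_monomial[of n m] \<gamma> by (auto simp: support_in_def comps_of_weight_def is_lift_def)
    then show ?thesis
      by (subst linear_op_expand[OF linear_op_lift]) (simp add: eval_at_sum)
  qed
  ultimately show ?thesis by (simp add: is_lift_def)
qed

lemma lift_eqI: "p \<in> homogeneous n d \<Longrightarrow> is_lift n d p q \<Longrightarrow> lift n p = q"
  using is_lift_lift is_lift_unique by blast

lemma lift_top: "p \<in> homogeneous n d \<Longrightarrow> lift n p - p \<in> polys_below n d"
  using is_lift_lift by (auto simp: is_lift_def)

lemma lift_vanishes: "p \<in> homogeneous n d \<Longrightarrow> \<gamma> \<in> comps_below n d \<Longrightarrow> eval_at (point n \<gamma>) (lift n p) = 0"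
  using is_lift_lift by (auto simp: is_lift_def)

lemma lift_polys_below:
  assumes "p \<in> homogeneous n d"
  shows "lift n p \<in> polys_below n (Suc d)"
  using support_in_add[OF polys_below_mono[OF le_SucI[OF order_refl] lift_top[OF assms]]
      homogeneous_polys_below[OF assms]] by simp

lemma lift_1: "lift n 1 = 1"
proof (rule lift_eqI)
  show "1 \<in> homogeneous n 0" using homogeneous_monomial[of 0 n] by simp
qed (simp add: is_lift_def)

definition demazure :: "nat \<Rightarrow> mpoly \<Rightarrow> mpoly" where
  "demazure k q = permute_vars (swap k) q - Const r * divided_difference k (Suc k) q"

lemma linear_op_demazure: "linear_op (demazure k)"
  unfolding demazure_def
  by (intro linear_op_minus linear_op_permute_vars linear_op_mult linear_op_divided_difference)

lemma eval_at_permute_vars: "eval_at v (permute_vars w p) = eval_at (\<lambda>i. v (w i)) p"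
  by (simp add: permute_vars_def eval_at_sub)

text \<open>If \<gamma>_k = \<gamma>_(k+1), the two coordinates differ by -r, and the defining
  equation of the divided difference makes the two terms of \<open>demazure\<close> cancel.
  Otherwise the swapped point belongs to a composition of the same weight, where the lift vanishes,
  and the distinct coordinates force the divided difference to vanish too.\<close>

lemma lift_swap:
  assumes k: "k \<in> {1..<n}" and p: "p \<in> homogeneous n d"
  shows "lift n (permute_vars (swap k) p) = demazure k (lift n p)"
proof (rule lift_eqI)
  show "permute_vars (swap k) p \<in> homogeneous n d"
    by (rule permute_vars_support(1)[OF swap_permutes[OF k] p])
  let ?q = "lift n p" and ?D = "divided_difference k (Suc k) (lift n p)"
  show "is_lift n d (permute_vars (swap k) p) (demazure k ?q)"
    unfolding is_lift_def
  proof safe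
    have "permute_vars (swap k) (?q - p) - Const r * ?D \<in> polys_below n d"
      using k by (intro support_in_diff support_in_Const_mult permute_vars_support(2)[OF swap_permutes[OF k]]
          lift_top p divided_difference_polys_below lift_polys_below) auto
    then show "demazure k ?q - permute_vars (swap k) p \<in> polys_below n d"
      by (simp add: demazure_def permute_vars_simps algebra_simps)
  next
    fix \<gamma> assume \<gamma>: "\<gamma> \<in> comps_below n d"
    let ?v = "point n \<gamma>"
    have q0: "eval_at ?v ?q = 0" by (rule lift_vanishes[OF p \<gamma>])
    have "eval_at ?v ((Var k - Var (Suc k)) * ?D) = eval_at ?v (?q - permute_vars (swap k) ?q)"
      by (subst divided_difference_mult) simp_all
    then have D: "(?v k - ?v (Suc k)) * eval_at ?v ?D = - eval_at ?v (permute_vars (swap k) ?q)"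
      by (simp add: q0)
    show "eval_at ?v (demazure k ?q) = 0"
    proof (cases "lookup \<gamma> k = lookup \<gamma> (Suc k)")
      case True
      then show ?thesis using D point_diff[OF k True] by (simp add: demazure_def)
    next
      case False
      have \<gamma>': "map_key (swap k) \<gamma> \<in> comps_below n d"
        using \<gamma> compositions_map_key[OF swap_permutes[OF k]] weight_map_key[OF swap_permutes[OF k]]
        by (simp add: comps_below_def)
      have "eval_at ?v (permute_vars (swap k) ?q) = eval_at (point n (map_key (swap k) \<gamma>)) ?q"
        unfolding eval_at_permute_vars
        by (rule eval_at_cong[OF polys_below_polys[OF lift_polys_below[OF p]]]) (simp add: point_swap[OF k False])
      then have s0: "eval_at ?v (permute_vars (swap k) ?q) = 0"
        using lift_vanishes[OF p \<gamma>'] by simp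
      moreover have "?v k \<noteq> ?v (Suc k)"
      proof
        assume "?v k = ?v (Suc k)"
        moreover have kk: "k \<in> {1..n}" "Suc k \<in> {1..n}" using k by auto
        ultimately show False
          using False by (simp only: point_eq[OF kk(1)] point_eq[OF kk(2)] neg_equal_iff_equal spectral_value_eq_iff simp_thms)
      qed
      ultimately show ?thesis using D by (simp add: demazure_def)
    qed
  qed
qed

text \<open>A point with \<gamma>_n = 0 has last coordinate \<open>ground_value n n = 0\<close> and
  is killed by the factor x_n. Every other one is the affine shift of a point of weight below
  \<open>d\<close>, where the lift of \<open>p\<close> vanishes.\<close>

lemma lift_cycle:
  assumes n: "1 \<le> n" and p: "p \<in> homogeneous n d"
  shows "lift n (Var n * permute_vars (cycle_inv n) p) = Var n * shift_vars n (lift n p)"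
proof (rule lift_eqI)
  let ?q = "lift n p"
  have nn: "n \<in> {1..n}" using n by simp
  show "Var n * permute_vars (cycle_inv n) p \<in> homogeneous n (Suc d)"
    by (intro homogeneous_Var_mult nn permute_vars_support(1)[OF cycle_inv_permutes[OF n]] p)
  show "is_lift n (Suc d) (Var n * permute_vars (cycle_inv n) p) (Var n * shift_vars n ?q)"
    unfolding is_lift_def
  proof safe
    have "Var n * (shift_vars n (?q - p) + (shift_vars n p - permute_vars (cycle_inv n) p)) \<in> polys_below n (Suc d)"
      by (intro polys_below_Var_mult nn support_in_add shift_vars_polys_below n lift_top p shift_vars_top)
    then show "Var n * shift_vars n ?q - Var n * permute_vars (cycle_inv n) p \<in> polys_below n (Suc d)"
      by (simp add: linear_op_diff[OF linear_op_shift_vars] right_diff_distrib)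
  next
    fix \<gamma> assume \<gamma>: "\<gamma> \<in> comps_below n (Suc d)"
    then have c: "\<gamma> \<in> compositions n" by (simp add: comps_below_def)
    show "eval_at (point n \<gamma>) (Var n * shift_vars n ?q) = 0"
    proof (cases "lookup \<gamma> n = 0")
      case True
      then show ?thesis using point_eq_ground_value_iff[OF nn c] by (simp add: ground_value_def)
    next
      case False
      then obtain \<eta> where \<eta>: "\<eta> \<in> compositions n" "\<gamma> = affine_shift n \<eta>" "weight \<gamma> = Suc (weight \<eta>)"
        using affine_shift_surj[OF n c] by auto
      then have "\<eta> \<in> comps_below n d" using \<gamma> by (simp add: comps_below_def)
      then show ?thesis
        unfolding \<eta>(2) using eval_at_shift_vars[OF n order_refl \<eta>(1), of ?q]
          lift_vanishes[OF p] polys_below_polys[OF lift_polys_below[OF p]] by simp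
    qed
  qed
qed

lemma cherednik_1:
  assumes "i \<in> {1..n}"
  shows "cherednik n i 1 = Const (r * of_nat (n - i))"
proof -
  have dd: "divided_difference i j 1 = 0" if "j \<noteq> i" for j
    using that by (intro divided_difference_unique) (auto simp: permute_vars_simps)
  have "exchange (j < i) i j 1 = (if i < j then 1 else 0)" if "j \<in> {1..n} - {i}" for j
    using that by (auto simp: exchange_def dd)
  then have "(\<Sum>j\<in>{1..n} - {i}. exchange (j < i) i j 1) = (\<Sum>j\<in>{1..n} - {i}. if i < j then 1 else 0)"
    by (intro sum.cong) auto
  also have "\<dots> = (\<Sum>j\<in>{i<..n}. 1)"
    using assms by (intro sum.mono_neutral_cong_right) auto
  finally have "(\<Sum>j\<in>{1..n} - {i}. exchange (j < i) i j 1) = of_nat (n - i)" by simp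
  then show ?thesis
    using euler_monomial[of i 0] by (simp add: cherednik_def Const_mult Const_of_nat)
qed

text \<open>Both sides change alike under the two moves that generate all monomials from 1. The
  corrections on the side of \<open>lift\<close>, from x_n + 1 and from the divided difference in
  \<open>demazure\<close>, match those in the Cherednik relations.\<close>

theorem lift_Var_monomial:
  assumes n: "1 \<le> n" and \<mu>: "\<mu> \<in> compositions n" and i: "i \<in> {1..n}"
  shows "lift n (Var i * monomial \<mu>) = Var i * lift n (monomial \<mu>) + lift n (cherednik n i (monomial \<mu>))"
  using n \<mu> i
proof (induction \<mu> arbitrary: i rule: composition_affine_induct)
  case zero
  \<comment> \<open>The only point of weight 0 is that of the zero composition; its coordinate
    \<open>i\<close> is -r (n - i).\<close>
  have "lift n (Var i) = Var i + Const (r * of_nat (n - i))"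
  proof (rule lift_eqI[OF homogeneous_Var[OF zero]], unfold is_lift_def, safe)
    show "Var i + Const (r * of_nat (n - i)) - Var i \<in> polys_below n 1"
      using polys_below_Const by simp
    fix \<gamma> assume "\<gamma> \<in> comps_below n 1"
    then have "\<gamma> = 0" by (simp add: comps_below_def)
    moreover have "{j \<in> {1..n}. beats 0 i j} = {i<..n}" using zero by (auto simp: beats_def)
    ultimately show "eval_at (point n \<gamma>) (Var i + Const (r * of_nat (n - i))) = 0"
      using zero by (simp add: point_eq nbeats_def del: atLeastAtMost_iff)
  qed
  moreover have "lift n (Const c) = Const c" for c
    using lift_simps(3)[of n c 1] by (simp add: lift_1)
  ultimately show ?case using cherednik_1[OF zero] by (simp add: lift_1)
next
  case (affine \<mu>)
  let ?f = "monomial \<mu>"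
  note hf = homogeneous_monomial[OF affine(1)]
  have perm: "cycle_inv n permutes {1..n}" by (rule cycle_inv_permutes[OF n])
  have mono: "monomial (affine_shift n \<mu>) = Var n * permute_vars (cycle_inv n) ?f"
    by (simp add: affine_shift_def monomial_add Var_def permute_vars_monomial[OF permutes_bij[OF perm]]
        inv_cycle_inv[OF n] mult.commute)
  note step = lift_cycle[OF n]
  show ?case
  proof (cases "i = n")
    case True
    have 1: "1 \<in> {1..n}" using n by simp
    have eq: "Var n * (Var n * permute_vars (cycle_inv n) ?f) = Var n * permute_vars (cycle_inv n) (Var 1 * ?f)"
      by (simp add: permute_vars_simps cycle_inv_def)
    have "lift n (Var n * monomial (affine_shift n \<mu>)) = Var n * shift_vars n (lift n (Var 1 * ?f))"
      unfolding mono eq by (rule step[OF homogeneous_Var_mult[OF 1 hf]])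
    \<comment> \<open>\<open>shift_vars\<close> sends x_1 to x_n + 1; the summand 1 becomes the
      extra \<open>?f\<close> required by \<open>cherednik_cycle_last\<close>.\<close>
    also have "\<dots> = Var n * ((Var n + 1) * shift_vars n (lift n ?f) + shift_vars n (lift n (cherednik n 1 ?f)))"
      unfolding affine.IH[OF 1] by (simp add: shift_vars_def)
    also have "\<dots> = Var n * (Var n * shift_vars n (lift n ?f)) + Var n * shift_vars n (lift n (cherednik n 1 ?f + ?f))"
      by (simp add: lift_simps linear_op_add[OF linear_op_shift_vars] algebra_simps)
    also have "\<dots> = Var n * lift n (monomial (affine_shift n \<mu>)) + lift n (cherednik n n (monomial (affine_shift n \<mu>)))"
      unfolding mono cherednik_cycle_last[OF n] step[OF hf]
        step[OF support_in_add[OF cherednik_homogeneous[OF 1 hf] hf]] ..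
    finally show ?thesis using True by simp
  next
    case False
    then have i: "i \<in> {1..<n}" "Suc i \<in> {1..n}" "cycle_inv n (Suc i) = i" using affine.prems by (auto simp: cycle_inv_def)
    have eq: "Var i * (Var n * permute_vars (cycle_inv n) ?f) = Var n * permute_vars (cycle_inv n) (Var (Suc i) * ?f)"
      by (simp add: permute_vars_simps i(3) mult.left_commute)
    have "lift n (Var i * monomial (affine_shift n \<mu>)) = Var n * shift_vars n (lift n (Var (Suc i) * ?f))"
      unfolding mono eq by (rule step[OF homogeneous_Var_mult[OF i(2) hf]])
    also have "\<dots> = Var n * (Var i * shift_vars n (lift n ?f) + shift_vars n (lift n (cherednik n (Suc i) ?f)))"
      unfolding affine.IH[OF i(2)] using i by (simp add: shift_vars_def)
    also have "\<dots> = Var i * lift n (monomial (affine_shift n \<mu>)) + lift n (cherednik n i (monomial (affine_shift n \<mu>)))"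
      unfolding mono cherednik_cycle[OF i(1)] step[OF hf] step[OF cherednik_homogeneous[OF i(2) hf]]
      by (simp add: algebra_simps)
    finally show ?thesis .
  qed
next
  case (swap \<mu> k)
  let ?f = "monomial \<mu>" and ?s = "permute_vars (Transposition.transpose k (Suc k))"
  note hf = homogeneous_monomial[OF swap(1)]
  define l where "l = Transposition.transpose k (Suc k) i"
  have l: "l \<in> {1..n}"
    unfolding l_def using permutes_in_image[OF swap_permutes[OF swap(2)]] swap.prems by blast
  have mono: "monomial (map_key (Transposition.transpose k (Suc k)) \<mu>) = ?s ?f"
    by (simp add: permute_vars_monomial)
  have "Var i * ?s ?f = ?s (Var l * ?f)" by (simp add: permute_vars_simps l_def)
  then have "lift n (Var i * ?s ?f) = demazure k (lift n (Var l * ?f))"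
    using lift_swap[OF swap(2) homogeneous_Var_mult[OF l hf]] by simp
  also have "\<dots> = demazure k (Var l * lift n ?f) + demazure k (lift n (cherednik n l ?f))"
    unfolding swap.IH[OF l] by (rule linear_op_add[OF linear_op_demazure])
  also have "demazure k (lift n (cherednik n l ?f)) = lift n (?s (cherednik n l ?f))"
    using lift_swap[OF swap(2) cherednik_homogeneous[OF l hf]] by simp
  finally have L: "lift n (Var i * ?s ?f) = demazure k (Var l * lift n ?f) + lift n (?s (cherednik n l ?f))" .
  have R: "lift n (?s ?f) = demazure k (lift n ?f)" by (rule lift_swap[OF swap(2) hf])
  consider "i = k" | "i = Suc k" | "i \<notin> {k, Suc k}" by auto
  then show ?case
  proof cases
    case 1
    \<comment> \<open>The Leibniz rule inside \<open>demazure\<close> leaves r times the lift of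
      \<open>?f\<close>, which is the correction in \<open>cherednik_swap_left\<close>. For
      \<open>i = Suc k\<close> both occur with the opposite sign.\<close>
    then have "l = Suc k" by (simp add: l_def)
    then show ?thesis
      unfolding mono L R
      by (simp add: 1 \<open>l = Suc k\<close> cherednik_swap_left[OF swap(2)] lift_simps demazure_def permute_vars_simps
          divided_difference_Var(2) algebra_simps)
  next
    case 2
    then have "l = k" by (simp add: l_def)
    then show ?thesis
      unfolding mono L R
      by (simp add: 2 \<open>l = k\<close> cherednik_swap_right[OF swap(2)] lift_simps demazure_def permute_vars_simps
          divided_difference_Var(3) algebra_simps)
  next
    case 3
    then have i: "l = i" "Transposition.transpose k (Suc k) i = i" by (auto simp: l_def)
    then show ?thesis
      unfolding mono L R
      by (simp add: i cherednik_swap_other[OF swap(2) 3] lift_simps demazure_def permute_vars_simps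
          divided_difference_Var(1)[OF _ 3] algebra_simps)
  qed
qed

section \<open>Positivity\<close>

text \<open>The bound is an integer: for |\<gamma>| > |\<eta>| it is negative and leaves only the
  coefficient 0. The disjunct \<open>c = 0\<close> is there because
  \<open>degree 0 = 0\<close>.\<close>

definition nonneg_coeff :: "int \<Rightarrow> ratfun \<Rightarrow> bool" where
  "nonneg_coeff k x \<longleftrightarrow> (\<exists>c. x = nat_poly_ratfun c \<and> (c = 0 \<or> int (degree c) \<le> k))"

lemma nat_poly_ratfun_0 [simp]: "nat_poly_ratfun 0 = 0"
  by (simp add: nat_poly_ratfun_def)

lemma nat_poly_ratfun_add: "nat_poly_ratfun (a + b) = nat_poly_ratfun a + nat_poly_ratfun b"
  unfolding nat_poly_ratfun_def to_fract_add[symmetric]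
  by (rule arg_cong[of _ _ to_fract]) (simp add: poly_eq_iff coeff_map_poly)

lemma nat_poly_ratfun_mult: "nat_poly_ratfun (a * b) = nat_poly_ratfun a * nat_poly_ratfun b"
  unfolding nat_poly_ratfun_def to_fract_mult[symmetric]
  by (rule arg_cong[of _ _ to_fract]) (simp add: poly_eq_iff coeff_map_poly coeff_mult)

lemma nonneg_coeff_0 [simp]: "nonneg_coeff k 0"
  unfolding nonneg_coeff_def by (rule exI[of _ 0]) simp

lemma nonneg_coeff_mono: "nonneg_coeff k x \<Longrightarrow> k \<le> l \<Longrightarrow> nonneg_coeff l x"
  unfolding nonneg_coeff_def by force

lemma nonneg_coeff_add:
  assumes "nonneg_coeff k x" "nonneg_coeff k y"
  shows "nonneg_coeff k (x + y)"
proof -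
  obtain a b where "x = nat_poly_ratfun a" "a = 0 \<or> int (degree a) \<le> k"
    "y = nat_poly_ratfun b" "b = 0 \<or> int (degree b) \<le> k"
    using assms unfolding nonneg_coeff_def by blast
  then show ?thesis
    unfolding nonneg_coeff_def using degree_add_le_max[of a b]
    by (intro exI[of _ "a + b"]) (auto simp: nat_poly_ratfun_add)
qed

lemma nonneg_coeff_sum: "(\<And>i. i \<in> I \<Longrightarrow> nonneg_coeff k (f i)) \<Longrightarrow> nonneg_coeff k (sum f I)"
  by (induction I rule: infinite_finite_induct) (auto intro: nonneg_coeff_add)

lemma nonneg_coeff_mult:
  assumes "nonneg_coeff k x" "nonneg_coeff l y"
  shows "nonneg_coeff (k + l) (x * y)"
proof -
  obtain a b where "x = nat_poly_ratfun a" "a = 0 \<or> int (degree a) \<le> k"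
    "y = nat_poly_ratfun b" "b = 0 \<or> int (degree b) \<le> l"
    using assms unfolding nonneg_coeff_def by blast
  then show ?thesis
    unfolding nonneg_coeff_def using degree_mult_le[of a b]
    by (intro exI[of _ "a * b"]) (auto simp: nat_poly_ratfun_mult)
qed

lemma nonneg_coeff_of_nat: "nonneg_coeff 0 (of_nat k)"
  unfolding nonneg_coeff_def
  by (rule exI[of _ "[:k:]"]) (simp add: nat_poly_ratfun_def of_nat_fract map_poly_pCons)

lemma nonneg_coeff_1: "nonneg_coeff 0 1"
  using nonneg_coeff_of_nat[of 1] by simp

lemma nonneg_coeff_r: "nonneg_coeff 1 r"
  unfolding nonneg_coeff_def
  by (rule exI[of _ "[:0, 1:]"]) (simp add: nat_poly_ratfun_def r_def map_poly_pCons)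

definition nonneg_poly :: "int \<Rightarrow> mpoly \<Rightarrow> bool" where
  "nonneg_poly k p \<longleftrightarrow> (\<forall>m. nonneg_coeff k (lookup p m))"

lemma nonneg_poly_0 [simp]: "nonneg_poly k 0"
  by (simp add: nonneg_poly_def)

lemma nonneg_poly_add: "nonneg_poly k p \<Longrightarrow> nonneg_poly k q \<Longrightarrow> nonneg_poly k (p + q)"
  by (simp add: nonneg_poly_def lookup_add nonneg_coeff_add)

lemma nonneg_poly_sum: "(\<And>i. i \<in> I \<Longrightarrow> nonneg_poly k (f i)) \<Longrightarrow> nonneg_poly k (sum f I)"
  by (simp add: nonneg_poly_def lookup_sum nonneg_coeff_sum)

lemma nonneg_poly_Const_mult: "nonneg_coeff k c \<Longrightarrow> nonneg_poly l p \<Longrightarrow> nonneg_poly (k + l) (Const c * p)"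
  by (simp add: nonneg_poly_def nonneg_coeff_mult)

lemma nonneg_poly_monomial: "nonneg_poly 0 (monomial m)"
  by (simp add: nonneg_poly_def lookup_monomial nonneg_coeff_1)

lemma Var_mult_monomial: "Var i * monomial m = monomial (m + single i 1)"
  by (simp add: monomial_add Var_def mult.commute)

text \<open>For \<nu>_j \<le> \<nu>_i the divided difference is a sum of monomials. In the remaining
  case, \<nu>_j = \<nu>_i + 1 with i < j, it is a single monomial with coefficient -1, and x_j times
  it cancels the separate summand x^\<nu>.\<close>

lemma exchange_nonneg:
  assumes "i \<noteq> j" "lookup \<nu> j \<le> lookup \<nu> i + (if i < j then 1 else 0)"
  shows "nonneg_poly 0 (exchange (j < i) i j (monomial \<nu>))"
proof -
  obtain m where m: "\<nu> = m + single i (lookup \<nu> i) + single j (lookup \<nu> j)" "lookup m i = 0" "lookup m j = 0"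
    using exponent_pair[OF assms(1)] by blast
  show ?thesis
  proof (cases "lookup \<nu> j \<le> lookup \<nu> i")
    case True
    then obtain k where k: "lookup \<nu> i = lookup \<nu> j + k" using le_Suc_ex by blast
    have "divided_difference i j (monomial \<nu>)
        = (\<Sum>t<k. monomial (m + single i (lookup \<nu> j + t) + single j (lookup \<nu> j + (k - Suc t))))"
      by (subst m(1), unfold k) (rule divided_difference_pair(1)[OF assms(1) m(2,3)])
    then have "nonneg_poly 0 (Var l * divided_difference i j (monomial \<nu>))" for l
      by (simp add: sum_distrib_left Var_mult_monomial nonneg_poly_sum nonneg_poly_monomial)
    then show ?thesis by (simp add: exchange_def nonneg_poly_add nonneg_poly_monomial)
  next
    case False
    then have k: "lookup \<nu> j = lookup \<nu> i + 1" and ij: "i < j" using assms by (auto split: if_splits)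
    have "divided_difference i j (monomial \<nu>) = - monomial (m + single i (lookup \<nu> i) + single j (lookup \<nu> i))"
      using divided_difference_pair(2)[OF assms(1) m(2,3), of "lookup \<nu> i" 1] by (subst m(1), unfold k) simp
    moreover have "\<nu> = m + single i (lookup \<nu> i) + single j (lookup \<nu> i) + single j 1"
      by (subst m(1)) (simp only: k single_add add.assoc)
    then have "Var j * monomial (m + single i (lookup \<nu> i) + single j (lookup \<nu> i)) = monomial \<nu>"
      unfolding Var_mult_monomial by (rule arg_cong[of _ _ monomial, OF sym])
    ultimately have "exchange False i j (monomial \<nu>) = 0" by (simp add: exchange_def)
    then show ?thesis using ij by simp
  qed
qed

lemma cherednik_nonneg:
  assumes "\<And>j. j \<in> {1..n} - {i} \<Longrightarrow> lookup \<nu> j \<le> lookup \<nu> i + (if i < j then 1 else 0)"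
  shows "nonneg_poly 1 (cherednik n i (monomial \<nu>))"
proof -
  have "nonneg_poly (0 + 0) (euler i (monomial \<nu>))"
    unfolding euler_monomial by (intro nonneg_poly_Const_mult nonneg_coeff_of_nat nonneg_poly_monomial)
  then have "nonneg_poly 1 (euler i (monomial \<nu>))"
    by (auto simp: nonneg_poly_def intro: nonneg_coeff_mono)
  moreover have "nonneg_poly 0 (\<Sum>j\<in>{1..n} - {i}. exchange (j < i) i j (monomial \<nu>))"
    by (rule nonneg_poly_sum, rule exchange_nonneg) (use assms in auto)
  then have "nonneg_poly (1 + 0) (Const r * (\<Sum>j\<in>{1..n} - {i}. exchange (j < i) i j (monomial \<nu>)))"
    by (intro nonneg_poly_Const_mult nonneg_coeff_r)
  ultimately show ?thesis unfolding cherednik_def by (intro nonneg_poly_add) simp_all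
qed

lemma leftmost_maximal_entry:
  assumes "\<zeta> \<in> compositions n" "weight \<zeta> \<noteq> 0"
  obtains i where "i \<in> {1..n}" "0 < lookup \<zeta> i"
    "\<And>j. j \<in> {1..n} \<Longrightarrow> lookup \<zeta> j \<le> lookup \<zeta> i" "\<And>j. j \<in> {1..n} \<Longrightarrow> j < i \<Longrightarrow> lookup \<zeta> j < lookup \<zeta> i"
proof -
  obtain i0 where i0: "i0 \<in> {1..n}" "0 < lookup \<zeta> i0" using compositions_nonzero_entry[OF assms] .
  define M where "M = Max (lookup \<zeta> ` {1..n})"
  have le: "lookup \<zeta> j \<le> M" if "j \<in> {1..n}" for j unfolding M_def using that by (intro Max_ge) auto
  have "M \<in> lookup \<zeta> ` {1..n}" unfolding M_def using i0 by (intro Max_in) auto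
  then have ex: "\<exists>i. i \<in> {1..n} \<and> lookup \<zeta> i = M" by auto
  define i where "i = (LEAST i. i \<in> {1..n} \<and> lookup \<zeta> i = M)"
  have i: "i \<in> {1..n}" "lookup \<zeta> i = M" using LeastI_ex[OF ex] unfolding i_def by blast+
  have "lookup \<zeta> j < M" if "j \<in> {1..n}" "j < i" for j
    using not_less_Least[of j "\<lambda>i. i \<in> {1..n} \<and> lookup \<zeta> i = M"] that le[OF that(1)] unfolding i_def by force
  moreover have "0 < lookup \<zeta> i" using le[OF i0(1)] i0(2) i(2) by simp
  ultimately show thesis using that[OF i(1)] le i(2) by blast
qed

text \<open>Degree count: multiplication by x_i raises both weights by one and keeps the bound. The
  Cherednik term stays in weight |\<zeta>| - 1 and brings at most one power of r, which the larger
  weight of \<zeta> allows.\<close>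

theorem lift_monomial_nonneg:
  assumes "1 \<le> n" "\<zeta> \<in> compositions n"
  shows "nonneg_coeff (int (weight \<zeta>) - int (weight \<gamma>)) (lookup (lift n (monomial \<zeta>)) \<gamma>)"
  using assms(2)
proof (induction "weight \<zeta>" arbitrary: \<zeta> \<gamma>)
  case 0
  then have "\<zeta> = 0" by simp
  then show ?case using nonneg_coeff_1 by (auto simp: lift_1 lookup_one when_def)
next
  case (Suc d)
  obtain i where i: "i \<in> {1..n}" "0 < lookup \<zeta> i"
    and max: "\<And>j. j \<in> {1..n} \<Longrightarrow> lookup \<zeta> j \<le> lookup \<zeta> i"
    and left: "\<And>j. j \<in> {1..n} \<Longrightarrow> j < i \<Longrightarrow> lookup \<zeta> j < lookup \<zeta> i"
    using leftmost_maximal_entry Suc by (metis nat.distinct(1))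
  obtain \<nu> where \<nu>: "\<nu> \<in> compositions n" "\<zeta> = \<nu> + single i 1" "weight \<zeta> = Suc (weight \<nu>)"
    using compositions_split[OF Suc.prems i(2)] .
  have d: "d = weight \<nu>" using \<nu>(3) Suc.hyps(2) by simp
  have entries: "lookup \<zeta> j = lookup \<nu> j + (if j = i then 1 else 0)" for j
    unfolding \<nu>(2) by (simp add: lookup_add lookup_single when_def)
  \<comment> \<open>\<nu>_i is one less than the maximum of \<zeta>, so entries to the left, being
    strictly below the maximum, are at most \<nu>_i and those to the right at most \<nu>_i +
    1.\<close>
  have "nonneg_poly 1 (cherednik n i (monomial \<nu>))"
  proof (rule cherednik_nonneg)
    fix j assume j: "j \<in> {1..n} - {i}"
    then show "lookup \<nu> j \<le> lookup \<nu> i + (if i < j then 1 else 0)"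
      using max[of j] left[of j] entries[of j] entries[of i] by auto
  qed
  then have pos: "nonneg_coeff 1 (lookup (cherednik n i (monomial \<nu>)) m)" for m
    by (simp add: nonneg_poly_def)
  let ?k = "int (weight \<zeta>) - int (weight \<gamma>)"
  have "nonneg_coeff ?k (lookup (Var i * lift n (monomial \<nu>)) \<gamma>)"
  proof -
    have "lookup (Var i * lift n (monomial \<nu>)) \<gamma>
        = (\<Sum>m\<in>keys (lift n (monomial \<nu>)). if m + single i 1 = \<gamma> then lookup (lift n (monomial \<nu>)) m else 0)"
      by (subst mpoly_expand[of "lift n (monomial \<nu>)"])
        (auto simp: sum_distrib_left mult.left_commute[of "Var i"] Var_mult_monomial lookup_sum lookup_monomial intro!: sum.cong)
    moreover have "nonneg_coeff ?k (if m + single i 1 = \<gamma> then lookup (lift n (monomial \<nu>)) m else 0)" for m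
      using Suc.hyps(1)[OF d \<nu>(1), of m] \<nu>(3) by auto
    ultimately show ?thesis by (simp add: nonneg_coeff_sum)
  qed
  moreover have "nonneg_coeff ?k (lookup (lift n (cherednik n i (monomial \<nu>))) \<gamma>)"
  proof -
    let ?c = "cherednik n i (monomial \<nu>)"
    have "nonneg_coeff ?k (lookup ?c m * lookup (lift n (monomial m)) \<gamma>)" if "m \<in> keys ?c" for m
    proof -
      have "m \<in> comps_of_weight n d"
        using cherednik_homogeneous[OF i(1) homogeneous_monomial[OF \<nu>(1)]] that d by (auto simp: support_in_def)
      then have m: "m \<in> compositions n" "d = weight m" by (auto simp: comps_of_weight_def)
      have "nonneg_coeff (1 + (int (weight m) - int (weight \<gamma>))) (lookup ?c m * lookup (lift n (monomial m)) \<gamma>)"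
        by (rule nonneg_coeff_mult[OF pos Suc.hyps(1)[OF m(2,1)]])
      then show ?thesis using m(2) Suc.hyps(2) by (elim nonneg_coeff_mono) simp
    qed
    then show ?thesis
      by (subst linear_op_expand[OF linear_op_lift]) (simp add: lookup_sum nonneg_coeff_sum)
  qed
  ultimately have "nonneg_coeff ?k (lookup (lift n (Var i * monomial \<nu>)) \<gamma>)"
    unfolding lift_Var_monomial[OF assms(1) \<nu>(1) i(1)] lookup_add by (rule nonneg_coeff_add)
  then show ?case by (simp only: \<nu>(2) Var_mult_monomial)
qed

section \<open>Nonsymmetric Jack polynomials\<close>

text \<open>
  The quadratic part drops by at least \<open>2 n\<close> times the moved amount when two entries are moved towards
  each other, which outweighs the linear part; the linear part orders two compositions that differ by
  a transposition.
\<close>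

definition potential_term :: "nat \<Rightarrow> nat \<Rightarrow> nat \<Rightarrow> int" where
  "potential_term n k a = int n * (int a)\<^sup>2 - int k * int a"

definition potential :: "nat \<Rightarrow> expo \<Rightarrow> int" where
  "potential n \<mu> = (\<Sum>k\<in>{1..n}. potential_term n k (lookup \<mu> k))"

lemma potential_add_single:
  assumes "i \<in> {1..n}" "lookup m i = 0"
  shows "potential n (m + single i a) = potential n m + potential_term n i a"
proof -
  have "potential_term n k (lookup (m + single i a) k)
      = potential_term n k (lookup m k) + (if k = i then potential_term n i a else 0)" for k
    using assms(2) by (auto simp: lookup_add lookup_single when_def potential_term_def)
  then show ?thesis using assms(1) by (simp add: potential_def sum.distrib)
qed

lemma potential_pair:
  assumes "i \<in> {1..n}" "j \<in> {1..n}" "i \<noteq> j" "lookup m i = 0" "lookup m j = 0"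
  shows "potential n (m + single i a + single j b)
    = potential n m + potential_term n i a + potential_term n j b"
  using assms by (simp add: potential_add_single lookup_add lookup_single_not_eq)

text \<open>The difference of the sides is u (2 n s + j - i). For s > 0 and indices in
  \<open>{1..n}\<close> the term 2 n s outweighs i - j; for s = 0, a transposition, the order of the
  indices decides.\<close>

lemma potential_term_less_left:
  assumes "int i < 2 * int n * int s + int j" "0 < u"
  shows "potential_term n i (c + s) + potential_term n j (c + u)
    < potential_term n i (c + (s + u)) + potential_term n j c"
proof -
  have "potential_term n i (c + (s + u)) + potential_term n j c
      - (potential_term n i (c + s) + potential_term n j (c + u))
      = int u * (2 * int n * int s + int j - int i)"
    by (simp add: potential_term_def power2_eq_square algebra_simps)
  moreover have "\<dots> > 0" using assms by simp
  ultimately show ?thesis by linarith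
qed

lemma potential_term_less_right:
  assumes "int j < 2 * int n * int u + int i" "0 < s"
  shows "potential_term n i (c + s) + potential_term n j (c + u)
    < potential_term n i c + potential_term n j (c + (s + u))"
  using potential_term_less_left[of j n u i s c] assms by (simp add: add.commute)

text \<open>After the cancellation in \<open>exchange False\<close>, x^\<mu> survives, with
  coefficient 1, exactly if \<open>beats \<mu> i j\<close>. Every other monomial has its two
  exponents moved towards each other or transposed into the order of lower potential.\<close>

lemma exchange_triangular:
  assumes ij: "i \<in> {1..n}" "j \<in> {1..n}" "i \<noteq> j"
  shows "exchange (j < i) i j (monomial \<mu>) - Const (if beats \<mu> i j then 1 else 0) * monomial \<mu>
    \<in> support_in {\<nu>. potential n \<nu> < potential n \<mu>}"
proof -
  let ?S = "support_in {\<nu>. potential n \<nu> < potential n \<mu>}"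
  obtain m where m: "\<mu> = m + single i (lookup \<mu> i) + single j (lookup \<mu> j)" "lookup m i = 0" "lookup m j = 0"
    using exponent_pair[OF ij(3)] by blast
  define X where "X a b = monomial (m + single i a + single j b)" for a b
  have X: "X a b \<in> ?S"
    if "potential_term n i a + potential_term n j b < potential_term n i (lookup \<mu> i) + potential_term n j (lookup \<mu> j)" for a b
    unfolding X_def using that potential_pair[OF ij m(2,3)] m(1)
    by (intro support_in_monomial) (metis (no_types, lifting) add.assoc add_less_cancel_left mem_Collect_eq)
  have \<mu>: "monomial \<mu> = X (lookup \<mu> i) (lookup \<mu> j)" unfolding X_def by (rule arg_cong[OF m(1)])
  have Vi: "Var i * X a b = X (Suc a) b" and Vj: "Var j * X a b = X a (Suc b)" for a b
  proof -
    have suc: "single l (Suc e) = single l e + single l 1" for l e :: nat by (simp flip: single_add)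
    show "Var i * X a b = X (Suc a) b" "Var j * X a b = X a (Suc b)"
      unfolding X_def Var_mult_monomial suc by (simp_all only: ac_simps)
  qed
  have n: "i \<le> n" "j \<le> n" using ij by auto
  show ?thesis
  proof (cases "lookup \<mu> j \<le> lookup \<mu> i")
    case True
    define c where "c = lookup \<mu> j"
    obtain k where k: "lookup \<mu> i = c + k" using True le_Suc_ex unfolding c_def by blast
    have dd: "divided_difference i j (monomial \<mu>) = (\<Sum>t<k. X (c + t) (c + (k - Suc t)))"
      unfolding \<mu> k c_def[symmetric] unfolding X_def by (rule divided_difference_pair(1)[OF ij(3) m(2,3)])
    have less: "X (c + s) (c + u) \<in> ?S" if "int i < 2 * int n * int s + int j" "0 < u" "s + u = k" for s u
      by (rule X) (use potential_term_less_left[OF that(1,2), of c] that(3) in \<open>simp add: k c_def[symmetric]\<close>)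
    show ?thesis
    proof (cases "j < i")
      case ji: True
      have "Var i * divided_difference i j (monomial \<mu>) = (\<Sum>t<k. X (c + Suc t) (c + (k - Suc t)))"
        by (simp add: dd sum_distrib_left Vi)
      moreover have "(\<Sum>t<k. X (c + Suc t) (c + (k - Suc t))) - Const (if beats \<mu> i j then 1 else 0) * monomial \<mu> \<in> ?S"
      proof (cases k)
        case 0
        then show ?thesis using k ji by (simp add: beats_def c_def)
      next
        case (Suc k')
        \<comment> \<open>The summand \<open>t = k'\<close> is x^\<mu> itself and is left out
          here.\<close>
        have "(\<Sum>t<k'. X (c + Suc t) (c + (k - Suc t))) \<in> ?S"
        proof (rule support_in_sum, rule less)
          fix t assume t: "t \<in> {..<k'}"
          have "2 * int n * int (Suc t) = 2 * int n + 2 * (int n * int t)" by (simp add: algebra_simps)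
          moreover have "0 \<le> int n * int t" "int i \<le> int n" "0 < int j" using n ij(2) by auto
          ultimately show "int i < 2 * int n * int (Suc t) + int j" by linarith
          show "0 < k - Suc t" "Suc t + (k - Suc t) = k" using t Suc by auto
        qed
        moreover have "beats \<mu> i j" using ji k Suc by (simp add: beats_def c_def)
        moreover have "monomial \<mu> = X (c + Suc k') c" unfolding \<mu> k Suc c_def ..
        ultimately show ?thesis unfolding Suc by simp
      qed
      ultimately show ?thesis using ji by (simp add: exchange_def)
    next
      case False
      then have ij': "i < j" using ij(3) by simp
      \<comment> \<open>The summand \<open>t = 0\<close> is the transposed monomial, lower because i
        < j. The diagonal term comes from the separate summand of
        \<open>exchange False\<close>.\<close>
      have "Var j * divided_difference i j (monomial \<mu>) = (\<Sum>t<k. X (c + t) (c + (k - t)))"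
        unfolding dd sum_distrib_left Vj by (rule sum.cong) (auto simp: Suc_diff_Suc simp flip: add_Suc_right)
      also have "\<dots> \<in> ?S"
      proof (rule support_in_sum, rule less)
        fix t assume t: "t \<in> {..<k}"
        have "0 \<le> 2 * int n * int t" by simp
        then show "int i < 2 * int n * int t + int j" using ij' by linarith
      qed auto
      finally show ?thesis using ij' k by (simp add: exchange_def beats_def c_def)
    qed
  next
    case False
    define c where "c = lookup \<mu> i"
    obtain k where k: "lookup \<mu> j = c + Suc k"
      using False less_iff_Suc_add[of "lookup \<mu> i" "lookup \<mu> j"] unfolding c_def by auto
    have dd: "divided_difference i j (monomial \<mu>) = - (\<Sum>t<Suc k. X (c + t) (c + (Suc k - Suc t)))"
      unfolding \<mu> k c_def[symmetric] unfolding X_def by (rule divided_difference_pair(2)[OF ij(3) m(2,3)])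
    have less: "X (c + s) (c + u) \<in> ?S" if "int j < 2 * int n * int u + int i" "0 < s" "s + u = Suc k" for s u
      by (rule X) (use potential_term_less_right[OF that(1,2), of c] that(3) in \<open>simp add: k c_def[symmetric]\<close>)
    have nb: "\<not> beats \<mu> i j" using False by (simp add: beats_def)
    show ?thesis
    proof (cases "j < i")
      case ji: True
      have "Var i * divided_difference i j (monomial \<mu>) = - (\<Sum>t<Suc k. X (c + Suc t) (c + (Suc k - Suc t)))"
        unfolding dd mult_minus_right sum_distrib_left Vi by simp
      also have "\<dots> \<in> ?S"
      proof (rule support_in_uminus, rule support_in_sum, rule less)
        fix t assume t: "t \<in> {..<Suc k}"
        have "0 \<le> 2 * int n * int (Suc k - Suc t)" by simp
        then show "int j < 2 * int n * int (Suc k - Suc t) + int i" using ji by linarith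
      qed auto
      finally show ?thesis using ji nb by (simp add: exchange_def)
    next
      case False
      then have ij': "i < j" using ij(3) by simp
      have "Var j * divided_difference i j (monomial \<mu>) = - (\<Sum>t<Suc k. X (c + t) (c + (Suc k - t)))"
        unfolding dd mult_minus_right sum_distrib_left Vj
        by (rule arg_cong[of _ _ uminus], rule sum.cong, rule refl, rule arg_cong2[of _ _ _ _ X]) auto
      moreover have "monomial \<mu> = X c (c + Suc k)" unfolding \<mu> k c_def ..
      \<comment> \<open>The summand \<open>t = 0\<close> is x^\<mu> with a minus sign and cancels
        the added monomial.\<close>
      ultimately have eq: "Var j * divided_difference i j (monomial \<mu>) + monomial \<mu> = - (\<Sum>t<k. X (c + Suc t) (c + (k - t)))"
        unfolding sum.lessThan_Suc_shift by simp
      have "- (\<Sum>t<k. X (c + Suc t) (c + (k - t))) \<in> ?S"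
      proof (rule support_in_uminus, rule support_in_sum, rule less)
        fix t assume t: "t \<in> {..<k}"
        have "2 * int n * 1 \<le> 2 * int n * int (k - t)" using t by (intro mult_left_mono) auto
        moreover have "int j \<le> int n" "0 < int i" using n ij(1) by auto
        ultimately show "int j < 2 * int n * int (k - t) + int i" by linarith
      qed auto
      then show ?thesis using ij' nb eq by (simp add: exchange_def)
    qed
  qed
qed

text \<open>The diagonal terms of the pairs add up to r times \<open>nbeats n \<mu> i\<close>, and
  \<open>euler\<close> adds \<mu>_i: together the spectral coordinate.\<close>

lemma cherednik_triangular:
  assumes i: "i \<in> {1..n}"
  shows "cherednik n i (monomial \<mu>) - Const (- point n \<mu> i) * monomial \<mu>
    \<in> support_in {\<nu>. potential n \<nu> < potential n \<mu>}"
proof -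
  let ?e = "\<lambda>j. if beats \<mu> i j then 1 else 0 :: ratfun"
  have "(\<Sum>j\<in>{1..n} - {i}. ?e j) = (\<Sum>j\<in>{j \<in> {1..n}. beats \<mu> i j}. 1)"
    by (rule sum.mono_neutral_cong_right) (auto simp: beats_irrefl)
  then have e: "(\<Sum>j\<in>{1..n} - {i}. ?e j) = of_nat (nbeats n \<mu> i)" by (simp add: nbeats_def)
  have "Const (\<Sum>j\<in>J. ?e j) = (\<Sum>j\<in>J. Const (?e j))" for J
    by (induction J rule: infinite_finite_induct) (simp_all add: Const_add)
  then have "cherednik n i (monomial \<mu>) - Const (- point n \<mu> i) * monomial \<mu>
      = Const r * (\<Sum>j\<in>{1..n} - {i}. exchange (j < i) i j (monomial \<mu>) - Const (?e j) * monomial \<mu>)"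
    unfolding cherednik_def euler_monomial point_eq[OF i] minus_minus e[symmetric] sum_subtractf sum_distrib_right[symmetric]
    by (simp add: Const_add Const_mult algebra_simps)
  moreover have "\<dots> \<in> support_in {\<nu>. potential n \<nu> < potential n \<mu>}"
    by (intro support_in_Const_mult support_in_sum exchange_triangular) (use i in auto)
  ultimately show ?thesis by simp
qed

text \<open>A monomial of maximal potential in \<open>f\<close> receives no off-diagonal
  contribution, so its diagonal entries are the eigenvalues of \<open>f\<close>. Since points
  determine compositions, this monomial is x^\<eta>.\<close>

lemma eigenfunction_leading_coeff:
  assumes f: "f \<in> homogeneous n d" "f \<noteq> 0" and \<eta>: "\<eta> \<in> compositions n"
    and eig: "\<And>i. i \<in> {1..n} \<Longrightarrow> cherednik n i f = Const (- point n \<eta> i) * f"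
  shows "lookup f \<eta> \<noteq> 0"
proof -
  have "keys f \<noteq> {}" using f(2) by simp
  then have "Max (potential n ` keys f) \<in> potential n ` keys f" by (intro Max_in) auto
  then obtain \<mu> where \<mu>: "\<mu> \<in> keys f" "potential n \<mu> = Max (potential n ` keys f)" by auto
  have max: "potential n \<nu> \<le> potential n \<mu>" if "\<nu> \<in> keys f" for \<nu>
    unfolding \<mu>(2) using that by (intro Max_ge) auto
  have "point n \<mu> i = point n \<eta> i" if i: "i \<in> {1..n}" for i
  proof -
    have summand: "lookup (cherednik n i (monomial \<nu>)) \<mu> = (if \<nu> = \<mu> then - point n \<mu> i else 0)" if "\<nu> \<in> keys f" for \<nu>
    proof -
      have "lookup (cherednik n i (monomial \<nu>) - Const (- point n \<nu> i) * monomial \<nu>) \<mu> = 0"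
        using support_inD[OF cherednik_triangular[OF i, of \<nu>], of \<mu>] max[OF that] by force
      then show ?thesis by (auto simp: lookup_add Const_uminus lookup_monomial eq_neg_iff_add_eq_0)
    qed
    have "lookup (cherednik n i f) \<mu> = (\<Sum>\<nu>\<in>keys f. lookup f \<nu> * lookup (cherednik n i (monomial \<nu>)) \<mu>)"
      by (subst linear_op_expand[OF linear_op_cherednik]) (simp add: lookup_sum)
    also have "\<dots> = (\<Sum>\<nu>\<in>keys f. if \<nu> = \<mu> then lookup f \<mu> * - point n \<mu> i else 0)"
      by (rule sum.cong) (simp_all add: summand)
    also have "\<dots> = lookup f \<mu> * - point n \<mu> i" using \<mu>(1) by simp
    finally have "- point n \<eta> i * lookup f \<mu> = lookup f \<mu> * - point n \<mu> i" by (simp add: eig[OF i])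
    then show ?thesis using \<mu>(1) by (simp add: in_keys_iff)
  qed
  then have "\<mu> = \<eta>"
    using \<mu>(1) f(1) \<eta> by (intro point_inject[of _ n]) (auto simp: support_in_def comps_of_weight_def)
  then show ?thesis using \<mu>(1) by (simp add: in_keys_iff)
qed

lemma lift_Var:
  assumes n: "1 \<le> n" and p: "p \<in> polys n" and i: "i \<in> {1..n}"
  shows "lift n (Var i * p) = Var i * lift n p + lift n (cherednik n i p)"
proof (rule linear_op_eq[OF _ _ _ p[unfolded polys_eq]])
  show "linear_op (\<lambda>p. lift n (Var i * p))"
    by (intro linear_op_comp[OF linear_op_lift] linear_op_mult linear_op_id)
  show "linear_op (\<lambda>p. Var i * lift n p + lift n (cherednik n i p))"
    by (intro linear_op_plus linear_op_mult linear_op_comp[OF linear_op_lift] linear_op_lift linear_op_cherednik)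
qed (rule lift_Var_monomial[OF n _ i])

lemma homogeneous_polys_below_0: "p \<in> homogeneous n d \<Longrightarrow> p \<in> polys_below n d \<Longrightarrow> p = 0"
  by (rule poly_mapping_eqI) (force dest: support_inD simp: comps_of_weight_def comps_below_def)

lemma lift_eq_0: "p \<in> homogeneous n d \<Longrightarrow> lift n p = 0 \<Longrightarrow> p = 0"
  using lift_top[of p n d] support_in_uminus[of "- p"] by (auto intro: homogeneous_polys_below_0)

lemma homogeneous_part_exists:
  assumes "p \<in> polys_below n (Suc d)"
  obtains f where "f \<in> homogeneous n d" "p - f \<in> polys_below n d"
proof
  define f where "f = (\<Sum>m\<in>keys p \<inter> comps_of_weight n d. Const (lookup p m) * monomial m)"
  show "f \<in> homogeneous n d"
    unfolding f_def by (intro support_in_sum support_in_Const_mult support_in_monomial) auto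
  have "p = (\<Sum>m\<in>keys p \<inter> comps_of_weight n d. Const (lookup p m) * monomial m)
      + (\<Sum>m\<in>keys p - comps_of_weight n d. Const (lookup p m) * monomial m)"
    by (subst sum.Int_Diff[of "keys p" _ "comps_of_weight n d", symmetric]) (simp_all flip: mpoly_expand)
  then have "p - f = (\<Sum>m\<in>keys p - comps_of_weight n d. Const (lookup p m) * monomial m)"
    unfolding f_def by (simp add: algebra_simps)
  also have "\<dots> \<in> polys_below n d"
    using assms by (intro support_in_sum support_in_Const_mult support_in_monomial)
      (auto simp: support_in_def comps_below_Suc)
  finally show "p - f \<in> polys_below n d" .
qed

text \<open>\<open>f\<close> is the top component of the Lagrange polynomial \<open>p\<close> of
  \<eta>, whose lift is \<open>p\<close>. The lift of x_i f vanishes at all points of weight at most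
  \<open>d\<close>, so there the lift of Y_i f takes the values of \<open>p\<close> times minus the
  coordinate. As \<open>p\<close> is nonzero only at \<eta>, \<open>f\<close> is an eigenfunction;
  only this shows that its coefficient at \<eta> is nonzero and can be normalized.\<close>

lemma nonsymmetric_jack_exists:
  assumes n: "1 \<le> n" and \<eta>: "\<eta> \<in> comps_of_weight n d"
  obtains f where "f \<in> homogeneous n d" "lookup f \<eta> = 1"
    "\<And>\<gamma>. \<gamma> \<in> comps_of_weight n d \<Longrightarrow> \<gamma> \<noteq> \<eta> \<Longrightarrow> eval_at (point n \<gamma>) (lift n f) = 0"
    "eval_at (point n \<eta>) (lift n f) \<noteq> 0"
proof -
  obtain p where p: "p \<in> polys_below n (Suc d)"
    and val: "\<And>\<gamma>. \<gamma> \<in> comps_below n (Suc d) \<Longrightarrow> eval_at (point n \<gamma>) p = (if \<gamma> = \<eta> then 1 else 0)"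
    using interpolation_exists[of n "Suc d" "\<lambda>\<gamma>. if \<gamma> = \<eta> then 1 else 0"] by blast
  obtain f where f: "f \<in> homogeneous n d" "p - f \<in> polys_below n d" using homogeneous_part_exists[OF p] .
  have "is_lift n d f p"
    using f(2) val \<eta> by (auto simp: is_lift_def comps_below_def comps_of_weight_def)
  then have lift_f: "lift n f = p" by (rule lift_eqI[OF f(1)])
  have \<eta>': "\<eta> \<in> comps_below n (Suc d)" using \<eta> by (simp add: comps_below_Suc)
  have "f \<noteq> 0"
    using lift_f val[OF \<eta>'] by (auto simp: lift_simps)
  moreover have "cherednik n i f = Const (- point n \<eta> i) * f" if i: "i \<in> {1..n}" for i
  proof -
    note cf = cherednik_homogeneous[OF i f(1)]
    have "lift n (cherednik n i f) = Const (- point n \<eta> i) * p"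
    proof -
      have "lift n (cherednik n i f) - Const (- point n \<eta> i) * p \<in> polys_below n (Suc d)"
        by (intro support_in_diff support_in_Const_mult lift_polys_below cf p)
      moreover have "eval_at (point n \<gamma>) (lift n (cherednik n i f) - Const (- point n \<eta> i) * p) = 0"
        if \<gamma>: "\<gamma> \<in> comps_below n (Suc d)" for \<gamma>
      proof -
        have "eval_at (point n \<gamma>) (lift n (Var i * f)) = 0"
          by (rule lift_vanishes[OF homogeneous_Var_mult[OF i f(1)] \<gamma>])
        then have "eval_at (point n \<gamma>) (lift n (cherednik n i f)) = - (point n \<gamma> i * eval_at (point n \<gamma>) p)"
          unfolding lift_Var[OF n homogeneous_polys[OF f(1)] i] lift_f by (simp add: eq_neg_iff_add_eq_0 add.commute)
        then show ?thesis using val[OF \<gamma>] by simp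
      qed
      ultimately have "lift n (cherednik n i f) - Const (- point n \<eta> i) * p = 0"
        by (rule interpolation_unique)
      then show ?thesis by (simp only: right_minus_eq)
    qed
    then have "lift n (cherednik n i f - Const (- point n \<eta> i) * f) = 0"
      unfolding lift_simps lift_f by simp
    moreover have "cherednik n i f - Const (- point n \<eta> i) * f \<in> homogeneous n d"
      by (intro support_in_diff support_in_Const_mult cf f(1))
    ultimately have "cherednik n i f - Const (- point n \<eta> i) * f = 0" by (rule lift_eq_0[rotated])
    then show ?thesis by (simp only: right_minus_eq)
  qed
  ultimately have c: "lookup f \<eta> \<noteq> 0"
    using f(1) \<eta> by (intro eigenfunction_leading_coeff) (auto simp: comps_of_weight_def)
  show thesis
  proof (rule that[of "Const (1 / lookup f \<eta>) * f"])
    show "Const (1 / lookup f \<eta>) * f \<in> homogeneous n d" by (rule support_in_Const_mult[OF f(1)])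
    show "lookup (Const (1 / lookup f \<eta>) * f) \<eta> = 1" using c by simp
    show "eval_at (point n \<gamma>) (lift n (Const (1 / lookup f \<eta>) * f)) = 0"
      if "\<gamma> \<in> comps_of_weight n d" "\<gamma> \<noteq> \<eta>" for \<gamma>
      using that val by (simp add: lift_simps lift_f comps_below_Suc)
    show "eval_at (point n \<eta>) (lift n (Const (1 / lookup f \<eta>) * f)) \<noteq> 0"
      using c val[OF \<eta>'] by (simp add: lift_simps lift_f)
  qed
qed

section \<open>Sign changes and the identification of the interpolation polynomials\<close>

lemma negate_vars_sub: "negate_vars = sub (\<lambda>i. - Var i)"
  by (simp add: negate_vars_def fun_eq_iff)

lemma linear_op_negate_vars: "linear_op negate_vars"
  unfolding negate_vars_sub by (rule linear_op_sub)

lemma negate_vars_monomial: "negate_vars (monomial m) = Const ((- 1) ^ weight m) * monomial m"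
proof -
  have pm: "Const ((- 1) ^ a) = (- 1) ^ a" for a
    by (induction a) (simp_all add: Const_mult Const_uminus)
  have "eval_monomial (\<lambda>i. - Var i) m = (\<Prod>i\<in>keys m. (- 1) ^ lookup m i * Var i ^ lookup m i)"
    unfolding eval_monomial_def by (rule prod.cong[OF refl power_minus])
  also have "\<dots> = (- 1) ^ weight m * eval_monomial Var m"
    by (simp add: prod.distrib eval_monomial_def weight_def power_sum)
  also have "eval_monomial Var m = monomial m"
    using permute_vars_id[of "monomial m"]
    by (simp add: permute_vars_def coefficient_hom.substitute_monomial[OF coefficient_hom_Const])
  finally show ?thesis
    by (simp add: negate_vars_sub coefficient_hom.substitute_monomial[OF coefficient_hom_Const] pm)
qed

lemma lookup_negate_vars: "lookup (negate_vars p) m = (- 1) ^ weight m * lookup p m"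
proof -
  have "lookup (negate_vars p) m = (\<Sum>k\<in>keys p. if k = m then (- 1) ^ weight m * lookup p m else 0)"
    unfolding linear_op_expand[OF linear_op_negate_vars, of p] lookup_sum
    by (rule sum.cong) (simp_all add: negate_vars_monomial lookup_monomial)
  then show ?thesis by (simp add: in_keys_iff)
qed

lemma negate_vars_negate_vars [simp]: "negate_vars (negate_vars p) = p"
  by (rule poly_mapping_eqI) (simp add: lookup_negate_vars flip: mult.assoc power_mult_distrib)

lemma negate_vars_support_in: "p \<in> support_in S \<Longrightarrow> negate_vars p \<in> support_in S"
  by (auto intro!: support_inI dest: support_inD simp: lookup_negate_vars)

lemma eval_at_negate_vars: "eval_at v (negate_vars p) = eval_at (\<lambda>i. - v i) p"
  by (simp add: negate_vars_sub eval_at_sub)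

lemma total_degree_eqI:
  assumes "p \<in> polys_below n (Suc d)" "lookup p \<eta> \<noteq> 0" "weight \<eta> = d"
  shows "total_degree p = d"
  unfolding total_degree_def
proof (rule Max_eqI)
  show "y \<le> d" if "y \<in> insert 0 (weight ` keys p)" for y
    using that assms(1) by (auto simp: support_in_def comps_below_def)
  show "d \<in> insert 0 (weight ` keys p)" using assms(2,3) by (auto simp: in_keys_iff)
qed simp

lemma polys_below_total_degree: "p \<in> polys n \<Longrightarrow> p \<in> polys_below n (Suc (total_degree p))"
  unfolding polys_def support_in_def comps_below_def total_degree_def
  by (auto simp: less_Suc_eq_le intro!: Max_ge)

lemma lookup_homogeneous_component:
  "lookup (homogeneous_component d p) m = (if weight m = d then lookup p m else 0)"
proof -
  have "lookup (homogeneous_component d p) m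
      = (\<Sum>k | k \<in> keys p \<and> weight k = d. if k = m then lookup p m else 0)"
    unfolding homogeneous_component_def coeff_of_def lookup_sum
    by (rule sum.cong) (simp_all add: lookup_monomial)
  then show ?thesis by (simp add: in_keys_iff)
qed

text \<open>Resolves the definite description. The witness is the lift of the normalized
  eigenfunction with all variables negated; the factor (-1)^|\<eta>| restores its top
  component.\<close>

lemma interp_poly_jack:
  assumes n: "1 \<le> n" and \<eta>: "\<eta> \<in> compositions n"
  shows jack_poly_homogeneous: "jack_poly n \<eta> \<in> homogeneous n (weight \<eta>)"
    and interp_poly_eq: "interp_poly n \<eta> = Const ((- 1) ^ weight \<eta>) * negate_vars (lift n (jack_poly n \<eta>))"
    and lift_jack_vanishes: "\<And>\<gamma>. \<gamma> \<in> comps_of_weight n (weight \<eta>) \<Longrightarrow> \<gamma> \<noteq> \<eta> \<Longrightarrow>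
      eval_at (point n \<gamma>) (lift n (jack_poly n \<eta>)) = 0"
    and lift_jack_nonzero: "eval_at (point n \<eta>) (lift n (jack_poly n \<eta>)) \<noteq> 0"
proof -
  define d where "d = weight \<eta>"
  have \<eta>d: "\<eta> \<in> comps_of_weight n d" using \<eta> by (simp add: comps_of_weight_def d_def)
  obtain f where f: "f \<in> homogeneous n d" "lookup f \<eta> = 1"
    "\<And>\<gamma>. \<gamma> \<in> comps_of_weight n d \<Longrightarrow> \<gamma> \<noteq> \<eta> \<Longrightarrow> eval_at (point n \<gamma>) (lift n f) = 0"
    "eval_at (point n \<eta>) (lift n f) \<noteq> 0"
    using nonsymmetric_jack_exists[OF n \<eta>d] by blast
  define s where "s = ((- 1) ^ d :: ratfun)"
  have s: "s * s = 1" by (simp add: s_def flip: power_mult_distrib)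
  define P where "P = Const s * negate_vars (lift n f)"
  have P: "P \<in> polys_below n (Suc d)"
    unfolding P_def by (intro support_in_Const_mult negate_vars_support_in lift_polys_below f(1))
  have top: "lookup (lift n f) m = lookup f m" if "weight m = d" for m
    using support_inD[OF lift_top[OF f(1)], of m] that by (force simp: lookup_minus comps_below_def)
  have P_top: "lookup P m = lookup f m" if "weight m = d" for m
    using s by (simp add: P_def lookup_negate_vars that top s_def flip: mult.assoc)
  have P_eval: "eval_at (spectral_vector n \<gamma>) P = s * eval_at (point n \<gamma>) (lift n f)" for \<gamma>
    by (simp add: P_def eval_at_negate_vars point_def[abs_def])
  have P_zero: "eval_at (spectral_vector n \<gamma>) P = 0" if "\<gamma> \<in> compositions n" "\<gamma> \<noteq> \<eta>" "weight \<gamma> \<le> d" for \<gamma>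
    unfolding P_eval using that f(3) lift_vanishes[OF f(1), of \<gamma>]
    by (cases "weight \<gamma> = d") (auto simp: comps_of_weight_def comps_below_def)
  have interp: "interp_poly n \<eta> = P"
    unfolding interp_poly_def
  proof (rule the_equality)
    show "P \<in> polys n \<and> total_degree P = weight \<eta> \<and>
        (\<forall>\<gamma>\<in>compositions n. \<gamma> \<noteq> \<eta> \<and> weight \<gamma> \<le> weight \<eta> \<longrightarrow> eval_at (spectral_vector n \<gamma>) P = 0) \<and>
        coeff_of P \<eta> = 1"
      using P_zero polys_below_polys[OF P] P_top[of \<eta>] f(2) total_degree_eqI[OF P, of \<eta>]
      by (simp add: d_def coeff_of_def)
  next
    fix p
    assume p: "p \<in> polys n \<and> total_degree p = weight \<eta> \<and>
        (\<forall>\<gamma>\<in>compositions n. \<gamma> \<noteq> \<eta> \<and> weight \<gamma> \<le> weight \<eta> \<longrightarrow> eval_at (spectral_vector n \<gamma>) p = 0) \<and>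
        coeff_of p \<eta> = 1"
    then have pb: "p \<in> polys_below n (Suc d)" using polys_below_total_degree[of p n] by (simp add: d_def)
    \<comment> \<open>Chosen to match the values at \<eta>, the only point of weight at most
      \<open>d\<close> where they may be nonzero. Then p - a P vanishes at all these points, and the
      coefficient at \<eta> forces \<open>a = 1\<close>.\<close>
    define a where "a = eval_at (spectral_vector n \<eta>) p / eval_at (spectral_vector n \<eta>) P"
    have nz: "eval_at (spectral_vector n \<eta>) P \<noteq> 0" using f(4) s by (auto simp: P_eval)
    have "negate_vars (p - Const a * P) = 0"
    proof (rule interpolation_unique)
      show "negate_vars (p - Const a * P) \<in> polys_below n (Suc d)"
        by (intro negate_vars_support_in support_in_diff support_in_Const_mult pb P)
      fix \<gamma> assume \<gamma>: "\<gamma> \<in> comps_below n (Suc d)"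
      have "eval_at (spectral_vector n \<gamma>) (p - Const a * P) = 0"
        using \<gamma> p P_zero[of \<gamma>] nz by (cases "\<gamma> = \<eta>") (auto simp: a_def comps_below_def d_def)
      then show "eval_at (point n \<gamma>) (negate_vars (p - Const a * P)) = 0"
        by (simp only: eval_at_negate_vars point_def minus_minus)
    qed
    then have "p - Const a * P = 0"
      using negate_vars_negate_vars[of "p - Const a * P"] by (simp add: linear_op_0[OF linear_op_negate_vars])
    then have pP: "p = Const a * P" by simp
    then have "a = 1" using p P_top[of \<eta>] f(2) by (simp add: coeff_of_def d_def)
    then show "p = P" using pP by simp
  qed
  have jack: "jack_poly n \<eta> = f"
  proof (rule poly_mapping_eqI)
    fix m
    show "lookup (jack_poly n \<eta>) m = lookup f m"
      using support_inD[OF f(1), of m] P_top[of m]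
      by (auto simp: jack_poly_def interp lookup_homogeneous_component comps_of_weight_def d_def)
  qed
  show "jack_poly n \<eta> \<in> homogeneous n (weight \<eta>)"
    "interp_poly n \<eta> = Const ((- 1) ^ weight \<eta>) * negate_vars (lift n (jack_poly n \<eta>))"
    "\<And>\<gamma>. \<gamma> \<in> comps_of_weight n (weight \<eta>) \<Longrightarrow> \<gamma> \<noteq> \<eta> \<Longrightarrow> eval_at (point n \<gamma>) (lift n (jack_poly n \<eta>)) = 0"
    "eval_at (point n \<eta>) (lift n (jack_poly n \<eta>)) \<noteq> 0"
    using f interp by (simp_all add: jack P_def s_def d_def)
qed

lemma lift_F_jack:
  assumes n: "1 \<le> n" and \<eta>: "\<eta> \<in> compositions n"
  shows "lift n (F_jack n \<eta>) = F_interp n \<eta>"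
proof -
  let ?s = "(- 1) ^ weight \<eta> :: ratfun" and ?d = "d_factor n \<eta> (1 / r)"
  let ?L = "lift n (jack_poly n \<eta>)"
  have "?s * ?s = 1" by (simp flip: power_mult_distrib)
  then have s: "Const ?s * Const ?s = 1" by (simp flip: Const_mult)
  have "F_interp n \<eta> = Const (?s * ?d) * (Const ?s * ?L)"
    by (simp add: F_interp_def interp_poly_eq[OF n \<eta>] linear_op_Const[OF linear_op_negate_vars])
  also have "\<dots> = (Const ?s * Const ?s) * (Const ?d * ?L)" by (simp only: Const_mult mult_ac)
  also have "\<dots> = lift n (F_jack n \<eta>)" unfolding s by (simp add: F_jack_def lift_simps)
  finally show ?thesis ..
qed

lemma F_jack_polys:
  assumes n: "1 \<le> n" and \<eta>: "\<eta> \<in> compositions n"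
  shows "F_jack n \<eta> \<in> polys n"
  unfolding F_jack_def
  using homogeneous_polys[OF support_in_Const_mult[OF jack_poly_homogeneous[OF n \<eta>]]] .

text \<open>On the points of weight \<open>d\<close> the lifted Jack polynomials are nonzero
  multiples of delta functions, so the coefficients are quotients of values. The lift of the
  remainder vanishes at all points of weight at most \<open>d\<close>, and \<open>lift\<close> is
  injective on homogeneous polynomials.\<close>

lemma homogeneous_F_jack_expansion:
  assumes n: "1 \<le> n" and f: "f \<in> homogeneous n d"
  obtains c where "f = (\<Sum>\<eta>\<in>comps_of_weight n d. Const (c \<eta>) * F_jack n \<eta>)"
proof -
  let ?C = "comps_of_weight n d" and ?J = "jack_poly n"
  have J: "?J \<eta> \<in> homogeneous n d" if "\<eta> \<in> ?C" for \<eta>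
    using jack_poly_homogeneous[OF n, of \<eta>] that by (simp add: comps_of_weight_def)
  define a where "a \<eta> = eval_at (point n \<eta>) (lift n f) / eval_at (point n \<eta>) (lift n (?J \<eta>))" for \<eta>
  define g where "g = f - (\<Sum>\<eta>\<in>?C. Const (a \<eta>) * ?J \<eta>)"
  have g: "g \<in> homogeneous n d"
    unfolding g_def by (intro support_in_diff f support_in_sum support_in_Const_mult J)
  have "lift n g = 0"
  proof (rule interpolation_unique[OF lift_polys_below[OF g]])
    fix \<gamma> assume "\<gamma> \<in> comps_below n (Suc d)"
    then consider "\<gamma> \<in> comps_below n d" | "\<gamma> \<in> ?C" by (auto simp: comps_below_Suc)
    then show "eval_at (point n \<gamma>) (lift n g) = 0"
    proof cases
      case 1
      then show ?thesis by (rule lift_vanishes[OF g])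
    next
      case 2
      have "eval_at (point n \<gamma>) (Const (a \<eta>) * lift n (?J \<eta>))
          = (if \<eta> = \<gamma> then eval_at (point n \<gamma>) (lift n f) else 0)" if "\<eta> \<in> ?C" for \<eta>
        using that 2 lift_jack_vanishes[OF n, of \<eta> \<gamma>] lift_jack_nonzero[OF n, of \<eta>]
        by (auto simp: a_def comps_of_weight_def)
      then have "eval_at (point n \<gamma>) (\<Sum>\<eta>\<in>?C. Const (a \<eta>) * lift n (?J \<eta>)) = eval_at (point n \<gamma>) (lift n f)"
        using 2 by (simp add: eval_at_sum del: eval_at_simps(6))
      then show ?thesis
        by (simp add: g_def lift_simps linear_op_sum[OF linear_op_lift])
    qed
  qed
  then have "g = 0" by (rule lift_eq_0[OF g])
  then have "f = (\<Sum>\<eta>\<in>?C. Const (a \<eta>) * ?J \<eta>)" by (simp add: g_def)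
  also have "\<dots> = (\<Sum>\<eta>\<in>?C. Const (a \<eta> / d_factor n \<eta> (1 / r)) * F_jack n \<eta>)"
    by (rule sum.cong) (simp_all add: F_jack_def d_factor_nonzero flip: mult.assoc Const_mult)
  finally show thesis by (rule that)
qed

lemma linear_on_polys_sum:
  assumes add: "\<And>p q. p \<in> polys n \<Longrightarrow> q \<in> polys n \<Longrightarrow> \<Xi> (p + q) = \<Xi> p + \<Xi> q"
    and scale: "\<And>c p. p \<in> polys n \<Longrightarrow> \<Xi> (Const c * p) = Const c * \<Xi> p"
    and g: "\<And>i. i \<in> A \<Longrightarrow> g i \<in> polys n"
  shows "\<Xi> (\<Sum>i\<in>A. Const (c i) * g i) = (\<Sum>i\<in>A. Const (c i) * \<Xi> (g i))"
  using g
proof (induction A rule: infinite_finite_induct)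
  case (insert x A)
  have "Const (c x) * g x \<in> polys n" "(\<Sum>i\<in>A. Const (c i) * g i) \<in> polys n"
    using insert.prems unfolding polys_eq by (auto intro: support_in_sum support_in_Const_mult)
  then show ?case using insert by (simp add: add scale)
qed (use scale[of 0 0] in \<open>simp_all add: polys_eq\<close>)

text \<open>Any candidate agrees with \<open>lift\<close> on each \<open>F_jack\<close>, hence on
  monomials by the expansion, hence on \<open>polys n\<close>; extensionality settles the rest of
  the type.\<close>

theorem dehomogenization_eq_lift:
  assumes n: "1 \<le> n"
  shows "dehomogenization n = restrict (lift n) (polys n)"
  unfolding dehomogenization_def
proof (rule the_equality)
  have "lift n p \<in> polys n" if "p \<in> polys n" for p
    unfolding polys_eq
  proof (rule linear_op_support_in[OF linear_op_lift _ that[unfolded polys_eq]])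
    fix m assume "m \<in> compositions n"
    then show "lift n (monomial m) \<in> support_in (compositions n)"
      using polys_below_polys[OF lift_polys_below[OF homogeneous_monomial]] by (simp add: polys_eq)
  qed
  moreover have "p + q \<in> polys n" "Const c * p \<in> polys n" if "p \<in> polys n" "q \<in> polys n" for p q c
    using that unfolding polys_eq by (auto intro: support_in_add support_in_Const_mult)
  ultimately show "restrict (lift n) (polys n) \<in> polys n \<rightarrow>\<^sub>E polys n \<and>
     (\<forall>p\<in>polys n. \<forall>q\<in>polys n. restrict (lift n) (polys n) (p + q)
        = restrict (lift n) (polys n) p + restrict (lift n) (polys n) q) \<and>
     (\<forall>c. \<forall>p\<in>polys n. restrict (lift n) (polys n) (Const c * p) = Const c * restrict (lift n) (polys n) p) \<and>
     (\<forall>\<eta>\<in>compositions n. restrict (lift n) (polys n) (F_jack n \<eta>) = F_interp n \<eta>)"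
    by (auto simp: lift_simps lift_F_jack[OF n] F_jack_polys[OF n])
next
  fix \<Xi> assume \<Xi>: "\<Xi> \<in> polys n \<rightarrow>\<^sub>E polys n \<and>
     (\<forall>p\<in>polys n. \<forall>q\<in>polys n. \<Xi> (p + q) = \<Xi> p + \<Xi> q) \<and>
     (\<forall>c. \<forall>p\<in>polys n. \<Xi> (Const c * p) = Const c * \<Xi> p) \<and>
     (\<forall>\<eta>\<in>compositions n. \<Xi> (F_jack n \<eta>) = F_interp n \<eta>)"
  have sum: "\<Xi> (\<Sum>i\<in>A. Const (c i) * g i) = (\<Sum>i\<in>A. Const (c i) * \<Xi> (g i))"
    if "\<And>i. i \<in> A \<Longrightarrow> g i \<in> polys n" for A :: "expo set" and c g
    using \<Xi> that by (intro linear_on_polys_sum) blast+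
  have mono: "\<Xi> (monomial m) = lift n (monomial m)" if m: "m \<in> compositions n" for m
  proof -
    let ?C = "comps_of_weight n (weight m)"
    obtain c where c: "monomial m = (\<Sum>\<eta>\<in>?C. Const (c \<eta>) * F_jack n \<eta>)"
      using homogeneous_F_jack_expansion[OF n homogeneous_monomial[OF m]] .
    have "\<Xi> (F_jack n \<eta>) = lift n (F_jack n \<eta>)" if "\<eta> \<in> ?C" for \<eta>
      using \<Xi> that lift_F_jack[OF n] by (simp add: comps_of_weight_def)
    then show ?thesis
      unfolding c by (subst sum)
        (auto simp: linear_op_sum[OF linear_op_lift] lift_simps comps_of_weight_def F_jack_polys[OF n])
  qed
  show "\<Xi> = restrict (lift n) (polys n)"
  proof (rule extensionalityI)
    show "\<Xi> \<in> extensional (polys n)" using \<Xi> by (auto simp: PiE_def)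
    fix p assume p: "p \<in> polys n"
    then have k: "m \<in> compositions n" if "m \<in> keys p" for m using that by (auto simp: polys_def)
    have "\<Xi> p = \<Xi> (\<Sum>m\<in>keys p. Const (lookup p m) * monomial m)" by (simp flip: mpoly_expand)
    also have "\<dots> = (\<Sum>m\<in>keys p. Const (lookup p m) * \<Xi> (monomial m))"
      by (rule sum) (simp add: polys_eq support_in_monomial k)
    also have "\<dots> = lift n p"
      unfolding linear_op_expand[OF linear_op_lift, of n p] by (rule sum.cong) (simp_all add: mono k)
    finally show "\<Xi> p = restrict (lift n) (polys n) p" using p by simp
  qed (rule restrict_extensional)
qed

theorem theoremC:
  fixes n :: nat and \<eta> \<gamma> :: expo
  assumes "n \<ge> 1" and "\<eta> \<in> compositions n" and "\<gamma> \<in> compositions n"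
  shows "\<exists>c :: nat poly. coeff_of (bar_monomial n \<eta>) \<gamma> = nat_poly_ratfun c \<and>
           (c = 0 \<or> int (degree c) \<le> int (weight \<eta>) - int (weight \<gamma>))"
proof -
  have "monomial \<eta> \<in> polys n"
    using assms(2) by (simp add: polys_eq support_in_monomial)
  then have "bar_monomial n \<eta> = lift n (monomial \<eta>)"
    by (simp add: bar_monomial_def dehomogenization_eq_lift[OF assms(1)])
  then show ?thesis
    using lift_monomial_nonneg[OF assms(1,2), of \<gamma>] by (simp add: nonneg_coeff_def coeff_of_def)
qed

end
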